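(* Let $0\le\alpha\le\frac12$, and set $s:=\frac12-\alpha$. Suppose that $\gamma\in H^s(\mathbb T^2)\cap L^\infty(\mathbb T^2)$ is non-negative and satisfies the generalized geometric control condition: there exist $L,c_0>0$ such that $$\liminf_{\delta\to0}\ \inf_{x\in\mathbb T^2}\ \inf_{\nu\in S^1}\ \frac{1}{|\Gamma_{x,\nu,L,\delta}|}\int_{\Gamma_{x,\nu,L,\delta}}\gamma(y)\,dy\ \ge\ c_0 .$$ Then there exists a constant $C>0$, independent of $R$, such that for every $R\ge 1$ and every $f\in L^2(\mathbb T^2)$ with $$\operatorname{supp}\widehat f\subset A_{R,\alpha}\cap\mathbb Z^2$$ one has $$\|f\|_{L^2(\mathbb T^2)}^2\le C\int_{\mathbb T^2}|f(x)|^2\,\gamma(x)\,dx .$$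
   Context: $\mathbb T^2=\mathbb R^2/\mathbb Z^2$ with Lebesgue (Haar probability) measure, and $\widehat f(k)=\int_{\mathbb T^2}f(x)e^{-2\pi i k\cdot x}\,dx$ for $k\in\mathbb Z^2$. $H^s(\mathbb T^2)$ is the $L^2$-based Sobolev space. For $x\in\mathbb T^2$, $\nu\in S^1$ (unit circle in $\mathbb R^2$), $L,\delta>0$, set $\mathcal G_{x,\nu,L}:=\{x+t\nu:0\le t\le L\}\subset\mathbb T^2$ (addition modulo $\mathbb Z^2$) and $\Gamma_{x,\nu,L,\delta}:=\{y\in\mathbb T^2:\operatorname{dist}(y,\mathcal G_{x,\nu,L})<\delta\}$; $|\cdot|$ denotes Lebesgue measure of sets. For $R\ge1$, $A_{R,\alpha}:=\{\xi\in\mathbb R^2: R\le|\xi|\le R+R^{-\alpha}\}$. *)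

theory Defs
  imports "HOL-Analysis.Analysis"
begin

text \<open>Functions on the torus \<open>\<real>\<^sup>2/\<int>\<^sup>2\<close> are represented by their lifts, the
  \<open>\<int>\<^sup>2\<close>-periodic functions on the plane; elements of the Lebesgue and Sobolev spaces are such
  functions rather than almost-everywhere classes. Points of the torus are represented by arbitrary
  points of the plane, and subsets of the torus by subsets of the fundamental domain
  \<open>[0,1) \<times> [0,1)\<close>. The type \<open>real \<times> real\<close> carries the Euclidean norm and inner product.\<close>

definition lattice_point :: "int \<times> int \<Rightarrow> real \<times> real" where
  "lattice_point k = (of_int (fst k), of_int (snd k))"

definition periodic :: "(real \<times> real \<Rightarrow> 'a) \<Rightarrow> bool" where
  "periodic f \<longleftrightarrow> (\<forall>x k. f (x + lattice_point k) = f x)"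

definition torus :: "(real \<times> real) measure" where
  "torus = lebesgue_on ({0..<1} \<times> {0..<1})"

definition L2_torus :: "(real \<times> real \<Rightarrow> complex) set" where
  "L2_torus = {f. periodic f \<and> f \<in> borel_measurable torus \<and>
     integrable torus (\<lambda>x. (norm (f x))\<^sup>2)}"

definition Linf_torus :: "(real \<times> real \<Rightarrow> complex) set" where
  "Linf_torus = {f. periodic f \<and> f \<in> borel_measurable torus \<and>
     (\<exists>M. AE x in torus. norm (f x) \<le> M)}"

definition L2_norm_torus :: "(real \<times> real \<Rightarrow> complex) \<Rightarrow> real" where
  "L2_norm_torus f = sqrt (LINT x|torus. (norm (f x))\<^sup>2)"

definition fourier_coeff :: "(real \<times> real \<Rightarrow> complex) \<Rightarrow> int \<times> int \<Rightarrow> complex" where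
  "fourier_coeff f k =
     (LINT x|torus. f x * exp (- 2 * of_real pi * \<i> * of_real (lattice_point k \<bullet> x)))"

text \<open>For \<open>s \<ge> 0\<close>, the only range in which this is used, the Sobolev space is contained in the
  space of square-integrable functions; no distributions are needed.\<close>

definition sobolev_torus :: "real \<Rightarrow> (real \<times> real \<Rightarrow> complex) set" where
  "sobolev_torus s = {f \<in> L2_torus.
     (\<lambda>k. (1 + (norm (lattice_point k))\<^sup>2) powr s * (norm (fourier_coeff f k))\<^sup>2) summable_on UNIV}"

definition torus_dist :: "real \<times> real \<Rightarrow> real \<times> real \<Rightarrow> real" where
  "torus_dist x y = (INF k. dist x (y + lattice_point k))"

text \<open>Here the segment is left in the plane: reduction modulo the lattice happens in
  \<open>torus_dist\<close>.\<close>

definition geodesic :: "real \<times> real \<Rightarrow> real \<times> real \<Rightarrow> real \<Rightarrow> (real \<times> real) set" where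
  "geodesic x \<nu> L = {x + t *\<^sub>R \<nu> | t. 0 \<le> t \<and> t \<le> L}"

definition tube :: "real \<times> real \<Rightarrow> real \<times> real \<Rightarrow> real \<Rightarrow> real \<Rightarrow> (real \<times> real) set" where
  "tube x \<nu> L \<delta> = {y \<in> space torus. (INF z\<in>geodesic x \<nu> L. torus_dist y z) < \<delta>}"

text \<open>The limit inferior and the infima are taken in the extended reals, where they always exist.\<close>

definition generalized_GCC :: "(real \<times> real \<Rightarrow> real) \<Rightarrow> bool" where
  "generalized_GCC \<gamma> \<longleftrightarrow> (\<exists>L>0. \<exists>c\<^sub>0>0.
     Liminf (at_right 0) (\<lambda>\<delta>. INF x. INF \<nu>\<in>sphere 0 1.
       ereal (1 / measure torus (tube x \<nu> L \<delta>) * (LINT y:tube x \<nu> L \<delta>|torus. \<gamma> y)))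
     \<ge> ereal c\<^sub>0)"

definition annulus :: "real \<Rightarrow> real \<Rightarrow> (real \<times> real) set" where
  "annulus R \<alpha> = {\<xi>. R \<le> norm \<xi> \<and> norm \<xi> \<le> R + R powr (- \<alpha>)}"

end

theory Submission
  imports Defs
begin

text \<open>Split the frequencies of \<open>f\<close> into caps of length of order \<open>sqrt R\<close>, each taken together with its
  antipode and separated from the next one by a gap of length \<open>\<kappa> * sqrt R\<close> carrying little mass.

  On a cap with direction \<open>\<nu>\<close> the frequencies \<open>k \<bullet> \<nu>\<close> lie in two intervals of bounded length around \<open>R\<close>
  and \<open>-R\<close>. The geometric control condition says that \<open>\<gamma>\<close> has mass bounded below on almost every
  segment of a fixed length in direction \<open>\<nu>\<close>, so a Logvinenko-Sereda inequality along these segments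
  bounds the mass of the cap by a constant, independent of \<open>R\<close> and \<open>\<kappa>\<close>, times its weighted mass.

  Frequencies \<open>k\<close> and \<open>l\<close> in different caps have \<open>|k - l|\<close> and \<open>|k + l|\<close> at least \<open>\<kappa> * sqrt R\<close>, and then
  \<open>m = l - k\<close> has at most \<open>C |m| powr (2 s)\<close> such representations. By Cauchy-Schwarz the interaction of different
  caps is at most the squared norm of \<open>f\<close> times the tail over \<open>|m| \<ge> \<kappa> * sqrt R\<close> of the Sobolev norm of
  \<open>\<gamma>\<close>, which tends to \<open>0\<close>. Bounded radii are covered by the one-interval inequality alone.\<close>

section \<open>The torus\<close>

text \<open>Curvature forces the size of the caps: an arc with chord \<open>d\<close> on a circle of
  radius R deviates from its tangent by about \<open>d\<^sup>2 / R\<close>, so \<open>sqrt R\<close>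
  is the largest scale on which the frequencies along \<open>\<nu>\<close> stay in intervals of
  bounded length. Separation at the same scale gives
  \<open>R \<le> |m|\<^sup>2 / \<kappa>\<^sup>2\<close> for the differences m, and this turns
  \<open>R powr (1 - \<alpha>) / |m|\<close> into a multiple of
  \<open>|m| powr (1 - 2 * \<alpha>)\<close>; here lies the origin of
  \<open>s = 1 / 2 - \<alpha>\<close>. If \<open>|k + l|\<close> is small, the lower bound for the
  coordinate of \<open>k + l\<close> across m is lost and the count breaks down. Antipodal caps are
  therefore kept together and decoupled by phases instead of by counting. The order of the choices
  matters. The cap constant comes first. Then the number \<open>N\<close> is fixed so that the
  fraction \<open>1 / N\<close> of the mass lost in the gaps is harmless even after multiplication
  by that constant; this determines \<open>\<kappa> = 1 / (2 * N)\<close>, the constant of the count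
  and the admissible tail of the Sobolev norm. The threshold for R comes last.\<close>

abbreviation square :: "(real \<times> real) set" where
  "square \<equiv> {0..<1} \<times> {0..<1}"

lemma square_borel [measurable]: "square \<in> sets borel"
  by (intro borel_Times) auto

lemma space_torus: "space torus = square"
  by (simp add: torus_def space_restrict_space)

lemma square_lebesgue: "square \<in> sets lebesgue"
  using square_borel by (simp add: sets_completionI_sets)

lemma borel_measurable_torus:
  assumes "F \<in> measurable borel N"
  shows "F \<in> measurable torus N"
  unfolding torus_def
  by (intro measurable_restrict_space1 measurable_completion) (use assms in simp)

lemma nn_integral_torus:
  assumes [measurable]: "F \<in> borel_measurable borel"
  shows "(\<integral>\<^sup>+ x. F x \<partial>torus) = (\<integral>\<^sup>+ x. F x * indicator square x \<partial>lborel)"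
proof -
  have "(\<integral>\<^sup>+ x. F x \<partial>torus) = (\<integral>\<^sup>+ x. F x * indicator square x \<partial>lebesgue)"
    unfolding torus_def using square_lebesgue by (subst nn_integral_restrict_space) auto
  also have "\<dots> = (\<integral>\<^sup>+ x. F x * indicator square x \<partial>lborel)"
    by (simp add: nn_integral_completion)
  finally show ?thesis .
qed

lemma lattice_point_add: "lattice_point (k + l) = lattice_point k + lattice_point l"
  by (simp add: lattice_point_def)

lemma lattice_point_minus: "lattice_point (- k) = - lattice_point k"
  by (simp add: lattice_point_def)

lemma lattice_point_diff: "lattice_point (k - l) = lattice_point k - lattice_point l"
  by (simp add: lattice_point_def)

lemma lattice_point_0 [simp]: "lattice_point 0 = 0"
  by (simp add: lattice_point_def zero_prod_def)

lemma norm_lattice_point_ge_1: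
  assumes "m \<noteq> 0"
  shows "1 \<le> norm (lattice_point m)"
proof (cases m)
  case (Pair i j)
  then have "i \<noteq> 0 \<or> j \<noteq> 0" using assms by (auto simp: zero_prod_def)
  then have "1 \<le> \<bar>i\<bar> \<or> 1 \<le> \<bar>j\<bar>" by linarith
  then have "1 \<le> \<bar>real_of_int i\<bar> \<or> 1 \<le> \<bar>real_of_int j\<bar>" by linarith
  then show ?thesis
    using norm_fst_le[of "real_of_int i" "real_of_int j"] norm_snd_le[of "real_of_int j" "real_of_int i"]
    by (auto simp: Pair lattice_point_def)
qed

section \<open>Representatives in the half-open square, periodization and translation
  invariance\<close>

definition cell :: "real \<times> real \<Rightarrow> int \<times> int" where
  "cell x = (\<lfloor>fst x\<rfloor>, \<lfloor>snd x\<rfloor>)"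

text \<open>Composition with \<open>wrap\<close> makes an arbitrary function periodic and leaves its
  values on the square unchanged.\<close>

definition wrap :: "real \<times> real \<Rightarrow> real \<times> real" where
  "wrap x = x - lattice_point (cell x)"

lemma diff_lattice_in_square_iff: "x - lattice_point k \<in> square \<longleftrightarrow> k = cell x"
proof (cases x)
  case (Pair a b)
  obtain i j where k: "k = (i, j)" by (cases k)
  have "0 \<le> a - real_of_int i \<and> a - real_of_int i < 1 \<longleftrightarrow> \<lfloor>a\<rfloor> = i" for a i
    by (auto simp: floor_eq_iff)
  then show ?thesis
    by (auto simp: Pair k lattice_point_def cell_def)
qed

lemma wrap_measurable [measurable]: "wrap \<in> borel_measurable borel"
proof -
  have "(\<lambda>x. (fst x - of_int \<lfloor>fst x\<rfloor>, snd x - of_int \<lfloor>snd x\<rfloor>)) \<in> 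
     (borel :: (real \<times> real) measure) \<rightarrow>\<^sub>M (borel \<Otimes>\<^sub>M borel :: (real \<times> real) measure)"
    unfolding borel_prod[symmetric] by measurable
  also have "(\<lambda>x. (fst x - of_int \<lfloor>fst x\<rfloor>, snd x - of_int \<lfloor>snd x\<rfloor>)) = wrap"
    by (auto simp: wrap_def cell_def lattice_point_def fun_eq_iff)
  finally show ?thesis by (simp add: borel_prod)
qed

lemma wrap_of_square: "x \<in> square \<Longrightarrow> wrap x = x"
  by (cases x) (auto simp: wrap_def cell_def lattice_point_def zero_prod_def floor_eq_iff)

lemma wrap_add_lattice: "wrap (x + lattice_point k) = wrap x"
  by (cases x; cases k) (auto simp: wrap_def cell_def lattice_point_def)

lemma periodic_wrap: "periodic F \<Longrightarrow> F (wrap x) = F x"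
  by (metis diff_add_cancel periodic_def wrap_def)

lemma periodic_compose_wrap: "periodic (\<lambda>x. F (wrap x))"
  by (simp add: periodic_def wrap_add_lattice)

text \<open>The indicators of the lattice translates of the square sum to one. With this partition
  inserted, Tonelli exchanges sum and integral, and translation invariance moves every term back to
  the square.\<close>

lemma nn_integral_periodize:
  assumes [measurable]: "F \<in> borel_measurable borel"
  shows "(\<integral>\<^sup>+ x. F x \<partial>lborel) =
    (\<integral>\<^sup>+ y. (\<integral>\<^sup>+ k. F (y + lattice_point k) \<partial>count_space UNIV) \<partial>torus)"
proof -
  have sum1: "(\<integral>\<^sup>+ k. F x * indicator square (x - lattice_point k) \<partial>count_space UNIV) = F x" for x
  proof -
    have "(\<integral>\<^sup>+ k. F x * indicator square (x - lattice_point k) \<partial>count_space UNIV)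
      = (\<integral>\<^sup>+ k. F x * indicator {cell x} k \<partial>count_space UNIV)"
      by (intro nn_integral_cong) (auto simp: diff_lattice_in_square_iff indicator_def simp del: mem_Sigma_iff)
    also have "\<dots> = F x * emeasure (count_space UNIV) {cell x}"
      by (intro nn_integral_cmult_indicator) auto
    also have "\<dots> = F x" by simp
    finally show ?thesis .
  qed
  have "(\<integral>\<^sup>+ x. F x \<partial>lborel) =
      (\<integral>\<^sup>+ x. (\<integral>\<^sup>+ k. F x * indicator square (x - lattice_point k) \<partial>count_space UNIV) \<partial>lborel)"
    by (simp only: sum1)
  also have "\<dots> = (\<integral>\<^sup>+ k. (\<integral>\<^sup>+ x. F x * indicator square (x - lattice_point k) \<partial>lborel) \<partial>count_space UNIV)"
    by (rule nn_integral_count_space_nn_integral) auto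
  also have "\<dots> = (\<integral>\<^sup>+ k. (\<integral>\<^sup>+ x. F (x + lattice_point k) * indicator square x \<partial>lborel) \<partial>count_space UNIV)"
  proof (rule nn_integral_cong)
    fix k
    have "(\<integral>\<^sup>+ x. F x * indicator square (x - lattice_point k) \<partial>lborel)
      = (\<integral>\<^sup>+ x. F x * indicator square (x - lattice_point k) \<partial>distr lborel borel ((+) (lattice_point k)))"
      by (simp add: lborel_distr_plus)
    also have "\<dots> = (\<integral>\<^sup>+ x. F (x + lattice_point k) * indicator square x \<partial>lborel)"
      by (subst nn_integral_distr) (auto simp: add.commute)
    finally show "(\<integral>\<^sup>+ x. F x * indicator square (x - lattice_point k) \<partial>lborel)
        = (\<integral>\<^sup>+ x. F (x + lattice_point k) * indicator square x \<partial>lborel)" .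
  qed
  also have "\<dots> = (\<integral>\<^sup>+ k. (\<integral>\<^sup>+ x. F (x + lattice_point k) \<partial>torus) \<partial>count_space UNIV)"
    by (intro nn_integral_cong, subst nn_integral_torus) auto
  also have "\<dots> = (\<integral>\<^sup>+ y. (\<integral>\<^sup>+ k. F (y + lattice_point k) \<partial>count_space UNIV) \<partial>torus)"
    by (rule nn_integral_count_space_nn_integral[symmetric]) (auto intro: borel_measurable_torus)
  finally show ?thesis .
qed

text \<open>The shift replaces the square by another fundamental domain. After periodization every
  point has exactly one lattice translate in that domain, so the sum over the lattice contributes
  the factor one.\<close>

lemma nn_integral_torus_translate:
  assumes [measurable]: "F \<in> borel_measurable borel" and "periodic F"
  shows "(\<integral>\<^sup>+ x. F (x + v) \<partial>torus) = (\<integral>\<^sup>+ x. F x \<partial>torus)"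
proof -
  have per: "F (x + lattice_point k) = F x" for x k
    using assms(2) unfolding periodic_def by blast
  have one: "(\<integral>\<^sup>+ k. indicator square (y + lattice_point k - v) \<partial>count_space UNIV) = (1::ennreal)" for y
  proof -
    have "y + lattice_point k - v \<in> square \<longleftrightarrow> k = - cell (y - v)" for k
    proof -
      have "y + lattice_point k - v = (y - v) - lattice_point (- k)"
        by (simp add: lattice_point_minus)
      then show ?thesis
        by (metis diff_lattice_in_square_iff minus_equation_iff)
    qed
    then have "(\<integral>\<^sup>+ k. indicator square (y + lattice_point k - v) \<partial>count_space UNIV)
      = (\<integral>\<^sup>+ k. indicator {- cell (y - v)} k \<partial>count_space UNIV)"
      by (intro nn_integral_cong) (auto simp: indicator_def simp del: mem_Sigma_iff)
    then show ?thesis by simp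
  qed
  have "(\<integral>\<^sup>+ x. F (x + v) \<partial>torus) = (\<integral>\<^sup>+ x. F (x + v) * indicator square x \<partial>lborel)"
    by (simp add: nn_integral_torus)
  also have "\<dots> = (\<integral>\<^sup>+ x. F x * indicator square (x - v) \<partial>distr lborel borel ((+) v))"
    by (subst nn_integral_distr) (auto simp: add.commute)
  also have "\<dots> = (\<integral>\<^sup>+ x. F x * indicator square (x - v) \<partial>lborel)"
    by (simp add: lborel_distr_plus)
  also have "\<dots> = (\<integral>\<^sup>+ y. (\<integral>\<^sup>+ k. F y * indicator square (y + lattice_point k - v) \<partial>count_space UNIV) \<partial>torus)"
    by (subst nn_integral_periodize) (auto simp: per)
  also have "\<dots> = (\<integral>\<^sup>+ x. F x \<partial>torus)"
    by (subst nn_integral_cmult) (auto simp: one)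
  finally show ?thesis .
qed

lemma emeasure_torus_space: "emeasure torus (space torus) = 1"
proof -
  have "emeasure torus (space torus) = (\<integral>\<^sup>+ x. 1 \<partial>torus)"
    by simp
  also have "\<dots> = emeasure lborel square"
    by (subst nn_integral_torus) auto
  also have "\<dots> = emeasure lborel ({0..<1::real}) * emeasure lborel ({0..<1::real})"
    by (simp add: lborel_prod[symmetric] lborel.emeasure_pair_measure_Times)
  finally show ?thesis by simp
qed

lemma finite_measure_torus: "finite_measure torus"
  by (rule finite_measureI) (simp add: emeasure_torus_space)

lemma measure_torus_space: "measure torus (space torus) = 1"
  by (simp add: measure_def emeasure_torus_space)

text \<open>Stating the invariance for image measures carries it from nonnegative integrands to
  vector-valued Bochner integrals without splitting these into parts.\<close>

lemma distr_torus_translate: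
  "distr torus borel (\<lambda>x. wrap (x + v)) = distr torus borel wrap"
proof (rule measure_eqI)
  fix A assume "A \<in> sets (distr torus borel (\<lambda>x. wrap (x + v)))"
  then have [measurable]: "A \<in> sets borel" by simp
  have [measurable]: "(\<lambda>x. wrap (x + v)) \<in> borel_measurable torus" for v
    by (rule borel_measurable_torus) measurable
  have [measurable]: "wrap \<in> borel_measurable torus"
    by (rule borel_measurable_torus) measurable
  have "emeasure (distr torus borel (\<lambda>x. wrap (x + v))) A = (\<integral>\<^sup>+ x. indicator A x \<partial>distr torus borel (\<lambda>x. wrap (x + v)))"
    by simp
  also have "\<dots> = (\<integral>\<^sup>+ x. indicator A (wrap (x + v)) \<partial>torus)"
    by (subst nn_integral_distr) auto
  also have "\<dots> = (\<integral>\<^sup>+ x. indicator A (wrap x) \<partial>torus)"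
    by (rule nn_integral_torus_translate) (auto intro: periodic_compose_wrap)
  also have "\<dots> = (\<integral>\<^sup>+ x. indicator A x \<partial>distr torus borel wrap)"
    by (subst nn_integral_distr) auto
  finally show "emeasure (distr torus borel (\<lambda>x. wrap (x + v))) A = emeasure (distr torus borel wrap) A"
    by simp
qed simp

lemma integral_torus_translate:
  fixes F :: "real \<times> real \<Rightarrow> 'a::{banach, second_countable_topology}"
  assumes [measurable]: "F \<in> borel_measurable borel" and "periodic F"
  shows "(LINT x|torus. F (x + v)) = (LINT x|torus. F x)"
proof -
  have m: "(\<lambda>x. wrap (x + v)) \<in> borel_measurable torus" for v
    by (rule borel_measurable_torus) measurable
  have "(LINT x|torus. F (x + v)) = (LINT x|torus. F (wrap (x + v)))"
    using periodic_wrap[OF assms(2)] by simp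
  also have "\<dots> = (LINT x|distr torus borel (\<lambda>x. wrap (x + v)). F x)"
    by (rule integral_distr[symmetric]) (auto simp: m)
  also have "\<dots> = (LINT x|distr torus borel (\<lambda>x. wrap (x + 0)). F x)"
    by (simp only: distr_torus_translate)
  also have "\<dots> = (LINT x|torus. F (wrap (x + 0)))"
    by (rule integral_distr) (use m[of 0] in simp_all)
  also have "\<dots> = (LINT x|torus. F x)"
    using periodic_wrap[OF assms(2)] by simp
  finally show ?thesis .
qed

section \<open>Trigonometric polynomials\<close>

definition chr :: "int \<times> int \<Rightarrow> real \<times> real \<Rightarrow> complex" where
  "chr k x = cis (2 * pi * (lattice_point k \<bullet> x))"

definition trig_poly :: "(int \<times> int) set \<Rightarrow> (int \<times> int \<Rightarrow> complex) \<Rightarrow> real \<times> real \<Rightarrow> complex" where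
  "trig_poly F a x = (\<Sum>k\<in>F. a k * chr k x)"

lemma norm_chr [simp]: "norm (chr k x) = 1"
  by (simp add: chr_def)

lemma chr_0 [simp]: "chr 0 x = 1"
  by (simp add: chr_def)

lemma chr_add_right: "chr k (x + y) = chr k x * chr k y"
  by (simp add: chr_def inner_add_right cis_mult distrib_left)

lemma chr_add_left: "chr (k + l) x = chr k x * chr l x"
  by (simp add: chr_def inner_add_left cis_mult distrib_left lattice_point_add)

lemma cnj_chr: "cnj (chr k x) = chr (- k) x"
  by (simp add: chr_def cis_cnj lattice_point_minus)

lemma chr_mult_cnj: "chr k x * cnj (chr l x) = chr (k - l) x"
  using chr_add_left[of k "- l" x] by (simp add: cnj_chr)

lemma chr_lattice [simp]: "chr k (lattice_point l) = 1"
proof -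
  have "lattice_point k \<bullet> lattice_point l = of_int (fst k * fst l + snd k * snd l)"
    by (simp add: lattice_point_def)
  then show ?thesis
    by (simp add: chr_def cis_multiple_2pi)
qed

lemma periodic_chr: "periodic (chr k)"
  by (simp add: periodic_def chr_add_right)

lemma continuous_chr: "continuous_on A (chr k)"
  unfolding chr_def by (intro continuous_intros)

lemma chr_borel [measurable]: "chr k \<in> borel_measurable borel"
  by (intro borel_measurable_continuous_onI continuous_chr)

lemma periodic_trig_poly: "periodic (trig_poly F a)"
  by (simp add: periodic_def trig_poly_def chr_add_right)

lemma trig_poly_borel [measurable]: "trig_poly F a \<in> borel_measurable borel"
  unfolding trig_poly_def[abs_def] by measurable

lemma trig_poly_translate: "trig_poly F a (x + v) = trig_poly F (\<lambda>k. a k * chr k v) x"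
  by (simp add: trig_poly_def chr_add_right mult_ac)

lemma norm_trig_poly_le: "norm (trig_poly F a x) \<le> (\<Sum>k\<in>F. norm (a k))"
  unfolding trig_poly_def by (rule sum_norm_le) (simp add: norm_mult)

lemma exp_eq_chr: "exp (- 2 * of_real pi * \<i> * of_real (lattice_point k \<bullet> x)) = chr (- k) x"
  by (simp add: chr_def cis_conv_exp lattice_point_minus mult_ac)

lemma fourier_coeff_chr: "fourier_coeff f k = (LINT x|torus. f x * chr (- k) x)"
  by (simp only: fourier_coeff_def exp_eq_chr)

lemma integrable_torus_bounded:
  fixes F :: "real \<times> real \<Rightarrow> 'a::{banach, second_countable_topology}"
  assumes "F \<in> borel_measurable torus" "\<And>x. norm (F x) \<le> B"
  shows "integrable torus F"
  using finite_measure.integrable_const_bound[OF finite_measure_torus, of F B] assms by simp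

text \<open>For nonzero \<open>k\<close> there is a shift on which the character takes the value
  \<open>- 1\<close>; it leaves the integral unchanged and also negates it.\<close>

lemma integral_chr: "(LINT x|torus. chr k x) = (if k = 0 then 1 else 0)"
proof (cases "k = 0")
  case True
  then show ?thesis
    by (simp add: measure_torus_space)
next
  case False
  define v where "v = (1 / (2 * (norm (lattice_point k))\<^sup>2)) *\<^sub>R lattice_point k"
  have "lattice_point k \<noteq> 0"
    using False by (cases k) (auto simp: lattice_point_def zero_prod_def)
  then have "lattice_point k \<bullet> v = 1 / 2"
    by (simp add: v_def power2_norm_eq_inner)
  then have "2 * pi * (lattice_point k \<bullet> v) = pi"
    by simp
  then have "chr k v = - 1"
    by (simp only: chr_def cis_pi)
  moreover have "(LINT x|torus. chr k (x + v)) = (LINT x|torus. chr k x)"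
    by (rule integral_torus_translate) (auto intro: periodic_chr)
  ultimately have "(LINT x|torus. chr k x) = - (LINT x|torus. chr k x)"
    by (simp add: chr_add_right)
  then show ?thesis
    using False by (simp add: eq_neg_iff_add_eq_0)
qed

lemma norm_trig_poly_sq:
  "of_real ((norm (trig_poly F a x))\<^sup>2) = (\<Sum>k\<in>F. \<Sum>l\<in>F. a k * cnj (a l) * chr (k - l) x)"
proof -
  have "of_real ((norm (trig_poly F a x))\<^sup>2) = trig_poly F a x * cnj (trig_poly F a x)"
    by (rule complex_norm_square)
  also have "\<dots> = (\<Sum>k\<in>F. \<Sum>l\<in>F. a k * cnj (a l) * chr (k - l) x)"
    by (simp add: trig_poly_def sum_product chr_mult_cnj[symmetric] mult_ac)
  finally show ?thesis .
qed

text \<open>Decay of the Fourier coefficients of the weight becomes decay of the matrix of this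
  quadratic form away from its diagonal; this is how the Sobolev norm of \<open>\<gamma>\<close>
  enters.\<close>

lemma weighted_trig_poly_norm:
  fixes w :: "real \<times> real \<Rightarrow> real"
  assumes "integrable torus w"
  shows "complex_of_real (LINT x|torus. w x * (norm (trig_poly F a x))\<^sup>2)
    = (\<Sum>k\<in>F. \<Sum>l\<in>F. a k * cnj (a l) * fourier_coeff (\<lambda>x. of_real (w x)) (l - k))"
proof -
  have int: "integrable torus (\<lambda>x. complex_of_real (w x) * chr k x)" for k
  proof (rule Bochner_Integration.integrable_bound[OF assms])
    have [measurable]: "w \<in> borel_measurable torus" "chr k \<in> borel_measurable torus"
      using assms borel_measurable_torus[OF chr_borel] by auto
    show "(\<lambda>x. complex_of_real (w x) * chr k x) \<in> borel_measurable torus"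
      by measurable
  qed (simp add: norm_mult)
  have "complex_of_real (LINT x|torus. w x * (norm (trig_poly F a x))\<^sup>2)
      = (LINT x|torus. complex_of_real (w x * (norm (trig_poly F a x))\<^sup>2))"
    by (rule integral_complex_of_real[symmetric])
  also have "\<dots> = (LINT x|torus. (\<Sum>k\<in>F. \<Sum>l\<in>F. a k * cnj (a l) * (complex_of_real (w x) * chr (k - l) x)))"
    by (simp only: of_real_mult norm_trig_poly_sq sum_distrib_left mult_ac)
  also have "\<dots> = (\<Sum>k\<in>F. \<Sum>l\<in>F. a k * cnj (a l) * (LINT x|torus. complex_of_real (w x) * chr (k - l) x))"
    by (subst Bochner_Integration.integral_sum integral_mult_right_zero
        | intro sum.cong refl Bochner_Integration.integrable_sum integrable_mult_right int)+
  finally show ?thesis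
    by (simp add: fourier_coeff_chr)
qed

lemma parseval:
  assumes "finite F"
  shows "(LINT x|torus. (norm (trig_poly F a x))\<^sup>2) = (\<Sum>k\<in>F. (norm (a k))\<^sup>2)"
proof -
  have fc: "fourier_coeff (\<lambda>x. complex_of_real 1) (l - k) = (if k = l then 1 else 0)" for k l
    by (simp add: fourier_coeff_chr integral_chr)
  have "integrable torus (\<lambda>x. 1::real)"
    by (rule integrable_torus_bounded[where B=1]) auto
  then have "complex_of_real (LINT x|torus. 1 * (norm (trig_poly F a x))\<^sup>2)
    = (\<Sum>k\<in>F. \<Sum>l\<in>F. a k * cnj (a l) * fourier_coeff (\<lambda>x. of_real 1) (l - k))"
    by (rule weighted_trig_poly_norm)
  also have "\<dots> = (\<Sum>k\<in>F. \<Sum>l\<in>F. if k = l then a k * cnj (a l) else 0)"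
    unfolding fc by (intro sum.cong refl) simp
  also have "\<dots> = (\<Sum>k\<in>F. a k * cnj (a k))"
    using assms by (simp add: sum.delta)
  also have "\<dots> = complex_of_real (\<Sum>k\<in>F. (norm (a k))\<^sup>2)"
    by (simp only: complex_norm_square of_real_sum)
  finally show ?thesis
    by (simp only: of_real_eq_iff mult_1)
qed

section \<open>A weighted Remez inequality\<close>

text \<open>Greedy choice from the left: take a point of \<open>B\<close> within \<open>d\<close> of
  the infimum and drop everything closer than \<open>d\<close> to its right. As the infimum need not
  belong to \<open>B\<close>, the dropped part is only known to lie in an interval of length
  \<open>2 * d\<close>, hence the factor 2 in the measure hypothesis.\<close>

lemma spaced_points:
  fixes B :: "real set"
  assumes "B \<in> sets borel" "B \<subseteq> {a..b}" "0 < d" "measure lborel B > 2 * d * real n"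
  shows "\<exists>t::nat \<Rightarrow> real. (\<forall>i\<le>n. t i \<in> B) \<and> (\<forall>i<n. t i + d \<le> t (Suc i))"
  using assms
proof (induction n arbitrary: B)
  case 0
  then have "B \<noteq> {}" by auto
  then obtain s where "s \<in> B" by blast
  then show ?case by (intro exI[of _ "\<lambda>_. s"]) auto
next
  case (Suc n)
  have pos: "0 \<le> 2 * d * real (Suc n)" using Suc.prems(3) by simp
  then have ne: "B \<noteq> {}" using Suc.prems(4) by auto
  have bdd: "bdd_below B" using Suc.prems(2) by (meson bdd_below_Icc bdd_below_mono)
  obtain s where s: "s \<in> B" "s < Inf B + d"
    using cInf_lessD[OF ne, of "Inf B + d"] Suc.prems(3) by auto
  define B' where "B' = B \<inter> {s + d..}"
  have B'[measurable]: "B' \<in> sets borel" and B[measurable]: "B \<in> sets borel"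
    using Suc.prems(1) by (auto simp: B'_def)
  have sub: "B \<subseteq> B' \<union> {Inf B .. Inf B + 2 * d}"
    using s(2) cInf_lower[OF _ bdd] by (fastforce simp: B'_def)
  have fin: "emeasure lborel B' \<noteq> \<infinity>" 
  proof -
    have "emeasure lborel B' \<le> emeasure lborel {a..b}"
      by (rule emeasure_mono) (use Suc.prems(2) in \<open>auto simp: B'_def\<close>)
    also have "\<dots> < \<infinity>" by (simp add: emeasure_lborel_Icc_eq)
    finally show ?thesis by simp
  qed
  have "measure lborel B \<le> measure lborel (B' \<union> {Inf B .. Inf B + 2 * d})"
  proof (intro measure_mono_fmeasurable sub fmeasurable.Un)
    show "B' \<in> fmeasurable lborel" using fin by (simp add: fmeasurable_def top.not_eq_extremum)
    show "{Inf B .. Inf B + 2 * d} \<in> fmeasurable lborel"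
      by (simp add: fmeasurable_def emeasure_lborel_Icc_eq)
  qed auto
  also have "\<dots> \<le> measure lborel B' + measure lborel {Inf B .. Inf B + 2 * d}"
    by (intro measure_subadditive) (use fin in \<open>simp_all add: emeasure_lborel_Icc_eq\<close>)
  also have "\<dots> = measure lborel B' + 2 * d"
    using Suc.prems(3) by simp
  finally have "measure lborel B' > 2 * d * real n"
    using Suc.prems(4) by (simp add: algebra_simps)
  moreover have "B' \<subseteq> {a..b}" using Suc.prems(2) by (auto simp: B'_def)
  ultimately obtain t where t: "\<forall>i\<le>n. t i \<in> B'" "\<forall>i<n. t i + d \<le> t (Suc i)"
    using Suc.IH[of B'] Suc.prems(3) B' by blast
  show ?case
  proof (intro exI[of _ "\<lambda>i. case i of 0 \<Rightarrow> s | Suc j \<Rightarrow> t j"] conjI allI impI)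
    fix i assume "i \<le> Suc n"
    then show "(case i of 0 \<Rightarrow> s | Suc j \<Rightarrow> t j) \<in> B"
      using t s by (auto simp: B'_def split: nat.splits)
  next
    fix i assume "i < Suc n"
    then show "(case i of 0 \<Rightarrow> s | Suc j \<Rightarrow> t j) + d \<le> (case Suc i of 0 \<Rightarrow> s | Suc j \<Rightarrow> t j)"
      using t by (auto simp: B'_def split: nat.splits)
  qed
qed

lemma spaced_points_dist:
  fixes t :: "nat \<Rightarrow> real"
  assumes "\<forall>i<n. t i + d \<le> t (Suc i)" "i \<le> j" "j \<le> n"
  shows "t i + real (j - i) * d \<le> t j"
  using assms(2,3)
proof (induction j rule: dec_induct)
  case (step j)
  then have "t i + real (j - i) * d \<le> t j" "t j + d \<le> t (Suc j)"
    using assms(1) by auto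
  then show ?case
    using step by (simp add: Suc_diff_le algebra_simps)
qed simp

section \<open>Lagrange interpolation at spaced nodes\<close>

lemma prod_index_dist:
  assumes "i \<le> n"
  shows "(\<Prod>j\<in>{..n} - {i}. \<bar>real i - real j\<bar>) = fact i * fact (n - i)"
proof -
  have split: "{..n} - {i} = {..<i} \<union> {Suc i..n}"
    using assms by auto
  have "(\<Prod>j<i. \<bar>real i - real j\<bar>) = (\<Prod>j\<in>{1..i}. real j)"
    by (rule prod.reindex_bij_witness[where i="\<lambda>j. i - j" and j="\<lambda>j. i - j"]) (auto simp: of_nat_diff)
  moreover have "(\<Prod>j\<in>{Suc i..n}. \<bar>real i - real j\<bar>) = (\<Prod>j\<in>{1..n - i}. real j)"
    by (rule prod.reindex_bij_witness[where i="\<lambda>j. i + j" and j="\<lambda>j. j - i"]) (auto simp: of_nat_diff)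
  ultimately show ?thesis
    unfolding split by (subst prod.union_disjoint) (auto simp: fact_prod)
qed

lemma sum_inverse_fact_fact:
  "(\<Sum>i\<le>n. 1 / (fact i * fact (n - i))) = (2 ^ n / fact n :: real)"
proof -
  have "(\<Sum>i\<le>n. 1 / (fact i * fact (n - i))) = (\<Sum>i\<le>n. real (n choose i) / fact n)"
    by (intro sum.cong refl) (simp add: binomial_fact)
  also have "\<dots> = real (\<Sum>i\<le>n. n choose i) / fact n"
    by (simp add: sum_divide_distrib)
  finally show ?thesis
    by (simp add: choose_row_sum)
qed

text \<open>The error of the interpolant has degree at most \<open>n\<close> and vanishes at
  \<open>n + 1\<close> distinct nodes.\<close>

lemma lagrange_interpolation:
  fixes p :: "'a::{idom,field} poly"
  assumes deg: "degree p \<le> n" and inj: "inj_on t {..n}"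
  shows "poly p z = (\<Sum>i\<le>n. poly p (t i) * (\<Prod>j\<in>{..n} - {i}. (z - t j) / (t i - t j)))"
proof -
  define q where "q i = smult (poly p (t i)) (\<Prod>j\<in>{..n} - {i}. smult (inverse (t i - t j)) [:- t j, 1:])" for i
  have poly_q: "poly (q i) z = poly p (t i) * (\<Prod>j\<in>{..n} - {i}. (z - t j) / (t i - t j))" for i z
    by (simp add: q_def poly_prod divide_inverse left_diff_distrib mult.commute)
  have "p - (\<Sum>i\<le>n. q i) = 0"
  proof (rule ccontr)
    assume nz: "p - (\<Sum>i\<le>n. q i) \<noteq> 0"
    have "degree (q i) \<le> n" if "i \<le> n" for i
    proof -
      have "degree (q i) \<le> degree (\<Prod>j\<in>{..n} - {i}. smult (inverse (t i - t j)) [:- t j, 1:])"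
        unfolding q_def by (rule degree_smult_le)
      also have "\<dots> \<le> sum (degree \<circ> (\<lambda>j. smult (inverse (t i - t j)) [:- t j, 1:])) ({..n} - {i})"
        by (rule degree_prod_sum_le) simp
      also have "\<dots> \<le> sum (\<lambda>j. 1) ({..n} - {i})"
        by (intro sum_mono) (auto intro: order_trans[OF degree_smult_le])
      finally show ?thesis using that by simp
    qed
    then have "degree (p - (\<Sum>i\<le>n. q i)) \<le> n"
      using deg by (intro degree_diff_le degree_sum_le) auto
    moreover have "t ` {..n} \<subseteq> {x. poly (p - (\<Sum>i\<le>n. q i)) x = 0}"
    proof safe
      fix k assume k: "k \<le> n"
      have "poly (q i) (t k) = (if i = k then poly p (t k) else 0)" if "i \<le> n" for i
      proof (cases "i = k")
        case True
        have "(\<Prod>j\<in>{..n} - {k}. (t k - t j) / (t k - t j)) = 1"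
          using inj k by (intro prod.neutral) (auto simp: inj_on_def)
        then show ?thesis using True by (simp add: poly_q)
      next
        case False
        then show ?thesis using k by (auto simp: poly_q intro!: bexI[of _ k])
      qed
      then have "(\<Sum>i\<le>n. poly (q i) (t k)) = (\<Sum>i\<le>n. if i = k then poly p (t k) else 0)"
        by (intro sum.cong) auto
      then show "poly (p - (\<Sum>i\<le>n. q i)) (t k) = 0"
        using k by (simp add: poly_sum)
    qed
    then have "card (t ` {..n}) \<le> card {x. poly (p - (\<Sum>i\<le>n. q i)) x = 0}"
      by (intro card_mono poly_roots_finite nz)
    ultimately show False
      using card_poly_roots_bound[OF nz] card_image[OF inj] by simp
  qed
  then have "poly p z = (\<Sum>i\<le>n. poly (q i) z)"
    by (metis eq_iff_diff_eq_0 poly_sum)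
  then show ?thesis by (simp only: poly_q)
qed

text \<open>In the Lagrange formula the numerators are at most one on the unit interval, and the
  denominators are compared with those of equally spaced nodes. The resulting
  \<open>1 / fact n\<close> compensates \<open>(2 / d) ^ n\<close> when \<open>d\<close> has order
  \<open>1 / n\<close>, which leaves only exponential growth.\<close>

lemma poly_bound_from_spaced_points:
  fixes p :: "complex poly" and t :: "nat \<Rightarrow> real"
  assumes deg: "degree p \<le> n" and d: "0 < d"
    and t01: "\<And>i. i \<le> n \<Longrightarrow> t i \<in> {0..1}"
    and sp: "\<forall>i<n. t i + d \<le> t (Suc i)"
    and bd: "\<And>i. i \<le> n \<Longrightarrow> norm (poly p (of_real (t i))) \<le> m"
    and u: "u \<in> {0..1}"
  shows "norm (poly p (of_real u)) \<le> m * ((2 / d) ^ n / fact n)"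
proof -
  have dist: "\<bar>real i - real j\<bar> * d \<le> \<bar>t i - t j\<bar>" if "i \<le> n" "j \<le> n" for i j
  proof (cases "i \<le> j")
    case True
    then show ?thesis using spaced_points_dist[OF sp True that(2)] by (simp add: of_nat_diff)
  next
    case False
    then show ?thesis using spaced_points_dist[OF sp, of j i] that by (simp add: of_nat_diff)
  qed
  have pos: "0 < \<bar>real i - real j\<bar> * d" if "i \<noteq> j" for i j :: nat
    using d that by simp
  have "inj_on (\<lambda>i. complex_of_real (t i)) {..n}"
  proof (rule inj_onI, rule ccontr)
    fix i j assume ij: "i \<in> {..n}" "j \<in> {..n}" "complex_of_real (t i) = complex_of_real (t j)" "i \<noteq> j"
    then show False using dist[of i j] pos[of i j] by simp
  qed
  then have "poly p (of_real u) = (\<Sum>i\<le>n. poly p (of_real (t i)) *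
      (\<Prod>j\<in>{..n} - {i}. (of_real u - of_real (t j)) / (of_real (t i) - of_real (t j))))"
    by (rule lagrange_interpolation[OF deg])
  also have "norm \<dots> \<le> (\<Sum>i\<le>n. m * (1 / d ^ n * (1 / (fact i * fact (n - i)))))"
  proof (rule sum_norm_le)
    fix i assume "i \<in> {..n}"
    then have i: "i \<le> n" by simp
    have m0: "0 \<le> m" using bd[OF i] norm_ge_zero order_trans by blast
    have "norm (\<Prod>j\<in>{..n} - {i}. (complex_of_real u - of_real (t j)) / (of_real (t i) - of_real (t j)))
        \<le> (\<Prod>j\<in>{..n} - {i}. 1 / (\<bar>real i - real j\<bar> * d))"
      unfolding prod_norm[symmetric]
    proof (rule prod_mono, safe)
      fix j assume j: "j \<le> n" "j \<noteq> i"
      have "norm ((complex_of_real u - of_real (t j)) / (of_real (t i) - of_real (t j)))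
          = \<bar>u - t j\<bar> / \<bar>t i - t j\<bar>"
        by (simp add: norm_divide flip: of_real_diff)
      also have "\<dots> \<le> 1 / (\<bar>real i - real j\<bar> * d)"
        using t01[OF j(1)] u dist[OF i j(1)] pos[of i j] j by (intro frac_le) (auto simp: abs_le_iff)
      finally show "norm ((complex_of_real u - of_real (t j)) / (of_real (t i) - of_real (t j)))
          \<le> 1 / (\<bar>real i - real j\<bar> * d)" .
    qed auto
    also have "\<dots> = 1 / d ^ n * (1 / (fact i * fact (n - i)))"
      using i by (simp add: prod_dividef prod.distrib prod_index_dist)
    finally show "norm (poly p (of_real (t i)) *
        (\<Prod>j\<in>{..n} - {i}. (of_real u - of_real (t j)) / (of_real (t i) - of_real (t j))))
        \<le> m * (1 / d ^ n * (1 / (fact i * fact (n - i))))"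
      unfolding norm_mult by (intro mult_mono bd[OF i] m0) auto
  qed
  also have "\<dots> = m * (1 / d ^ n * (\<Sum>i\<le>n. 1 / (fact i * fact (n - i))))"
    by (simp only: sum_distrib_left)
  also have "\<dots> = m * ((2 / d) ^ n / fact n)"
    by (simp only: sum_inverse_fact_fact) (simp add: power_divide)
  finally show ?thesis .
qed

section \<open>The unit interval as parameter space of segments, and the Remez bound on it\<close>

abbreviation unit_seg :: "real measure" where
  "unit_seg \<equiv> restrict_space lborel {0..1}"

lemma emeasure_unit_seg_space: "emeasure unit_seg (space unit_seg) = 1"
  by (simp only: emeasure_restrict_space space_restrict_space) (simp add: emeasure_restrict_space)

lemma finite_measure_unit_seg: "finite_measure unit_seg"
  by (rule finite_measureI) (simp only: emeasure_unit_seg_space, simp)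

lemma measure_unit_seg_space [simp]: "measure unit_seg {0..1} = 1"
  by (simp add: measure_restrict_space)

lemma borel_measurable_unit_seg: "f \<in> measurable borel N \<Longrightarrow> f \<in> measurable unit_seg N"
  by (rule measurable_restrict_space1) simp

lemma integrable_unit_seg_bounded:
  fixes F :: "real \<Rightarrow> 'a::{banach, second_countable_topology}"
  assumes "F \<in> borel_measurable unit_seg" "\<And>x. x \<in> {0..1} \<Longrightarrow> norm (F x) \<le> B"
  shows "integrable unit_seg F"
  by (rule finite_measure.integrable_const_bound[OF finite_measure_unit_seg, of F B])
    (use assms in \<open>auto simp: space_restrict_space intro!: AE_I2\<close>)

text \<open>The sublevel set of \<open>|p|\<^sup>2\<close> at the height \<open>\<mu> > 2 I / c\<close> carries at least half of the weight, so it
  has measure at least \<open>c / (2 M)\<close> and contains \<open>n + 1\<close> well spaced points; Lagrange interpolation at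
  these gives a constant that is only exponential in \<open>n\<close>.\<close>

lemma weighted_remez:
  fixes p :: "complex poly" and w :: "real \<Rightarrow> real"
  assumes deg: "degree p \<le> n" and [measurable]: "w \<in> borel_measurable borel"
    and w: "\<And>u. 0 \<le> w u" "\<And>u. w u \<le> M" and c: "0 < c" "c \<le> (LINT u|unit_seg. w u)" and u: "u \<in> {0..1}"
  shows "(norm (poly p (of_real u)))\<^sup>2 \<le>
    2 / c * ((8 * M * real (Suc n) / c) ^ n / fact n)\<^sup>2 * (LINT u|unit_seg. w u * (norm (poly p (of_real u)))\<^sup>2)"
proof -
  let ?N = "\<lambda>u. (norm (poly p (of_real u)))\<^sup>2"
  define I where "I = (LINT u|unit_seg. w u * ?N u)"
  have contN: "continuous_on UNIV ?N" by (intro continuous_intros)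
  have [measurable]: "?N \<in> borel_measurable borel"
    by (rule borel_measurable_continuous_onI[OF contN])
  obtain Q where Q: "\<And>u. u \<in> {0..1} \<Longrightarrow> ?N u \<le> Q"
  proof -
    have "compact (?N ` {0..1})"
      by (intro compact_continuous_image continuous_on_subset[OF contN]) auto
    then have "bdd_above (?N ` {0..1})"
      by (intro bounded_imp_bdd_above compact_imp_bounded)
    then show ?thesis using that unfolding bdd_above_def by (metis imageI)
  qed
  have intw: "integrable unit_seg w"
    by (rule integrable_unit_seg_bounded[where B=M]) (use w in \<open>auto intro: borel_measurable_unit_seg\<close>)
  have "(LINT u|unit_seg. w u) \<le> (LINT u|unit_seg. M)"
    by (intro integral_mono intw w(2)) (auto intro: integrable_unit_seg_bounded)
  then have M: "0 < M" using c by simp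
  have intI: "integrable unit_seg (\<lambda>u. w u * ?N u)"
    by (rule integrable_unit_seg_bounded[where B="M * Q"])
      (use w Q M in \<open>auto intro!: mult_mono borel_measurable_unit_seg simp: abs_mult\<close>)
  have I0: "0 \<le> I" unfolding I_def using w by (intro integral_nonneg_AE) auto
  \<comment> \<open>With this spacing \<open>2 * d * n\<close> stays at or below
    \<open>c / (2 * M)\<close>, the lower bound for the measure of the sublevel set, so that
    \<open>spaced_points\<close> applies.\<close>
  define d where "d = c / (4 * M * real (Suc n))"
  have d: "0 < d" using c M by (simp add: d_def)
  \<comment> \<open>A level strictly above \<open>2 / c * I\<close> is positive even if
    \<open>I = 0\<close>; the limiting level is reached at the end by density.\<close>
  have key: "?N u \<le> \<mu> * ((8 * M * real (Suc n) / c) ^ n / fact n)\<^sup>2" if mu: "\<mu> > 2 / c * I" for \<mu>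
  proof -
    have mu0: "0 < \<mu>" using mu I0 c by (meson divide_nonneg_pos le_less_trans mult_nonneg_nonneg zero_le_numeral less_imp_le)
    define B where "B = {u \<in> {0..1}. ?N u \<le> \<mu>}"
    have [measurable]: "B \<in> sets borel"
    proof -
      have "B = {0..1} \<inter> {u. ?N u \<le> \<mu>}" by (auto simp: B_def)
      then show ?thesis by simp
    qed
    \<comment> \<open>A Chebyshev argument: on \<open>B\<close> the weight is at most
      \<open>M\<close>, and off \<open>B\<close> the factor \<open>?N u / \<mu>\<close> is at least
      one.\<close>
    have "(LINT u|unit_seg. w u) \<le> (LINT u|unit_seg. M * indicator B u + w u * ?N u / \<mu>)"
    proof (rule integral_mono[OF intw])
      show "integrable unit_seg (\<lambda>u. M * indicator B u + w u * ?N u / \<mu>)"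
        by (intro Bochner_Integration.integrable_add integrable_divide intI
            integrable_unit_seg_bounded[where B=M]) 
          (use M in \<open>auto simp: indicator_def intro!: borel_measurable_unit_seg\<close>)
      fix u assume "u \<in> space unit_seg"
      then have u: "u \<in> {0..1}" by (simp add: space_restrict_space)
      show "w u \<le> M * indicator B u + w u * ?N u / \<mu>"
      proof (cases "u \<in> B")
        case True
        then show ?thesis using w[of u] mu0 by (simp add: add_increasing2)
      next
        case False
        then have "1 \<le> ?N u / \<mu>" using u mu0 by (simp add: B_def)
        then have "w u * 1 \<le> w u * (?N u / \<mu>)" using w by (intro mult_left_mono)
        then show ?thesis using False by simp
      qed
    qed
    also have "\<dots> = M * measure unit_seg B + I / \<mu>"
    proof -
      have "integrable unit_seg (\<lambda>u. M * indicator B u)"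
        by (rule integrable_unit_seg_bounded[where B=M])
          (use M in \<open>auto simp: indicator_def intro!: borel_measurable_unit_seg\<close>)
      moreover have "B \<inter> space unit_seg = B"
        by (auto simp: B_def space_restrict_space)
      ultimately show ?thesis
        by (subst Bochner_Integration.integral_add) (auto simp: I_def intro: intI)
    qed
    also have "measure unit_seg B = measure lborel B"
      by (rule measure_restrict_space) (auto simp: B_def)
    finally have "c \<le> M * measure lborel B + I / \<mu>" using c by linarith
    moreover have "I / \<mu> < c / 2"
      using mu mu0 c by (simp add: field_simps)
    ultimately have "c / 2 < M * measure lborel B" by linarith
    moreover have "2 * d * real n * M \<le> c / 2"
    proof -
      have "2 * d * real n * M = c / 2 * (real n / real (Suc n))"
        using M by (simp add: d_def divide_simps)
      also have "\<dots> \<le> c / 2 * 1"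
        using c by (intro mult_left_mono) auto
      finally show ?thesis by simp
    qed
    ultimately have "M * (2 * d * real n) < M * measure lborel B" by (simp only: mult.commute[of M])
    then have "measure lborel B > 2 * d * real n" using M mult_less_cancel_left_pos by blast
    moreover have "B \<subseteq> {0..1}" by (auto simp: B_def)
    ultimately obtain t where t: "\<forall>i\<le>n. t i \<in> B" "\<forall>i<n. t i + d \<le> t (Suc i)"
      using spaced_points[of B 0 1 d n] d by auto
    have "norm (poly p (of_real u)) \<le> sqrt \<mu> * ((2 / d) ^ n / fact n)"
      using t by (intro poly_bound_from_spaced_points[OF deg d _ t(2) _ u])
        (auto simp: B_def real_le_rsqrt)
    then have "?N u \<le> (sqrt \<mu> * ((2 / d) ^ n / fact n))\<^sup>2"
      by (intro power_mono) auto
    also have "\<dots> = \<mu> * ((2 / d) ^ n / fact n)\<^sup>2"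
      using mu0 by (simp only: power_mult_distrib real_sqrt_pow2[OF less_imp_le])
    also have "2 / d = 8 * M * real (Suc n) / c"
      using M c by (simp add: d_def field_simps)
    finally show ?thesis .
  qed
  let ?L = "((8 * M * real (Suc n) / c) ^ n / fact n)\<^sup>2"
  have L: "0 < ?L" using M c by simp
  have "?N u / ?L \<le> 2 / c * I"
  proof (rule dense_ge)
    fix \<mu> assume "2 / c * I < \<mu>"
    then show "?N u / ?L \<le> \<mu>" using key[of \<mu>] L by (simp only: pos_divide_le_eq)
  qed
  then show ?thesis
    using L by (simp only: pos_divide_le_eq I_def mult_ac)
qed

section \<open>Frequencies in one interval\<close>

text \<open>The torus carries a completed measure. Through this identity map every Borel function of
  point and time becomes measurable for the product with that measure, as Fubini requires.\<close>

lemma borel_id_pair: "(\<lambda>p. (fst p, snd p)) \<in> measurable (torus \<Otimes>\<^sub>M unit_seg) (borel \<Otimes>\<^sub>M borel)"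
proof -
  have [measurable]: "(\<lambda>x. x) \<in> measurable torus borel"
    by (rule borel_measurable_torus) simp
  have [measurable]: "(\<lambda>x. x) \<in> measurable unit_seg borel"
    by (rule borel_measurable_unit_seg) simp
  have "fst \<in> measurable (torus \<Otimes>\<^sub>M unit_seg) borel" 
    using measurable_compose[OF measurable_fst \<open>(\<lambda>x. x) \<in> measurable torus borel\<close>] by simp
  moreover have "snd \<in> measurable (torus \<Otimes>\<^sub>M unit_seg) borel" 
    using measurable_compose[OF measurable_snd \<open>(\<lambda>x. x) \<in> measurable unit_seg borel\<close>] by simp
  ultimately show ?thesis
    by (rule measurable_Pair)
qed

lemma fubini_torus_seg:
  fixes H :: "real \<times> real \<Rightarrow> real \<Rightarrow> 'a::{banach, second_countable_topology}"
  assumes H: "(\<lambda>p. H (fst p) (snd p)) \<in> borel_measurable (borel \<Otimes>\<^sub>M borel)"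
    and bd: "\<And>x u. u \<in> {0..1} \<Longrightarrow> norm (H x u) \<le> B"
  shows "integrable torus (\<lambda>x. LINT u|unit_seg. H x u)"
    and "integrable unit_seg (\<lambda>u. LINT x|torus. H x u)"
    and "(LINT x|torus. LINT u|unit_seg. H x u) = (LINT u|unit_seg. LINT x|torus. H x u)"
proof -
  interpret T: finite_measure torus by (rule finite_measure_torus)
  interpret S: finite_measure unit_seg by (rule finite_measure_unit_seg)
  interpret P: pair_sigma_finite torus unit_seg ..
  have f: "finite_measure (torus \<Otimes>\<^sub>M unit_seg)"
    by (rule finite_measure_pair_measure) unfold_locales
  have m: "case_prod H \<in> borel_measurable (torus \<Otimes>\<^sub>M unit_seg)"
    using measurable_compose[OF borel_id_pair H] by (simp add: case_prod_beta')
  have i: "integrable (torus \<Otimes>\<^sub>M unit_seg) (case_prod H)"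
    by (rule finite_measure.integrable_const_bound[OF f _ m, of B])
      (auto intro!: AE_I2 bd simp: space_pair_measure space_restrict_space)
  show "integrable torus (\<lambda>x. LINT u|unit_seg. H x u)"
    using P.integrable_fst[OF i] by simp
  show "integrable unit_seg (\<lambda>u. LINT x|torus. H x u)"
    using P.integrable_snd[OF i] by simp
  show "(LINT x|torus. LINT u|unit_seg. H x u) = (LINT u|unit_seg. LINT x|torus. H x u)"
    using P.Fubini_integral[OF i] by simp
qed

text \<open>Borel measurability and bounds at every point, because the weight is evaluated along
  single segments, which are null sets of the plane.\<close>

definition weight :: "real \<Rightarrow> (real \<times> real \<Rightarrow> real) \<Rightarrow> bool" where
  "weight M g \<longleftrightarrow> g \<in> borel_measurable borel \<and> periodic g \<and> (\<forall>x. 0 \<le> g x \<and> g x \<le> M)"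

text \<open>The vector \<open>v\<close> holds direction and length at once, so the inner integral is
  the mean of \<open>g\<close> over the segment from \<open>x\<close> to
  \<open>x + v\<close>.\<close>

definition line_bound :: "real \<Rightarrow> real \<times> real \<Rightarrow> (real \<times> real \<Rightarrow> real) \<Rightarrow> bool" where
  "line_bound c v g \<longleftrightarrow> (AE x in torus. c \<le> (LINT u|unit_seg. g (x + u *\<^sub>R v)))"

lemma power2_norm_add_le: "(norm (x + y))\<^sup>2 \<le> 2 * (norm x)\<^sup>2 + 2 * (norm y :: real)\<^sup>2"
proof -
  have "(norm (x + y))\<^sup>2 \<le> (norm x + norm y)\<^sup>2"
    by (intro power_mono norm_triangle_ineq) simp
  also have "\<dots> \<le> 2 * (norm x)\<^sup>2 + 2 * (norm y)\<^sup>2"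
    using sum_squares_bound[of "norm x" "norm y"] by (simp add: power2_sum)
  finally show ?thesis .
qed

lemma parseval_le:
  assumes "finite F" "\<And>k. k \<in> F \<Longrightarrow> norm (b k) \<le> \<epsilon>"
  shows "(LINT x|torus. (norm (trig_poly F (\<lambda>k. a k * b k) x))\<^sup>2) \<le> \<epsilon>\<^sup>2 * (\<Sum>k\<in>F. (norm (a k))\<^sup>2)"
  unfolding parseval[OF assms(1)] sum_distrib_left
proof (rule sum_mono)
  fix k assume k: "k \<in> F"
  have "(norm (b k))\<^sup>2 \<le> \<epsilon>\<^sup>2" using assms(2)[OF k] by (intro power_mono) auto
  then show "(norm (a k * b k))\<^sup>2 \<le> \<epsilon>\<^sup>2 * (norm (a k))\<^sup>2"
    using mult_right_mono[of "(norm (b k))\<^sup>2" "\<epsilon>\<^sup>2" "(norm (a k))\<^sup>2"]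
    by (simp add: norm_mult power_mult_distrib mult.commute)
qed

lemma integrable_trig_poly_sq: "integrable torus (\<lambda>x. (norm (trig_poly F a x))\<^sup>2)"
proof (rule integrable_torus_bounded)
  show "(\<lambda>x. (norm (trig_poly F a x))\<^sup>2) \<in> borel_measurable torus"
    by (rule borel_measurable_torus) measurable
  show "norm ((norm (trig_poly F a x))\<^sup>2) \<le> (\<Sum>k\<in>F. norm (a k))\<^sup>2" for x
    using norm_trig_poly_le[of F a x] by (auto intro: power_mono)
qed

lemma integrable_weight_trig_poly_sq:
  assumes "weight M g"
  shows "integrable torus (\<lambda>x. g (x + v) * (norm (trig_poly F a x))\<^sup>2)"
proof (rule integrable_torus_bounded)
  have [measurable]: "g \<in> borel_measurable borel" using assms by (simp add: weight_def)
  show "(\<lambda>x. g (x + v) * (norm (trig_poly F a x))\<^sup>2) \<in> borel_measurable torus"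
    by (rule borel_measurable_torus) measurable
  show "norm (g (x + v) * (norm (trig_poly F a x))\<^sup>2) \<le> M * (\<Sum>k\<in>F. norm (a k))\<^sup>2" for x
  proof -
    have "0 \<le> g (x + v)" "g (x + v) \<le> M"
      using assms unfolding weight_def by blast+
    then show ?thesis
      using norm_trig_poly_le[of F a x] by (auto intro!: mult_mono power_mono simp: abs_mult)
  qed
qed

text \<open>Along a segment in direction \<open>v\<close> the modulus of the trigonometric polynomial is that of a function
  with frequencies in an interval of length \<open>2 D\<close>. It is replaced by its Taylor polynomial, to which
  the Remez inequality applies for almost every base point \<open>x\<close>; for a fixed time \<open>u\<close> the remainder is
  again a trigonometric polynomial in \<open>x\<close>, so Parseval bounds it.\<close>

lemma logvinenko_sereda_step:
  fixes F :: "(int \<times> int) set" and a :: "int \<times> int \<Rightarrow> complex" and n :: nat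
  assumes g: "weight M g" and lb: "line_bound c v g" and c: "0 < c" and F: "finite F"
    and freq: "\<And>k. k \<in> F \<Longrightarrow> \<bar>lattice_point k \<bullet> v - \<mu>\<bar> \<le> D"
  defines "X \<equiv> \<Sum>k\<in>F. (norm (a k))\<^sup>2"
    and "Y \<equiv> LINT x|torus. g x * (norm (trig_poly F a x))\<^sup>2"
    and "K \<equiv> 2 / c * ((8 * M * real (Suc n) / c) ^ n / fact n)\<^sup>2"
    and "\<epsilon> \<equiv> (2 * pi * D) ^ Suc n / fact n"
  shows "X \<le> 2 * (K * (2 * Y + 2 * M * (\<epsilon>\<^sup>2 * X))) + 2 * (\<epsilon>\<^sup>2 * X)"
proof (cases "F = {}")
  case True
  then show ?thesis by (simp add: X_def Y_def trig_poly_def)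
next
  case False
  then obtain k0 where "k0 \<in> F" by blast
  then have D: "0 \<le> D" using freq[of k0] by linarith
  have gm[measurable]: "g \<in> borel_measurable borel" and per: "periodic g"
    and g0: "\<And>x. 0 \<le> g x" and gM: "\<And>x. g x \<le> M"
    using g by (auto simp: weight_def)
  have M0: "0 \<le> M" using g0[of 0] gM[of 0] by linarith
  have K0: "0 \<le> K" using c by (simp add: K_def)
  \<comment> \<open>Only frequencies relative to \<open>\<mu>\<close> matter, since the common
    factor \<open>cis (2 * pi * \<mu> * u)\<close> has modulus one.\<close>
  define th where "th k = 2 * pi * (lattice_point k \<bullet> v - \<mu>)" for k
  define T where "T k u = (\<Sum>m\<le>n. (\<i> * of_real (th k * u)) ^ m / fact m)" for k u
  \<comment> \<open>\<open>q\<close> has the modulus of the trigonometric polynomial along the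
    segment, \<open>p\<close> is its Taylor polynomial in \<open>u\<close>, and \<open>r\<close> is
    the remainder. For fixed \<open>x\<close>, \<open>p\<close> is a polynomial in \<open>u\<close>;
    for fixed \<open>u\<close>, all three are trigonometric polynomials in \<open>x\<close>.\<close>
  define p where "p x u = trig_poly F (\<lambda>k. a k * T k u) x" for x u
  define q where "q x u = trig_poly F (\<lambda>k. a k * cis (th k * u)) x" for x u
  define r where "r x u = trig_poly F (\<lambda>k. a k * (cis (th k * u) - T k u)) x" for x u
  have qpr: "q x u = p x u + r x u" for x u
    by (simp add: q_def p_def r_def trig_poly_def algebra_simps sum.distrib sum_subtractf)
  have rT: "norm (cis (th k * u) - T k u) \<le> \<epsilon>" if "k \<in> F" "u \<in> {0..1}" for k u
  proof -
    have "norm (cis (th k * u) - T k u) \<le> exp \<bar>Re (\<i> * of_real (th k * u))\<bar> * norm (\<i> * of_real (th k * u)) ^ Suc n / fact n"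
      unfolding T_def cis_conv_exp by (rule Taylor_exp)
    also have "\<dots> = \<bar>th k * u\<bar> ^ Suc n / fact n"
      by (simp add: norm_mult abs_mult)
    also have "\<dots> \<le> (2 * pi * D) ^ Suc n / fact n"
    proof (intro divide_right_mono power_mono)
      have "\<bar>th k * u\<bar> \<le> \<bar>th k\<bar> * 1" unfolding abs_mult using that by (intro mult_left_mono) auto
      also have "\<dots> \<le> 2 * pi * D" using freq[OF that(1)] by (simp add: th_def abs_mult)
      finally show "\<bar>th k * u\<bar> \<le> 2 * pi * D" .
    qed auto
    finally show ?thesis by (simp only: \<epsilon>_def)
  qed
  have nq: "norm (q x u) = norm (trig_poly F a (x + u *\<^sub>R v))" for x u
  proof -
    have "cis (- (2 * pi * \<mu> * u)) * trig_poly F a (x + u *\<^sub>R v) = q x u"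
      unfolding trig_poly_translate q_def trig_poly_def sum_distrib_left
      by (intro sum.cong refl) (simp add: chr_def th_def cis_mult mult_ac inner_scaleR_right algebra_simps)
    then show ?thesis by (metis norm_cis norm_mult mult_1)
  qed
  \<comment> \<open>At every time \<open>u\<close> the coefficients of \<open>q\<close> differ from
    \<open>a\<close> by phases only, so the full mass is seen at each \<open>u\<close>.\<close>
  have X_q: "X = (LINT x|torus. (norm (q x u))\<^sup>2)" for u
    unfolding q_def parseval[OF F] X_def by (simp add: norm_mult)
  have r_le: "(LINT x|torus. (norm (r x u))\<^sup>2) \<le> \<epsilon>\<^sup>2 * X" if "u \<in> {0..1}" for u
    unfolding r_def X_def by (intro parseval_le F rT that)
  have pb: "norm (p x u) \<le> (\<Sum>k\<in>F. norm (a k) * (1 + \<epsilon>))" if "u \<in> {0..1}" for x u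
  proof -
    have "norm (T k u) \<le> 1 + \<epsilon>" if "k \<in> F" for k
      using rT[OF that \<open>u \<in> {0..1}\<close>] norm_triangle_ineq4[of "cis (th k * u)" "cis (th k * u) - T k u"] by simp
    then show ?thesis
      unfolding p_def by (intro order_trans[OF norm_trig_poly_le] sum_mono) (simp add: norm_mult mult_left_mono)
  qed
  define B where "B = (\<Sum>k\<in>F. norm (a k) * (1 + \<epsilon>))"
  have cis_m[measurable]: "cis \<in> borel_measurable borel"
    by (intro borel_measurable_continuous_onI continuous_intros)
  have pm: "(\<lambda>z. p (fst z) (snd z)) \<in> borel_measurable (borel \<Otimes>\<^sub>M borel)"
    unfolding p_def trig_poly_def T_def by measurable
  have p2m: "(\<lambda>z. (norm (p (fst z) (snd z)))\<^sup>2) \<in> borel_measurable (borel \<Otimes>\<^sub>M borel)"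
    using pm by measurable
  have p2b: "norm ((norm (p x u))\<^sup>2) \<le> B\<^sup>2" if "u \<in> {0..1}" for x u
    using pb[OF that, of x] by (auto simp: B_def intro: power_mono)
  have [measurable]: "(\<lambda>z. g (fst z + snd z *\<^sub>R v)) \<in> borel_measurable (borel \<Otimes>\<^sub>M borel)"
    by measurable
  have gpm: "(\<lambda>z. g (fst z + snd z *\<^sub>R v) * (norm (p (fst z) (snd z)))\<^sup>2) \<in> borel_measurable (borel \<Otimes>\<^sub>M borel)"
    using p2m by measurable
  have gpb: "norm (g (x + u *\<^sub>R v) * (norm (p x u))\<^sup>2) \<le> M * B\<^sup>2" if "u \<in> {0..1}" for x u
    using g0[of "x + u *\<^sub>R v"] gM[of "x + u *\<^sub>R v"] p2b[OF that, of x] M0 by (auto simp: abs_mult intro!: mult_mono)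
  note fub1 = fubini_torus_seg[where H="\<lambda>x u. (norm (p x u))\<^sup>2", OF p2m p2b]
  note fub2 = fubini_torus_seg[where H="\<lambda>x u. g (x + u *\<^sub>R v) * (norm (p x u))\<^sup>2", OF gpm gpb]
  have remez: "(LINT u|unit_seg. (norm (p x u))\<^sup>2) \<le> K * (LINT u|unit_seg. g (x + u *\<^sub>R v) * (norm (p x u))\<^sup>2)"
    if cx: "c \<le> (LINT u|unit_seg. g (x + u *\<^sub>R v))" for x
  proof -
    \<comment> \<open>\<open>p x\<close> collected by powers of \<open>u\<close>; the coefficients
      depend on \<open>x\<close>, the bound on the degree does not.\<close>
    define P where "P = (\<Sum>m\<le>n. monom (\<Sum>k\<in>F. a k * chr k x * (\<i> * of_real (th k)) ^ m / fact m) m)"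
    have "degree P \<le> n"
      unfolding P_def by (intro degree_sum_le) (auto intro: order_trans[OF degree_monom_le])
    have P: "poly P (of_real u) = p x u" for u
    proof -
      have "poly P (of_real u) = (\<Sum>m\<le>n. \<Sum>k\<in>F. a k * chr k x * (\<i> * of_real (th k)) ^ m / fact m * of_real u ^ m)"
        by (simp add: P_def poly_sum poly_monom sum_distrib_right)
      also have "\<dots> = (\<Sum>k\<in>F. \<Sum>m\<le>n. a k * chr k x * (\<i> * of_real (th k)) ^ m / fact m * of_real u ^ m)"
        by (rule sum.swap)
      also have "\<dots> = p x u"
        unfolding p_def trig_poly_def T_def sum_distrib_left sum_distrib_right
        by (intro sum.cong refl) (simp add: power_mult_distrib mult_ac)
      finally show ?thesis .
    qed
    have [measurable]: "(\<lambda>u. g (x + u *\<^sub>R v)) \<in> borel_measurable borel" by measurable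
    have bd: "(norm (p x u))\<^sup>2 \<le> K * (LINT u|unit_seg. g (x + u *\<^sub>R v) * (norm (p x u))\<^sup>2)" if "u \<in> {0..1}" for u
      using weighted_remez[OF \<open>degree P \<le> n\<close> _ _ _ c cx that, of M] g0 gM
      unfolding P K_def by simp
    have [measurable]: "(\<lambda>u. (norm (p x u))\<^sup>2) \<in> borel_measurable borel"
      unfolding p_def trig_poly_def T_def by measurable
    have "(LINT u|unit_seg. (norm (p x u))\<^sup>2) \<le> (LINT u'|unit_seg. K * (LINT u|unit_seg. g (x + u *\<^sub>R v) * (norm (p x u))\<^sup>2))"
      by (intro integral_mono integrable_unit_seg_bounded[OF borel_measurable_unit_seg p2b])
        (auto intro: integrable_unit_seg_bounded bd simp: space_restrict_space)
    then show ?thesis by simp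
  qed
  have le1: "X - 2 * (\<epsilon>\<^sup>2 * X) \<le> 2 * (LINT x|torus. (norm (p x u))\<^sup>2)" if u: "u \<in> {0..1}" for u
  proof -
    have "X \<le> (LINT x|torus. 2 * (norm (p x u))\<^sup>2 + 2 * (norm (r x u))\<^sup>2)"
      unfolding X_q[of u]
      by (intro integral_mono Bochner_Integration.integrable_add integrable_mult_right)
        (auto simp: q_def p_def r_def integrable_trig_poly_sq, auto simp: qpr[unfolded q_def p_def r_def] power2_norm_add_le)
    also have "\<dots> = 2 * (LINT x|torus. (norm (p x u))\<^sup>2) + 2 * (LINT x|torus. (norm (r x u))\<^sup>2)"
      by (subst Bochner_Integration.integral_add) (auto simp: p_def r_def integrable_trig_poly_sq)
    finally show ?thesis using r_le[OF u] by linarith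
  qed
  have le2: "(LINT x|torus. g (x + u *\<^sub>R v) * (norm (p x u))\<^sup>2) \<le> 2 * Y + 2 * M * (\<epsilon>\<^sup>2 * X)" if u: "u \<in> {0..1}" for u
  proof -
    have "(LINT x|torus. g (x + u *\<^sub>R v) * (norm (p x u))\<^sup>2)
        \<le> (LINT x|torus. 2 * (g (x + u *\<^sub>R v) * (norm (q x u))\<^sup>2) + 2 * M * (norm (r x u))\<^sup>2)"
    proof (intro integral_mono Bochner_Integration.integrable_add integrable_mult_right)
      fix x
      have "(norm (p x u))\<^sup>2 \<le> 2 * (norm (q x u))\<^sup>2 + 2 * (norm (r x u))\<^sup>2"
        using power2_norm_add_le[of "q x u" "- r x u"] by (simp add: qpr)
      then have "g (x + u *\<^sub>R v) * (norm (p x u))\<^sup>2 \<le> g (x + u *\<^sub>R v) * (2 * (norm (q x u))\<^sup>2 + 2 * (norm (r x u))\<^sup>2)"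
        using g0 by (rule mult_left_mono)
      also have "\<dots> \<le> 2 * (g (x + u *\<^sub>R v) * (norm (q x u))\<^sup>2) + 2 * M * (norm (r x u))\<^sup>2"
        using mult_right_mono[OF gM[of "x + u *\<^sub>R v"], of "2 * (norm (r x u))\<^sup>2"] by (simp add: algebra_simps)
      finally show "g (x + u *\<^sub>R v) * (norm (p x u))\<^sup>2
          \<le> 2 * (g (x + u *\<^sub>R v) * (norm (q x u))\<^sup>2) + 2 * M * (norm (r x u))\<^sup>2" .
    qed (auto simp: q_def p_def r_def integrable_trig_poly_sq integrable_weight_trig_poly_sq[OF g])
    also have "\<dots> = 2 * (LINT x|torus. g (x + u *\<^sub>R v) * (norm (q x u))\<^sup>2) + 2 * M * (LINT x|torus. (norm (r x u))\<^sup>2)"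
      by (subst Bochner_Integration.integral_add)
        (auto simp: q_def r_def integrable_trig_poly_sq integrable_weight_trig_poly_sq[OF g])
    \<comment> \<open>Translation invariance removes the shift: the weighted mass is the same at
      every time.\<close>
    also have "(LINT x|torus. g (x + u *\<^sub>R v) * (norm (q x u))\<^sup>2) = Y"
      unfolding nq Y_def
      by (rule integral_torus_translate[where F="\<lambda>x. g x * (norm (trig_poly F a x))\<^sup>2"], measurable)
        (use per periodic_trig_poly[of F a] in \<open>simp add: periodic_def\<close>)
    finally show ?thesis
      using mult_left_mono[OF r_le[OF u], of "2 * M"] M0 by simp
  qed
  \<comment> \<open>The bounds \<open>le1\<close> and \<open>le2\<close> hold at each single time,
    whereas the Remez inequality needs a whole segment; Fubini mediates between the two.\<close>
  have "X - 2 * (\<epsilon>\<^sup>2 * X) = (LINT u|unit_seg. X - 2 * (\<epsilon>\<^sup>2 * X))" by simp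
  also have "\<dots> \<le> (LINT u|unit_seg. 2 * (LINT x|torus. (norm (p x u))\<^sup>2))"
    by (intro integral_mono integrable_mult_right fub1 le1)
      (auto intro: integrable_unit_seg_bounded simp: space_restrict_space)
  also have "\<dots> = 2 * (LINT x|torus. LINT u|unit_seg. (norm (p x u))\<^sup>2)"
    by (simp only: integral_mult_right_zero fub1(3))
  also have "(LINT x|torus. LINT u|unit_seg. (norm (p x u))\<^sup>2) \<le>
      (LINT x|torus. K * (LINT u|unit_seg. g (x + u *\<^sub>R v) * (norm (p x u))\<^sup>2))"
    using lb unfolding line_bound_def
    by (intro integral_mono_AE integrable_mult_right fub1 fub2) (auto elim!: eventually_mono intro: remez)
  also have "\<dots> = K * (LINT u|unit_seg. LINT x|torus. g (x + u *\<^sub>R v) * (norm (p x u))\<^sup>2)"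
    by (simp only: integral_mult_right_zero fub2(3))
  also have "(LINT u|unit_seg. LINT x|torus. g (x + u *\<^sub>R v) * (norm (p x u))\<^sup>2) \<le> (LINT u|unit_seg. 2 * Y + 2 * M * (\<epsilon>\<^sup>2 * X))"
    by (intro integral_mono fub2 le2) (auto intro: integrable_unit_seg_bounded simp: space_restrict_space)
  finally show ?thesis using K0 by (simp add: mult_left_mono)
qed

lemma power_over_fact_tendsto_0: "(\<lambda>n. x ^ n / fact n :: real) \<longlonglongrightarrow> 0"
  using summable_LIMSEQ_zero[OF summable_exp[of x]] by (simp add: divide_inverse mult.commute)

lemma power_over_fact_le_exp:
  assumes "0 \<le> (x::real)"
  shows "x ^ n / fact n \<le> exp x"
proof -
  have "(\<Sum>m\<in>{n}. x ^ m /\<^sub>R fact m) \<le> (\<Sum>m. x ^ m /\<^sub>R fact m)"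
    using assms by (intro sum_le_suminf summable_exp_generic) auto
  then show ?thesis by (simp add: exp_def divide_inverse mult.commute)
qed

text \<open>The Taylor error has the factor \<open>1 / n!\<close>, which beats the exponential growth of the Remez constant.\<close>

lemma logvinenko_sereda:
  assumes M: "0 < M" and c: "0 < c" and D: "0 \<le> D"
  shows "\<exists>C>0. \<forall>g v \<mu> F (a :: int \<times> int \<Rightarrow> complex).
    weight M g \<and> line_bound c v g \<and> finite F \<and> (\<forall>k\<in>F. \<bar>lattice_point k \<bullet> v - \<mu>\<bar> \<le> D) \<longrightarrow>
    (\<Sum>k\<in>F. (norm (a k))\<^sup>2) \<le> C * (LINT x|torus. g x * (norm (trig_poly F a x))\<^sup>2)"
proof -
  define S where "S n = (8 * M * real (Suc n) / c) ^ n / fact n" for n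
  define \<epsilon> where "\<epsilon> n = (2 * pi * D) ^ Suc n / fact n" for n :: nat
  have e0: "\<epsilon> \<longlonglongrightarrow> 0"
    using tendsto_mult_left_zero[OF power_over_fact_tendsto_0[of "2 * pi * D"], of "2 * pi * D"]
    by (simp add: \<epsilon>_def[abs_def] mult_ac)
  have Se0: "(\<lambda>n. S n * \<epsilon> n) \<longlonglongrightarrow> 0"
  proof (rule tendsto_sandwich[OF _ _ tendsto_const])
    define A where "A = 8 * M / c"
    let ?z = "A * exp 1 * (2 * pi * D)"
    show "(\<lambda>n. exp 1 * (2 * pi * D) * (?z ^ n / fact n)) \<longlonglongrightarrow> 0"
      by (intro tendsto_mult_right_zero power_over_fact_tendsto_0)
    show "\<forall>\<^sub>F n in sequentially. 0 \<le> S n * \<epsilon> n"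
      using M c D by (intro always_eventually) (auto simp: S_def \<epsilon>_def)
    show "\<forall>\<^sub>F n in sequentially. S n * \<epsilon> n \<le> exp 1 * (2 * pi * D) * (?z ^ n / fact n)"
    proof (intro always_eventually allI)
      fix n
      \<comment> \<open>\<open>real (Suc n) ^ n / fact n\<close> is one term of the exponential
        series at \<open>Suc n\<close>; hence \<open>S n\<close> grows only exponentially.\<close>
      have "S n = A ^ n * (real (Suc n) ^ n / fact n)"
        by (simp add: S_def A_def power_mult_distrib power_divide del: of_nat_Suc)
      also have "\<dots> \<le> A ^ n * exp (real (Suc n))"
        using M c by (intro mult_left_mono power_over_fact_le_exp) (auto simp: A_def)
      also have "exp (real (Suc n)) = exp 1 * exp 1 ^ n"
        by (simp add: exp_add exp_of_nat_mult[symmetric])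
      finally have "S n * \<epsilon> n \<le> (A ^ n * (exp 1 * exp 1 ^ n)) * \<epsilon> n"
        using D by (intro mult_right_mono) (auto simp: \<epsilon>_def)
      also have "\<dots> = exp 1 * (2 * pi * D) * (?z ^ n / fact n)"
        by (simp only: \<epsilon>_def power_mult_distrib power_Suc mult_ac times_divide_eq_right times_divide_eq_left)
      finally show "S n * \<epsilon> n \<le> exp 1 * (2 * pi * D) * (?z ^ n / fact n)" .
    qed
  qed
  \<comment> \<open>This sequence is the coefficient of \<open>X\<close> on the right of
    \<open>logvinenko_sereda_step\<close>; once it is below one half, that part is absorbed into the
    left side.\<close>
  have "(\<lambda>n. 8 * M / c * (S n * \<epsilon> n)\<^sup>2 + 2 * (\<epsilon> n)\<^sup>2) \<longlonglongrightarrow> 8 * M / c * 0\<^sup>2 + 2 * 0\<^sup>2"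
    by (intro tendsto_intros e0 Se0)
  then have "\<forall>\<^sub>F n in sequentially. 8 * M / c * (S n * \<epsilon> n)\<^sup>2 + 2 * (\<epsilon> n)\<^sup>2 < 1 / 2"
    by (rule order_tendstoD) simp
  then obtain n where n: "8 * M / c * (S n * \<epsilon> n)\<^sup>2 + 2 * (\<epsilon> n)\<^sup>2 < 1 / 2"
    by (auto simp: eventually_sequentially)
  show ?thesis
  proof (intro exI[of _ "8 * (2 / c * (S n)\<^sup>2)"] conjI allI impI)
    show "0 < 8 * (2 / c * (S n)\<^sup>2)"
      using M c by (simp add: S_def)
    fix g v \<mu> F and a :: "int \<times> int \<Rightarrow> complex"
    assume "weight M g \<and> line_bound c v g \<and> finite F \<and> (\<forall>k\<in>F. \<bar>lattice_point k \<bullet> v - \<mu>\<bar> \<le> D)"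
    then have A: "weight M g" "line_bound c v g" "finite F" "\<And>k. k \<in> F \<Longrightarrow> \<bar>lattice_point k \<bullet> v - \<mu>\<bar> \<le> D"
      by blast+
    define X where "X = (\<Sum>k\<in>F. (norm (a k))\<^sup>2)"
    define Y where "Y = (LINT x|torus. g x * (norm (trig_poly F a x))\<^sup>2)"
    have "X \<le> 2 * (2 / c * (S n)\<^sup>2 * (2 * Y + 2 * M * ((\<epsilon> n)\<^sup>2 * X))) + 2 * ((\<epsilon> n)\<^sup>2 * X)"
      using logvinenko_sereda_step[OF A(1,2) c A(3,4), where n=n and a=a]
      unfolding X_def Y_def S_def \<epsilon>_def .
    also have "\<dots> = 4 * (2 / c * (S n)\<^sup>2) * Y + (8 * M / c * (S n * \<epsilon> n)\<^sup>2 + 2 * (\<epsilon> n)\<^sup>2) * X"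
      by (simp add: algebra_simps power_mult_distrib)
    also have "\<dots> \<le> 4 * (2 / c * (S n)\<^sup>2) * Y + 1 / 2 * X"
      by (intro add_left_mono mult_right_mono less_imp_le[OF n]) (simp add: X_def sum_nonneg)
    finally show "X \<le> 8 * (2 / c * (S n)\<^sup>2) * Y" by linarith
  qed
qed

section \<open>Frequencies in two antipodal intervals\<close>

lemma norm_cis_minus_one_le: "norm (cis t - 1) \<le> \<bar>t\<bar>"
proof -
  have "norm (cis t - 1) = 2 * \<bar>sin (t / 2)\<bar>"
    using dist_exp_i_1[of t] by (simp add: cis_conv_exp)
  also have "\<dots> \<le> 2 * \<bar>t / 2\<bar>"
    by (intro mult_left_mono abs_sin_x_le_abs_x) simp
  finally show ?thesis by simp
qed

lemma cis_inj_of_close: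
  assumes "\<bar>a - b\<bar> < 2 * pi" "cis a = cis b"
  shows "a = b"
proof -
  have e: "exp (\<i> * of_real a) = exp (\<i> * of_real b)"
    using assms(2) by (simp only: cis_conv_exp)
  have "\<i> * complex_of_real a = \<i> * of_real b"
    by (rule exp_complex_eqI[OF _ e]) (use assms(1) in simp)
  then show ?thesis by simp
qed

lemma inj_on_roots_of_unity:
  assumes "0 < N"
  shows "inj_on (\<lambda>j. cis (- (2 * pi * real j / real N))) {..<N}"
proof (rule inj_onI)
  fix i j assume ij: "i \<in> {..<N}" "j \<in> {..<N}"
    "cis (- (2 * pi * real i / real N)) = cis (- (2 * pi * real j / real N))"
  define a b where "a = - (2 * pi * real i / real N)" and "b = - (2 * pi * real j / real N)"
  have "\<bar>real j - real i\<bar> < real N" using ij by auto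
  then have "2 * pi * (\<bar>real j - real i\<bar> / real N) < 2 * pi * 1"
    using assms by (intro mult_strict_left_mono) auto
  moreover have "a - b = 2 * pi * ((real j - real i) / real N)"
    by (simp add: a_def b_def right_diff_distrib diff_divide_distrib)
  ultimately have "\<bar>a - b\<bar> < 2 * pi"
    by (simp add: abs_mult)
  then have "a = b"
    by (rule cis_inj_of_close) (use ij(3) in \<open>simp only: a_def b_def\<close>)
  then have "real i = real j"
    using assms by (simp add: a_def b_def)
  then show "i = j" by simp
qed

lemma finite_inj_separated:
  fixes z :: "'b \<Rightarrow> 'a::metric_space"
  assumes "finite I" "inj_on z I"
  shows "\<exists>\<delta>>0. \<forall>i\<in>I. \<forall>j\<in>I. i \<noteq> j \<longrightarrow> \<delta> \<le> dist (z i) (z j)"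
proof -
  let ?P = "{p \<in> I \<times> I. fst p \<noteq> snd p}"
  \<comment> \<open>The element 1 keeps the set nonempty when \<open>I\<close> has fewer than two
    members.\<close>
  let ?D = "insert 1 ((\<lambda>p. dist (z (fst p)) (z (snd p))) ` ?P)"
  have fin: "finite ?D" using assms(1) by simp
  have pos: "0 < d" if "d \<in> ?D" for d
    using that assms(2) by (auto simp: inj_on_def)
  show ?thesis
  proof (intro exI[of _ "Min ?D"] conjI ballI impI)
    show "0 < Min ?D" using Min_in[OF fin] pos by blast
    fix i j assume "i \<in> I" "j \<in> I" "i \<noteq> j"
    then have "dist (z i) (z j) \<in> ?D" by (force intro!: image_eqI[where x="(i, j)"])
    then show "Min ?D \<le> dist (z i) (z j)" by (rule Min_le[OF fin])
  qed
qed

text \<open>The difference of the two combinations is \<open>(z - z') * q\<close>, so they determine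
  \<open>q\<close> with a loss of \<open>1 / \<delta>\<close>, and then \<open>p\<close>.\<close>

lemma two_phase_bound:
  fixes p q z z' :: complex
  assumes z: "norm z = 1" and "0 < \<delta>" "\<delta> \<le> dist z z'"
  shows "(norm p)\<^sup>2 + (norm q)\<^sup>2 \<le> (2 + 12 / \<delta>\<^sup>2) * ((norm (p + z * q))\<^sup>2 + (norm (p + z' * q))\<^sup>2)"
proof -
  let ?A = "p + z * q" and ?B = "p + z' * q"
  have q: "(norm q)\<^sup>2 \<le> 2 / \<delta>\<^sup>2 * ((norm ?A)\<^sup>2 + (norm ?B)\<^sup>2)"
  proof -
    have "(\<delta> * norm q)\<^sup>2 \<le> (norm ((z - z') * q))\<^sup>2"
      using assms by (intro power_mono) (auto simp: norm_mult dist_norm intro: mult_right_mono)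
    also have "(z - z') * q = ?A + (- ?B)" by (simp add: algebra_simps)
    also have "(norm \<dots>)\<^sup>2 \<le> 2 * (norm ?A)\<^sup>2 + 2 * (norm ?B)\<^sup>2"
      using power2_norm_add_le[of ?A "- ?B"] by (simp only: norm_minus_cancel)
    finally show ?thesis using assms by (simp add: power_mult_distrib field_simps)
  qed
  have "(norm p)\<^sup>2 \<le> 2 * (norm ?A)\<^sup>2 + 2 * (norm q)\<^sup>2"
    using power2_norm_add_le[of ?A "- (z * q)"] z by (simp add: norm_mult)
  moreover have "2 * (norm ?A)\<^sup>2 \<le> 2 * ((norm ?A)\<^sup>2 + (norm ?B)\<^sup>2)" by simp
  moreover have "3 * (2 / \<delta>\<^sup>2 * ((norm ?A)\<^sup>2 + (norm ?B)\<^sup>2)) \<le> 12 / \<delta>\<^sup>2 * ((norm ?A)\<^sup>2 + (norm ?B)\<^sup>2)"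
    by (simp add: divide_right_mono mult_right_mono flip: mult.assoc)
  ultimately show ?thesis using q by (simp only: distrib_right)
qed

text \<open>Take the index \<open>j0\<close> at which \<open>p + z j * q\<close> is smallest. Paired
  with \<open>j0\<close>, every other index satisfies the two-phase bound, and then its own term
  alone dominates. Giving up \<open>j0\<close> costs at most the weight \<open>M\<close>.\<close>

lemma all_but_one_phase:
  fixes p q :: complex and w :: "nat \<Rightarrow> real"
  assumes N: "0 < N" and z: "\<And>j. norm (z j) = 1" and \<delta>: "0 < \<delta>"
    and sep: "\<And>i j. i < N \<Longrightarrow> j < N \<Longrightarrow> i \<noteq> j \<Longrightarrow> \<delta> \<le> dist (z i) (z j)"
    and w: "\<And>j. 0 \<le> w j" "\<And>j. w j \<le> M"
  shows "((\<Sum>j<N. w j) - M) * ((norm p)\<^sup>2 + (norm q)\<^sup>2)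
    \<le> 2 * (2 + 12 / \<delta>\<^sup>2) * (\<Sum>j<N. w j * (norm (p + z j * q))\<^sup>2)"
proof -
  let ?A = "\<lambda>j. (norm (p + z j * q))\<^sup>2"
  let ?S = "(norm p)\<^sup>2 + (norm q)\<^sup>2" and ?C = "2 * (2 + 12 / \<delta>\<^sup>2)"
  have C0: "0 \<le> ?C" by simp
  obtain j0 where j0: "j0 < N" "\<And>j. j < N \<Longrightarrow> ?A j0 \<le> ?A j"
  proof -
    have "finite {..<N}" "{..<N} \<noteq> {}" using N by auto
    then show ?thesis
      using arg_min_if_finite[of "{..<N}" ?A] that[of "arg_min_on ?A {..<N}"] by (force simp: not_less)
  qed
  have each: "?S \<le> ?C * ?A j" if "j < N" "j \<noteq> j0" for j
  proof -
    have "?S \<le> (2 + 12 / \<delta>\<^sup>2) * (?A j + ?A j0)"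
      using that j0 by (intro two_phase_bound z \<delta> sep)
    also have "\<dots> \<le> (2 + 12 / \<delta>\<^sup>2) * (?A j + ?A j)"
      using j0(2)[OF that(1)] by (intro mult_left_mono) auto
    finally show ?thesis by (simp add: algebra_simps)
  qed
  have "((\<Sum>j<N. w j) - M) * ?S \<le> (\<Sum>j\<in>{..<N} - {j0}. w j) * ?S"
    using w(2)[of j0] j0(1) by (intro mult_right_mono) (auto simp: sum.remove[of "{..<N}" j0])
  also have "\<dots> \<le> (\<Sum>j\<in>{..<N} - {j0}. w j * (?C * ?A j))"
    unfolding sum_distrib_right by (intro sum_mono mult_left_mono each w) auto
  also have "\<dots> \<le> (\<Sum>j<N. w j * (?C * ?A j))"
    by (intro sum_mono2) (auto intro!: mult_nonneg_nonneg w C0)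
  also have "\<dots> = ?C * (\<Sum>j<N. w j * ?A j)"
    by (simp only: sum_distrib_left mult_ac)
  finally show ?thesis .
qed

text \<open>Over translations along \<open>\<nu>\<close> of length less than \<open>1 / (2 R)\<close> the amplitudes \<open>p\<close> and \<open>q\<close> of the two
  antipodal pieces are almost constant, while their relative phase runs through the \<open>N\<close>-th roots of
  unity. Since \<open>|p + z q|\<close> is small for at most one of these, averaging over \<open>N\<close> translations
  decouples the pieces, and each of them is handled by the case of a single frequency interval.\<close>

lemma logvinenko_sereda_antipodal:
  assumes M: "0 < M" and c: "0 < c" and D: "0 \<le> D" and len: "0 < len"
  shows "\<exists>C>0. \<exists>R\<^sub>1>0. \<forall>g \<nu> R F G (a :: int \<times> int \<Rightarrow> complex).
    weight M g \<and> line_bound c (len *\<^sub>R \<nu>) g \<and> R\<^sub>1 \<le> R \<and> finite F \<and> finite G \<and> F \<inter> G = {} \<and>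
    (\<forall>k\<in>F. \<bar>lattice_point k \<bullet> \<nu> - R\<bar> \<le> D) \<and> (\<forall>k\<in>G. \<bar>lattice_point k \<bullet> \<nu> + R\<bar> \<le> D) \<longrightarrow>
    (\<Sum>k\<in>F \<union> G. (norm (a k))\<^sup>2) \<le> C * (LINT x|torus. g x * (norm (trig_poly (F \<union> G) a x))\<^sup>2)"
proof -
  have D': "0 \<le> len * D" using D len by simp
  obtain C0 where C0: "0 < C0" and LS: "\<And>g v \<mu> F (a :: int \<times> int \<Rightarrow> complex). weight M g \<Longrightarrow> line_bound c v g \<Longrightarrow>
       finite F \<Longrightarrow> (\<forall>k\<in>F. \<bar>lattice_point k \<bullet> v - \<mu>\<bar> \<le> len * D) \<Longrightarrow>
       (\<Sum>k\<in>F. (norm (a k))\<^sup>2) \<le> C0 * (LINT x|torus. g x * (norm (trig_poly F a x))\<^sup>2)"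
    using logvinenko_sereda[OF M c D'] by blast
  \<comment> \<open>This makes \<open>N / C0 - M\<close> at least \<open>M\<close>: the lower bound
    summed over the translates survives the loss of one of them.\<close>
  obtain N :: nat where N: "2 * M * C0 \<le> real N" "0 < N"
  proof -
    obtain N :: nat where "2 * M * C0 < real N" using reals_Archimedean2 by blast
    moreover have "0 < 2 * M * C0" using M C0 by simp
    ultimately show ?thesis using that[of N] by (metis less_imp_le less_trans of_nat_0_less_iff)
  qed
  define z where "z j = cis (- (2 * pi * real j / real N))" for j
  have "inj_on z {..<N}"
    unfolding z_def[abs_def] by (rule inj_on_roots_of_unity[OF N(2)])
  then have "\<exists>\<delta>>0. \<forall>i\<in>{..<N}. \<forall>j\<in>{..<N}. i \<noteq> j \<longrightarrow> \<delta> \<le> dist (z i) (z j)"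
    by (intro finite_inj_separated) simp_all
  then obtain \<delta> where \<delta>: "0 < \<delta>" "\<And>i j. i < N \<Longrightarrow> j < N \<Longrightarrow> i \<noteq> j \<Longrightarrow> \<delta> \<le> dist (z i) (z j)"
    by auto
  define K where "K = 2 * (2 + 12 / \<delta>\<^sup>2)"
  have K: "0 < K" by (simp add: K_def add_pos_nonneg)
  \<comment> \<open>From this radius on, the phase error \<open>\<epsilon> = pi * D / R\<close>
    satisfies \<open>2 * K * N * \<epsilon>\<^sup>2 \<le> 1 / 2\<close> and can be absorbed. The
    summand 1 keeps \<open>R1\<close> positive when \<open>D = 0\<close>.\<close>
  define R1 where "R1 = 1 + sqrt (4 * K * real N) * (pi * D)"
  have R1: "0 < R1" "1 \<le> R1" using K D by (auto simp: R1_def add_pos_nonneg)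
  show ?thesis
  proof (rule exI[of _ "4 * K * real N / M"], rule conjI[rotated], rule exI[of _ R1], intro conjI allI impI)
    show "0 < 4 * K * real N / M" using K M N by simp
    show "0 < R1" by (rule R1)
    fix g \<nu> R F G and a :: "int \<times> int \<Rightarrow> complex"
    assume A: "weight M g \<and> line_bound c (len *\<^sub>R \<nu>) g \<and> R1 \<le> R \<and> finite F \<and> finite G \<and> F \<inter> G = {} \<and>
      (\<forall>k\<in>F. \<bar>lattice_point k \<bullet> \<nu> - R\<bar> \<le> D) \<and> (\<forall>k\<in>G. \<bar>lattice_point k \<bullet> \<nu> + R\<bar> \<le> D)"
    then have g: "weight M g" and lb: "line_bound c (len *\<^sub>R \<nu>) g" and R: "R1 \<le> R"
      and F: "finite F" and G: "finite G" and FG: "F \<inter> G = {}"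
      and freqF: "\<And>k. k \<in> F \<Longrightarrow> \<bar>lattice_point k \<bullet> \<nu> - R\<bar> \<le> D"
      and freqG: "\<And>k. k \<in> G \<Longrightarrow> \<bar>lattice_point k \<bullet> \<nu> + R\<bar> \<le> D"
      by blast+
    have g0: "\<And>x. 0 \<le> g x" and gM: "\<And>x. g x \<le> M" and per: "periodic g"
      and [measurable]: "g \<in> borel_measurable borel"
      using g by (auto simp: weight_def)
    have R0: "0 < R" using R R1 by linarith
    define X where "X = (\<Sum>k\<in>F \<union> G. (norm (a k))\<^sup>2)"
    define Y where "Y = (LINT x|torus. g x * (norm (trig_poly (F \<union> G) a x))\<^sup>2)"
    have X0: "0 \<le> X" by (simp add: X_def sum_nonneg)
    \<comment> \<open>After this shift, waves of frequency \<open>R\<close> and \<open>- R\<close>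
      along \<open>\<nu>\<close> differ by the phase \<open>2 * pi * j / N\<close>. Up to a common
      factor the ideal multipliers are \<open>b\<close>, equal to 1 on \<open>F\<close> and to
      \<open>z j\<close> on \<open>G\<close>; \<open>r\<close> is the error caused by the spread of
      the frequencies around \<open>R\<close> and \<open>- R\<close>.\<close>
    define s where "s j = (real j / (2 * R * real N)) *\<^sub>R \<nu>" for j
    define \<epsilon> where "\<epsilon> = pi * D / R"
    define b where "b j k = (if k \<in> F then 1 else z j)" for j k
    define r where "r j k = b j k * (cis (2 * pi * (real j / (2 * R * real N)) * (lattice_point k \<bullet> \<nu> - (if k \<in> F then R else - R))) - 1)" for j k
    have phase: "cis (- (2 * pi * (real j / (2 * R * real N)) * R)) * chr k (s j) = b j k + r j k" if "k \<in> F \<union> G" for j k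
    proof -
      have zz: "z j = cis (- (2 * (2 * pi * (real j / (2 * R * real N)) * R)))"
      proof -
        have "2 * (2 * pi * (real j / (2 * R * real N)) * R) = 2 * pi * real j / real N"
          using R0 N(2) by (simp add: field_simps)
        then show ?thesis by (simp only: z_def)
      qed
      show ?thesis
        unfolding r_def b_def zz
        by (simp add: chr_def s_def cis_mult algebra_simps)
    qed
    have nf: "norm (trig_poly (F \<union> G) a (x + s j)) =
        norm (trig_poly (F \<union> G) (\<lambda>k. a k * b j k) x + trig_poly (F \<union> G) (\<lambda>k. a k * r j k) x)" for j x
    proof -
      have "cis (- (2 * pi * (real j / (2 * R * real N)) * R)) * trig_poly (F \<union> G) a (x + s j) =
          (\<Sum>k\<in>F \<union> G. a k * (cis (- (2 * pi * (real j / (2 * R * real N)) * R)) * chr k (s j)) * chr k x)"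
        unfolding trig_poly_translate unfolding trig_poly_def sum_distrib_left by (simp only: mult_ac)
      also have "\<dots> = (\<Sum>k\<in>F \<union> G. a k * (b j k + r j k) * chr k x)"
        by (intro sum.cong refl) (simp only: phase)
      also have "\<dots> = trig_poly (F \<union> G) (\<lambda>k. a k * b j k) x + trig_poly (F \<union> G) (\<lambda>k. a k * r j k) x"
        by (simp only: trig_poly_def distrib_left distrib_right sum.distrib)
      finally have "norm (cis (- (2 * pi * (real j / (2 * R * real N)) * R)) * trig_poly (F \<union> G) a (x + s j)) =
          norm (trig_poly (F \<union> G) (\<lambda>k. a k * b j k) x + trig_poly (F \<union> G) (\<lambda>k. a k * r j k) x)"
        by (rule arg_cong)
      then show ?thesis by (simp only: norm_mult norm_cis mult_1)
    qed
    have split: "trig_poly (F \<union> G) (\<lambda>k. a k * b j k) x = trig_poly F a x + z j * trig_poly G a x" for j x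
    proof -
      have "trig_poly (F \<union> G) (\<lambda>k. a k * b j k) x = (\<Sum>k\<in>F. a k * b j k * chr k x) + (\<Sum>k\<in>G. a k * b j k * chr k x)"
        unfolding trig_poly_def by (rule sum.union_disjoint[OF F G FG])
      also have "(\<Sum>k\<in>F. a k * b j k * chr k x) = trig_poly F a x"
        by (simp add: trig_poly_def b_def)
      also have "(\<Sum>k\<in>G. a k * b j k * chr k x) = z j * trig_poly G a x"
        unfolding trig_poly_def sum_distrib_left
        by (intro sum.cong refl) (use FG in \<open>auto simp: b_def\<close>)
      finally show ?thesis .
    qed
    have r_le: "(LINT x|torus. (norm (trig_poly (F \<union> G) (\<lambda>k. a k * r j k) x))\<^sup>2) \<le> \<epsilon>\<^sup>2 * X" if j: "j < N" for j
      unfolding X_def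
    proof (rule parseval_le)
      fix k assume k: "k \<in> F \<union> G"
      define t where "t = lattice_point k \<bullet> \<nu> - (if k \<in> F then R else - R)"
      have t: "\<bar>t\<bar> \<le> D" using k freqF[of k] freqG[of k] by (auto simp: t_def)
      have "norm (r j k) \<le> norm (cis (2 * pi * (real j / (2 * R * real N)) * t) - 1)"
        by (simp add: r_def b_def t_def z_def norm_mult)
      also have "\<dots> \<le> \<bar>2 * pi * (real j / (2 * R * real N)) * t\<bar>"
        by (rule norm_cis_minus_one_le)
      also have "\<dots> = pi * \<bar>t\<bar> / R * (real j / real N)"
        using R0 N by (simp add: abs_mult)
      also have "\<dots> \<le> pi * D / R * 1"
        using R0 N j t by (intro mult_mono divide_right_mono mult_left_mono) auto
      finally show "norm (r j k) \<le> \<epsilon>" by (simp add: \<epsilon>_def)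
    qed (use F G in simp)
    have upper: "(LINT x|torus. g (x + s j) * (norm (trig_poly F a x + z j * trig_poly G a x))\<^sup>2) \<le> 2 * Y + 2 * M * (\<epsilon>\<^sup>2 * X)"
      if j: "j < N" for j
    proof -
      let ?b = "\<lambda>x. trig_poly (F \<union> G) (\<lambda>k. a k * b j k) x" and ?r = "\<lambda>x. trig_poly (F \<union> G) (\<lambda>k. a k * r j k) x"
      have shift_int: "integrable torus (\<lambda>x. g (x + s j) * (norm (trig_poly (F \<union> G) a (x + s j)))\<^sup>2)"
        unfolding trig_poly_translate by (rule integrable_weight_trig_poly_sq[OF g])
      have "(LINT x|torus. g (x + s j) * (norm (?b x))\<^sup>2)
          \<le> (LINT x|torus. 2 * (g (x + s j) * (norm (trig_poly (F \<union> G) a (x + s j)))\<^sup>2) + 2 * M * (norm (?r x))\<^sup>2)"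
      proof (intro integral_mono Bochner_Integration.integrable_add integrable_mult_right shift_int
          integrable_weight_trig_poly_sq[OF g] integrable_trig_poly_sq)
        fix x
        have "(norm (?b x))\<^sup>2 \<le> 2 * (norm (?b x + ?r x))\<^sup>2 + 2 * (norm (?r x))\<^sup>2"
          using power2_norm_add_le[of "?b x + ?r x" "- ?r x"] by simp
        then have "g (x + s j) * (norm (?b x))\<^sup>2 \<le> g (x + s j) * (2 * (norm (?b x + ?r x))\<^sup>2 + 2 * (norm (?r x))\<^sup>2)"
          using g0 by (rule mult_left_mono)
        also have "\<dots> \<le> 2 * (g (x + s j) * (norm (?b x + ?r x))\<^sup>2) + 2 * M * (norm (?r x))\<^sup>2"
          using mult_right_mono[OF gM[of "x + s j"], of "2 * (norm (?r x))\<^sup>2"] by (simp add: algebra_simps)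
        finally show "g (x + s j) * (norm (?b x))\<^sup>2
            \<le> 2 * (g (x + s j) * (norm (trig_poly (F \<union> G) a (x + s j)))\<^sup>2) + 2 * M * (norm (?r x))\<^sup>2"
          by (simp only: nf)
      qed
      also have "\<dots> = 2 * (LINT x|torus. g (x + s j) * (norm (trig_poly (F \<union> G) a (x + s j)))\<^sup>2)
          + 2 * M * (LINT x|torus. (norm (?r x))\<^sup>2)"
        by (subst Bochner_Integration.integral_add) (auto simp: shift_int integrable_trig_poly_sq)
      also have "(LINT x|torus. g (x + s j) * (norm (trig_poly (F \<union> G) a (x + s j)))\<^sup>2) = Y"
        unfolding Y_def
        by (rule integral_torus_translate[where F="\<lambda>x. g x * (norm (trig_poly (F \<union> G) a x))\<^sup>2"], measurable)
          (use per periodic_trig_poly[of "F \<union> G" a] in \<open>simp add: periodic_def\<close>)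
      finally have "(LINT x|torus. g (x + s j) * (norm (?b x))\<^sup>2) \<le> 2 * Y + 2 * M * (LINT x|torus. (norm (?r x))\<^sup>2)" .
      moreover have "2 * M * (LINT x|torus. (norm (?r x))\<^sup>2) \<le> 2 * M * (\<epsilon>\<^sup>2 * X)"
        using M by (intro mult_left_mono r_le j) simp
      ultimately show ?thesis
        unfolding split by linarith
    qed
    \<comment> \<open>The shift is moved from the weight to the polynomial, where it changes only
      the phases of \<open>a\<close>; the one-interval inequality then applies to each piece by
      itself.\<close>
    have lower: "(\<Sum>k\<in>H. (norm (a k))\<^sup>2) / C0 \<le> (LINT x|torus. g (x + s j) * (norm (trig_poly H a x))\<^sup>2)"
      if H: "finite H" "\<And>k. k \<in> H \<Longrightarrow> \<bar>lattice_point k \<bullet> \<nu> - \<mu>\<bar> \<le> D" for H \<mu> j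
    proof -
      have eq: "(LINT x|torus. g (x + s j) * (norm (trig_poly H a x))\<^sup>2) =
          (LINT x|torus. g x * (norm (trig_poly H (\<lambda>k. a k * chr k (- s j)) x))\<^sup>2)"
        using integral_torus_translate[where F="\<lambda>x. g x * (norm (trig_poly H (\<lambda>k. a k * chr k (- s j)) x))\<^sup>2" and v="s j"]
          per periodic_trig_poly[of H "\<lambda>k. a k * chr k (- s j)"]
        by (simp add: periodic_def flip: trig_poly_translate)
      have "(\<Sum>k\<in>H. (norm (a k * chr k (- s j)))\<^sup>2) \<le>
          C0 * (LINT x|torus. g x * (norm (trig_poly H (\<lambda>k. a k * chr k (- s j)) x))\<^sup>2)"
      proof (rule LS[OF g lb H(1), of "len * \<mu>"], rule ballI)
        fix k assume "k \<in> H"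
        then have "len * \<bar>lattice_point k \<bullet> \<nu> - \<mu>\<bar> \<le> len * D"
          using H(2) len by (intro mult_left_mono) auto
        then show "\<bar>lattice_point k \<bullet> (len *\<^sub>R \<nu>) - len * \<mu>\<bar> \<le> len * D"
          using len by (simp add: abs_mult flip: right_diff_distrib)
      qed
      then show ?thesis
        using C0 unfolding eq by (simp add: norm_mult field_simps)
    qed
    have pw: "((\<Sum>j<N. g (x + s j)) - M) * ((norm (trig_poly F a x))\<^sup>2 + (norm (trig_poly G a x))\<^sup>2)
        \<le> K * (\<Sum>j<N. g (x + s j) * (norm (trig_poly F a x + z j * trig_poly G a x))\<^sup>2)" for x
      unfolding K_def by (rule all_but_one_phase[OF N(2) _ \<delta>]) (auto simp: z_def g0 gM)
    have sum_X: "X = (\<Sum>k\<in>F. (norm (a k))\<^sup>2) + (\<Sum>k\<in>G. (norm (a k))\<^sup>2)"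
      unfolding X_def by (rule sum.union_disjoint[OF F G FG])
    have intg: "integrable torus (\<lambda>x. g (x + s j) * (norm (trig_poly H a x))\<^sup>2)" for j H
      by (rule integrable_weight_trig_poly_sq[OF g])
    have intb: "integrable torus (\<lambda>x. g (x + s j) * (norm (trig_poly F a x + z j * trig_poly G a x))\<^sup>2)" for j
      unfolding split[symmetric] by (rule integrable_weight_trig_poly_sq[OF g])
    \<comment> \<open>The lower bounds concern \<open>F\<close> and \<open>G\<close> separately, the
      upper bounds only their combinations; \<open>pw\<close> links the two. The subtracted
      \<open>M * X\<close> pays for the one phase, varying with the point, that is given up
      there.\<close>
    have "(real N / C0 - M) * X = (\<Sum>j<N. (\<Sum>k\<in>F. (norm (a k))\<^sup>2) / C0 + (\<Sum>k\<in>G. (norm (a k))\<^sup>2) / C0) - M * X"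
      by (simp add: sum_X add_divide_distrib left_diff_distrib ring_distribs)
    also have "\<dots> \<le> (\<Sum>j<N. (LINT x|torus. g (x + s j) * (norm (trig_poly F a x))\<^sup>2) + (LINT x|torus. g (x + s j) * (norm (trig_poly G a x))\<^sup>2)) - M * X"
      by (intro diff_right_mono sum_mono add_mono lower[where \<mu>=R] lower[where \<mu>="-R"] F G)
        (use freqF freqG in auto)
    also have "\<dots> = (LINT x|torus. ((\<Sum>j<N. g (x + s j)) - M) * ((norm (trig_poly F a x))\<^sup>2 + (norm (trig_poly G a x))\<^sup>2))"
    proof -
      have e: "((\<Sum>j<N. g (x + s j)) - M) * ((norm (trig_poly F a x))\<^sup>2 + (norm (trig_poly G a x))\<^sup>2) =
          (\<Sum>j<N. g (x + s j) * (norm (trig_poly F a x))\<^sup>2 + g (x + s j) * (norm (trig_poly G a x))\<^sup>2)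
          - (M * (norm (trig_poly F a x))\<^sup>2 + M * (norm (trig_poly G a x))\<^sup>2)" for x
        by (simp add: left_diff_distrib sum_distrib_right distrib_left sum.distrib)
      show ?thesis
        unfolding e sum_X
        by (simp add: intg integrable_trig_poly_sq parseval F G distrib_left)
    qed
    also have "\<dots> \<le> (LINT x|torus. K * (\<Sum>j<N. g (x + s j) * (norm (trig_poly F a x + z j * trig_poly G a x))\<^sup>2))"
    proof (rule integral_mono[OF _ _ pw])
      show "integrable torus (\<lambda>x. ((\<Sum>j<N. g (x + s j)) - M) * ((norm (trig_poly F a x))\<^sup>2 + (norm (trig_poly G a x))\<^sup>2))"
        by (simp add: left_diff_distrib sum_distrib_right distrib_left intg integrable_trig_poly_sq)
    qed (simp add: intb)
    also have "\<dots> = K * (\<Sum>j<N. LINT x|torus. g (x + s j) * (norm (trig_poly F a x + z j * trig_poly G a x))\<^sup>2)"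
      by (simp add: intb)
    also have "\<dots> \<le> K * (\<Sum>j<N. 2 * Y + 2 * M * (\<epsilon>\<^sup>2 * X))"
      using K by (intro mult_left_mono sum_mono upper) auto
    also have "\<dots> = 2 * K * real N * Y + M * (2 * K * real N * \<epsilon>\<^sup>2) * X"
      by (simp add: algebra_simps)
    also have "\<dots> \<le> 2 * K * real N * Y + M * (1 / 2) * X"
    proof -
      have "sqrt (4 * K * real N) * (pi * D) \<le> R" using R by (simp add: R1_def)
      then have "(sqrt (4 * K * real N) * (pi * D))\<^sup>2 \<le> R\<^sup>2"
        using K D by (intro power_mono) auto
      then have "4 * K * real N * (pi * D)\<^sup>2 \<le> R\<^sup>2"
        using K by (simp add: power_mult_distrib)
      then have "2 * K * real N * \<epsilon>\<^sup>2 \<le> 1 / 2"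
        using R0 by (simp add: \<epsilon>_def power_divide field_simps)
      then show ?thesis
        using M X0 by (intro add_left_mono mult_right_mono mult_left_mono) auto
    qed
    finally have main: "(real N / C0 - M) * X \<le> 2 * K * real N * Y + M * (1 / 2) * X" .
    have "M \<le> real N / C0 - M" using N C0 by (simp add: field_simps)
    then have "M * X \<le> (real N / C0 - M) * X" using X0 by (rule mult_right_mono)
    with main have "M * X / 2 \<le> 2 * K * real N * Y" by simp
    then have "X \<le> 4 * K * real N / M * Y" using M by (simp add: field_simps)
    then show "(\<Sum>k\<in>F \<union> G. (norm (a k))\<^sup>2) \<le> 4 * K * real N / M * (LINT x|torus. g x * (norm (trig_poly (F \<union> G) a x))\<^sup>2)"
      unfolding X_def Y_def .
  qed
qed

section \<open>From tubes to lines\<close>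

lemma tonelli_plane_seg:
  fixes H :: "real \<times> real \<Rightarrow> real \<Rightarrow> ennreal"
  assumes H: "(\<lambda>p. H (fst p) (snd p)) \<in> borel_measurable (borel \<Otimes>\<^sub>M borel)"
  shows "(\<lambda>x. \<integral>\<^sup>+ u. H x u \<partial>unit_seg) \<in> borel_measurable borel"
    and "(\<integral>\<^sup>+ x. (\<integral>\<^sup>+ u. H x u \<partial>unit_seg) \<partial>lborel) = (\<integral>\<^sup>+ u. (\<integral>\<^sup>+ x. H x u \<partial>lborel) \<partial>unit_seg)"
proof -
  interpret S: finite_measure unit_seg by (rule finite_measure_unit_seg)
  interpret P: pair_sigma_finite lborel unit_seg ..
  have snd: "snd \<in> measurable (lborel \<Otimes>\<^sub>M unit_seg) borel" 
    using measurable_compose[OF measurable_snd borel_measurable_unit_seg[of "\<lambda>x. x" borel]] by simp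
  have fst: "fst \<in> measurable (lborel \<Otimes>\<^sub>M unit_seg) borel"
    by simp
  have m: "(\<lambda>p. H (fst p) (snd p)) \<in> borel_measurable (lborel \<Otimes>\<^sub>M unit_seg)"
    using measurable_compose[OF measurable_Pair[OF fst snd] H] by simp
  show "(\<lambda>x. \<integral>\<^sup>+ u. H x u \<partial>unit_seg) \<in> borel_measurable borel"
    using S.borel_measurable_nn_integral_fst[OF m] by simp
  show "(\<integral>\<^sup>+ x. (\<integral>\<^sup>+ u. H x u \<partial>unit_seg) \<partial>lborel) = (\<integral>\<^sup>+ u. (\<integral>\<^sup>+ x. H x u \<partial>lborel) \<partial>unit_seg)"
    using P.Fubini[OF m] by simp
qed

lemma nn_integral_lborel_translate:
  fixes F :: "'a::euclidean_space \<Rightarrow> ennreal"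
  assumes [measurable]: "F \<in> borel_measurable borel"
  shows "(\<integral>\<^sup>+ x. F (c + x) \<partial>lborel) = (\<integral>\<^sup>+ x. F x \<partial>lborel)"
proof -
  have "(\<integral>\<^sup>+ x. F x \<partial>lborel) = (\<integral>\<^sup>+ x. F x \<partial>distr lborel borel ((+) c))"
    by (simp add: lborel_distr_plus)
  also have "\<dots> = (\<integral>\<^sup>+ x. F (c + x) \<partial>lborel)"
    by (subst nn_integral_distr) auto
  finally show ?thesis by simp
qed

text \<open>A strict bound on an infimum is already satisfied by some member, so both infima turn
  into existential quantifiers. The sign of the lattice vector is free, since the lattice is
  symmetric.\<close>

lemma in_tube_iff:
  assumes "0 \<le> L"
  shows "y \<in> tube x \<nu> L \<delta> \<longleftrightarrow> y \<in> square \<and>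
    (\<exists>k. \<exists>t. 0 \<le> t \<and> t \<le> L \<and> norm (y + lattice_point k - x - t *\<^sub>R \<nu>) < \<delta>)"
proof -
  have bdd: "bdd_below (range (\<lambda>k. dist y (z + lattice_point k)))" for z
    by (rule bdd_belowI[of _ 0]) auto
  have nn: "0 \<le> torus_dist y z" for z
    unfolding torus_dist_def by (intro cINF_greatest) auto
  have ne: "geodesic x \<nu> L \<noteq> {}"
  proof -
    have "x + 0 *\<^sub>R \<nu> \<in> geodesic x \<nu> L"
      unfolding geodesic_def using assms by blast
    then show ?thesis by blast
  qed
  have "(INF z\<in>geodesic x \<nu> L. torus_dist y z) < \<delta> \<longleftrightarrow> (\<exists>z\<in>geodesic x \<nu> L. torus_dist y z < \<delta>)"
    by (intro cINF_less_iff ne) (auto intro!: bdd_belowI[of _ 0] nn)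
  also have "\<dots> \<longleftrightarrow> (\<exists>z\<in>geodesic x \<nu> L. \<exists>k. dist y (z + lattice_point k) < \<delta>)"
    unfolding torus_dist_def using bdd by (subst cINF_less_iff) auto
  also have "\<dots> \<longleftrightarrow> (\<exists>k. \<exists>t. 0 \<le> t \<and> t \<le> L \<and> norm (y - lattice_point k - x - t *\<^sub>R \<nu>) < \<delta>)"
  proof -
    have geo: "(\<exists>z\<in>geodesic x \<nu> L. P z) \<longleftrightarrow> (\<exists>t. 0 \<le> t \<and> t \<le> L \<and> P (x + t *\<^sub>R \<nu>))" for P
      unfolding geodesic_def by blast
    have "y - (x + t *\<^sub>R \<nu> + lattice_point k) = y - lattice_point k - x - t *\<^sub>R \<nu>" for t k
      by simp
    then show ?thesis
      unfolding geo dist_norm by (simp only:) blast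
  qed
  also have "\<dots> \<longleftrightarrow> (\<exists>k. \<exists>t. 0 \<le> t \<and> t \<le> L \<and> norm (y + lattice_point k - x - t *\<^sub>R \<nu>) < \<delta>)"
    by (metis add.inverse_inverse diff_minus_eq_add lattice_point_minus)
  finally show ?thesis by (auto simp: tube_def space_torus)
qed

lemma tube_borel:
  assumes "0 \<le> L"
  shows "tube x \<nu> L \<delta> \<in> sets borel"
proof -
  have "tube x \<nu> L \<delta> = square \<inter> (\<Union>k. \<Union>t\<in>{0..L}. ball (x + t *\<^sub>R \<nu> - lattice_point k) \<delta>)"
  proof (rule set_eqI)
    fix y
    have "dist (x + t *\<^sub>R \<nu> - lattice_point k) y = norm (y + lattice_point k - x - t *\<^sub>R \<nu>)" for k t
    proof -
      have "x + t *\<^sub>R \<nu> - lattice_point k - y = - (y + lattice_point k - x - t *\<^sub>R \<nu>)" by simp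
      then show ?thesis by (simp only: dist_norm norm_minus_cancel)
    qed
    then show "y \<in> tube x \<nu> L \<delta> \<longleftrightarrow> y \<in> square \<inter> (\<Union>k. \<Union>t\<in>{0..L}. ball (x + t *\<^sub>R \<nu> - lattice_point k) \<delta>)"
      unfolding in_tube_iff[OF assms] by (simp del: split_paired_Ex mem_Sigma_iff add: Bex_def conj_assoc)
  qed
  then show ?thesis by (simp only:) (intro sets.Int square_borel borel_open open_UN ballI open_ball)
qed

lemma sets_torus_borel: "A \<in> sets borel \<Longrightarrow> A \<subseteq> square \<Longrightarrow> A \<in> sets torus"
  unfolding torus_def by (subst sets_restrict_space_iff) (use square_lebesgue in \<open>auto simp: sets_completionI_sets\<close>)

text \<open>A tube is compared with an average of balls centred on its axis, from above here and from below in
  the next lemma, which avoids rotated rectangles. The axis is extended by \<open>1\<close> at both ends, so that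
  every point of the tube sees balls centred on an axis interval of length \<open>2 \<delta>\<close>.\<close>

lemma tube_integral_le:
  assumes g: "weight M g" and nu: "norm \<nu> = 1" and L: "0 < L" and d: "0 < \<delta>" "\<delta> \<le> 1"
  shows "(\<integral>\<^sup>+ y. ennreal (g y) * indicator (tube x \<nu> L \<delta>) y \<partial>torus)
    \<le> ennreal ((L + 2) / (2 * \<delta>)) * (\<integral>\<^sup>+ z. indicator (ball 0 (2 * \<delta>)) z *
        (\<integral>\<^sup>+ u. ennreal (g (x - \<nu> + z + u *\<^sub>R ((L + 2) *\<^sub>R \<nu>))) \<partial>unit_seg) \<partial>lborel)"
proof -
  have [measurable]: "g \<in> borel_measurable borel" and per: "g (y + lattice_point k) = g y" for y k
    using g unfolding weight_def periodic_def by blast+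
  define v where "v = (L + 2) *\<^sub>R \<nu>"
  define B where "B = ball (0 :: real \<times> real) (2 * \<delta>)"
  have [measurable]: "B \<in> sets borel" by (simp add: B_def)
  have cover: "ennreal (2 * \<delta> / (L + 2)) \<le> (\<integral>\<^sup>+ u. indicator B (w + \<nu> - u *\<^sub>R v) \<partial>unit_seg)"
    if t: "0 \<le> t" "t \<le> L" "norm (w - t *\<^sub>R \<nu>) < \<delta>" for t w
  proof -
    \<comment> \<open>These are the axis parameters within \<open>\<delta>\<close> of the axis point
      at \<open>t\<close>. The extended axis starts one unit earlier, hence \<open>1 + t\<close>; as
      \<open>\<delta> \<le> 1\<close>, the extension at both ends keeps \<open>J\<close> inside the
      unit interval.\<close>
    define J where "J = {(1 + t - \<delta>) / (L + 2) .. (1 + t + \<delta>) / (L + 2)}"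
    have J: "J \<subseteq> {0..1}" using t L d by (auto simp: J_def field_simps)
    have le: "(1 + t - \<delta>) / (L + 2) \<le> (1 + t + \<delta>) / (L + 2)"
      using L d by (intro divide_right_mono) auto
    have "ennreal (2 * \<delta> / (L + 2)) = emeasure lborel J"
      unfolding J_def using le by (simp add: diff_divide_distrib[symmetric])
    also have "\<dots> = emeasure unit_seg J"
      using J by (subst emeasure_restrict_space) auto
    also have "\<dots> = (\<integral>\<^sup>+ u. indicator J u \<partial>unit_seg)"
      using J by (subst nn_integral_indicator) (auto simp: sets_restrict_space J_def)
    also have "\<dots> \<le> (\<integral>\<^sup>+ u. indicator B (w + \<nu> - u *\<^sub>R v) \<partial>unit_seg)"
    proof (intro nn_integral_mono)
      fix u
      have "w + \<nu> - u *\<^sub>R v \<in> B" if "u \<in> J"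
      proof -
        have u: "\<bar>(1 + t) - u * (L + 2)\<bar> \<le> \<delta>" using that L by (auto simp: J_def field_simps abs_le_iff)
        have "w + \<nu> - u *\<^sub>R v = (w - t *\<^sub>R \<nu>) + ((1 + t) - u * (L + 2)) *\<^sub>R \<nu>"
          by (simp add: v_def algebra_simps)
        also have "norm \<dots> \<le> norm (w - t *\<^sub>R \<nu>) + \<bar>(1 + t) - u * (L + 2)\<bar>"
          using norm_triangle_ineq[of "w - t *\<^sub>R \<nu>" "((1 + t) - u * (L + 2)) *\<^sub>R \<nu>"] nu by simp
        finally show ?thesis using t(3) u by (simp add: B_def)
      qed
      then show "indicator J u \<le> (indicator B (w + \<nu> - u *\<^sub>R v) :: ennreal)"
        by (auto simp: indicator_def)
    qed
    finally show ?thesis .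
  qed
  define W where "W y = (\<integral>\<^sup>+ u. indicator B (y - x + \<nu> - u *\<^sub>R v) \<partial>unit_seg)" for y
  have mB: "(\<lambda>p. indicator B (fst p - x + \<nu> - snd p *\<^sub>R v)) \<in> borel_measurable (borel \<Otimes>\<^sub>M borel)"
    by measurable
  have [measurable]: "W \<in> borel_measurable borel"
    unfolding W_def[abs_def] by (rule tonelli_plane_seg(1)[OF mB])
  \<comment> \<open>A point of the tube comes near the planar axis only after some lattice
    translation, and the sum over all translations contains the right one.\<close>
  have pw: "indicator (tube x \<nu> L \<delta>) y \<le> ennreal ((L + 2) / (2 * \<delta>)) * (\<integral>\<^sup>+ k. W (y + lattice_point k) \<partial>count_space UNIV)" for y
  proof (cases "y \<in> tube x \<nu> L \<delta>")
    case True
    then obtain k t where t: "0 \<le> t" "t \<le> L" "norm (y + lattice_point k - x - t *\<^sub>R \<nu>) < \<delta>"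
      using L by (auto simp: in_tube_iff)
    have "1 = ennreal ((L + 2) / (2 * \<delta>)) * ennreal (2 * \<delta> / (L + 2))"
      using L d by (simp add: ennreal_mult[symmetric])
    also have "\<dots> \<le> ennreal ((L + 2) / (2 * \<delta>)) * W (y + lattice_point k)"
      unfolding W_def using cover[OF t] by (intro mult_left_mono) auto
    also have "W (y + lattice_point k) \<le> (\<integral>\<^sup>+ k. W (y + lattice_point k) \<partial>count_space UNIV)"
      by (rule nn_integral_ge_point) simp
    finally show ?thesis using True by (simp add: mult_left_mono)
  qed simp
  have "(\<integral>\<^sup>+ y. ennreal (g y) * indicator (tube x \<nu> L \<delta>) y \<partial>torus)
      \<le> (\<integral>\<^sup>+ y. ennreal ((L + 2) / (2 * \<delta>)) * (\<integral>\<^sup>+ k. ennreal (g (y + lattice_point k)) * W (y + lattice_point k) \<partial>count_space UNIV) \<partial>torus)"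
  proof (rule nn_integral_mono)
    fix y
    have "ennreal (g y) * indicator (tube x \<nu> L \<delta>) y \<le> ennreal (g y) * (ennreal ((L + 2) / (2 * \<delta>)) * (\<integral>\<^sup>+ k. W (y + lattice_point k) \<partial>count_space UNIV))"
      by (intro mult_left_mono pw) simp
    also have "\<dots> = ennreal ((L + 2) / (2 * \<delta>)) * (\<integral>\<^sup>+ k. ennreal (g (y + lattice_point k)) * W (y + lattice_point k) \<partial>count_space UNIV)"
      by (simp add: per nn_integral_cmult mult.left_commute)
    finally show "ennreal (g y) * indicator (tube x \<nu> L \<delta>) y \<le> ennreal ((L + 2) / (2 * \<delta>)) * (\<integral>\<^sup>+ k. ennreal (g (y + lattice_point k)) * W (y + lattice_point k) \<partial>count_space UNIV)" .
  qed
  also have "\<dots> = (\<integral>\<^sup>+ y. (\<integral>\<^sup>+ k. ennreal ((L + 2) / (2 * \<delta>)) * (ennreal (g (y + lattice_point k)) * W (y + lattice_point k)) \<partial>count_space UNIV) \<partial>torus)"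
    by (simp add: nn_integral_cmult)
  also have "\<dots> = (\<integral>\<^sup>+ y. ennreal ((L + 2) / (2 * \<delta>)) * (ennreal (g y) * W y) \<partial>lborel)"
    by (subst nn_integral_periodize) auto
  also have "\<dots> = ennreal ((L + 2) / (2 * \<delta>)) * (\<integral>\<^sup>+ y. ennreal (g y) * W y \<partial>lborel)"
    by (rule nn_integral_cmult) measurable
  also have "(\<integral>\<^sup>+ y. ennreal (g y) * W y \<partial>lborel) = (\<integral>\<^sup>+ y. (\<integral>\<^sup>+ u. ennreal (g y) * indicator B (y - x + \<nu> - u *\<^sub>R v) \<partial>unit_seg) \<partial>lborel)"
    unfolding W_def by (intro nn_integral_cong nn_integral_cmult[symmetric] borel_measurable_unit_seg) measurable
  also have "\<dots> = (\<integral>\<^sup>+ u. (\<integral>\<^sup>+ y. ennreal (g y) * indicator B (y - x + \<nu> - u *\<^sub>R v) \<partial>lborel) \<partial>unit_seg)"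
    by (rule tonelli_plane_seg(2)) measurable
  also have "\<dots> = (\<integral>\<^sup>+ u. (\<integral>\<^sup>+ z. ennreal (g (x - \<nu> + z + u *\<^sub>R v)) * indicator B z \<partial>lborel) \<partial>unit_seg)"
  proof (rule nn_integral_cong)
    fix u
    have "(\<integral>\<^sup>+ y. ennreal (g y) * indicator B (y - x + \<nu> - u *\<^sub>R v) \<partial>lborel)
        = (\<integral>\<^sup>+ y. ennreal (g (x - \<nu> + u *\<^sub>R v + y)) * indicator B (x - \<nu> + u *\<^sub>R v + y - x + \<nu> - u *\<^sub>R v) \<partial>lborel)"
      by (rule nn_integral_lborel_translate[symmetric]) measurable
    then show "(\<integral>\<^sup>+ y. ennreal (g y) * indicator B (y - x + \<nu> - u *\<^sub>R v) \<partial>lborel)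
        = (\<integral>\<^sup>+ z. ennreal (g (x - \<nu> + z + u *\<^sub>R v)) * indicator B z \<partial>lborel)"
      by (simp add: add_ac)
  qed
  also have "\<dots> = (\<integral>\<^sup>+ z. (\<integral>\<^sup>+ u. ennreal (g (x - \<nu> + z + u *\<^sub>R v)) * indicator B z \<partial>unit_seg) \<partial>lborel)"
    by (rule tonelli_plane_seg(2)[symmetric]) measurable
  also have "\<dots> = (\<integral>\<^sup>+ z. indicator B z * (\<integral>\<^sup>+ u. ennreal (g (x - \<nu> + z + u *\<^sub>R v)) \<partial>unit_seg) \<partial>lborel)"
  proof (rule nn_integral_cong)
    fix z
    have "(\<integral>\<^sup>+ u. ennreal (g (x - \<nu> + z + u *\<^sub>R v)) * indicator B z \<partial>unit_seg)
      = (\<integral>\<^sup>+ u. ennreal (g (x - \<nu> + z + u *\<^sub>R v)) \<partial>unit_seg) * indicator B z"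
      by (intro nn_integral_multc borel_measurable_unit_seg) measurable
    then show "(\<integral>\<^sup>+ u. ennreal (g (x - \<nu> + z + u *\<^sub>R v)) * indicator B z \<partial>unit_seg)
      = indicator B z * (\<integral>\<^sup>+ u. ennreal (g (x - \<nu> + z + u *\<^sub>R v)) \<partial>unit_seg)"
      by (simp add: mult.commute)
  qed
  finally show ?thesis unfolding v_def B_def .
qed

lemma tube_measure_ge:
  assumes nu: "norm \<nu> = 1" and L: "0 < l" "l \<le> 1 / 4" "l \<le> L" and d: "0 < \<delta>" "\<delta> \<le> 1 / 4"
  shows "ennreal (l / (4 * \<delta>)) * emeasure lborel (ball (0 :: real \<times> real) \<delta>) \<le> emeasure torus (tube x \<nu> L \<delta>)"
proof -
  define v where "v = l *\<^sub>R \<nu>"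
  define B where "B = ball (0 :: real \<times> real) \<delta>"
  have [measurable]: "B \<in> sets borel" by (simp add: B_def)
  have L0: "0 \<le> L" using L by simp
  note tube_borel[OF L0, measurable]
  define W where "W y = (\<integral>\<^sup>+ u. indicator B (y - x - u *\<^sub>R v) \<partial>unit_seg)" for y
  have mB: "(\<lambda>p. indicator B (fst p - x - snd p *\<^sub>R v)) \<in> borel_measurable (borel \<Otimes>\<^sub>M borel)"
    by measurable
  have Wm[measurable]: "W \<in> borel_measurable borel"
    unfolding W_def[abs_def] by (rule tonelli_plane_seg(1)[OF mB])
  \<comment> \<open>Axis points whose balls both contain \<open>y\<close> are at most
    \<open>2 * \<delta>\<close> apart, which confines the parameter to an interval of length
    \<open>4 * \<delta> / l\<close> around any admissible one.\<close>
  have W_le: "W y \<le> ennreal (4 * \<delta> / l)" for y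
  proof (cases "\<exists>u\<in>{0..1}. y - x - u *\<^sub>R v \<in> B")
    case True
    then obtain u0 where u0: "u0 \<in> {0..1}" "y - x - u0 *\<^sub>R v \<in> B" by blast
    define J where "J = {u0 - 2 * \<delta> / l .. u0 + 2 * \<delta> / l}"
    have "W y \<le> (\<integral>\<^sup>+ u. indicator J u \<partial>unit_seg)"
      unfolding W_def
    proof (rule nn_integral_mono)
      fix u
      have "u \<in> J" if "y - x - u *\<^sub>R v \<in> B"
      proof -
        have "(y - x - u0 *\<^sub>R v) - (y - x - u *\<^sub>R v) = ((u - u0) * l) *\<^sub>R \<nu>"
          by (simp add: v_def algebra_simps)
        then have "\<bar>u - u0\<bar> * l = norm ((y - x - u0 *\<^sub>R v) - (y - x - u *\<^sub>R v))"
          using nu L by (simp add: abs_mult)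
        also have "\<dots> \<le> \<delta> + \<delta>"
          using that u0(2) norm_triangle_ineq4[of "y - x - u0 *\<^sub>R v" "y - x - u *\<^sub>R v"] by (simp add: B_def)
        finally have "\<bar>u - u0\<bar> \<le> 2 * \<delta> / l" using L by (simp add: field_simps)
        then show ?thesis by (auto simp: J_def abs_le_iff)
      qed
      then show "indicator B (y - x - u *\<^sub>R v) \<le> (indicator J u :: ennreal)"
        by (auto simp: indicator_def)
    qed
    also have "\<dots> = (\<integral>\<^sup>+ u. indicator J u * indicator {0..1} u \<partial>lborel)"
      by (subst nn_integral_restrict_space) auto
    also have "\<dots> \<le> (\<integral>\<^sup>+ u. indicator J u \<partial>lborel)"
      by (intro nn_integral_mono) (auto simp: indicator_def)
    also have "\<dots> = ennreal (4 * \<delta> / l)"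
      using L d by (simp add: J_def)
    finally show ?thesis .
  next
    case False
    have "W y = (\<integral>\<^sup>+ u. 0 \<partial>unit_seg)"
      unfolding W_def by (rule nn_integral_cong) (use False in \<open>auto simp: space_restrict_space\<close>)
    then show ?thesis by simp
  qed
  have W_nz: "\<exists>u\<in>{0..1}. norm (y - x - u *\<^sub>R v) < \<delta>" if "W y \<noteq> 0" for y
  proof (rule ccontr)
    assume c: "\<not> ?thesis"
    have "W y = (\<integral>\<^sup>+ u. 0 \<partial>unit_seg)"
      unfolding W_def by (rule nn_integral_cong) (use c in \<open>auto simp: space_restrict_space B_def\<close>)
    then show False using that by simp
  qed
  have pw: "(\<integral>\<^sup>+ k. W (y + lattice_point k) \<partial>count_space UNIV) \<le> ennreal (4 * \<delta> / l) * indicator (tube x \<nu> L \<delta>) y"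
    if y: "y \<in> square" for y
  proof (cases "\<exists>k. W (y + lattice_point k) \<noteq> 0")
    case True
    then obtain k where k: "W (y + lattice_point k) \<noteq> 0" by blast
    obtain u where u: "u \<in> {0..1}" "norm (y + lattice_point k - x - u *\<^sub>R v) < \<delta>" using W_nz[OF k] by blast
    have "y \<in> tube x \<nu> L \<delta>"
      unfolding in_tube_iff[OF L0]
    proof (intro conjI y exI)
      show "0 \<le> u * l" using u L by simp
      have "u * l \<le> 1 * l" using u L by (intro mult_right_mono) auto
      then show "u * l \<le> L" using L(3) by linarith
      show "norm (y + lattice_point k - x - (u * l) *\<^sub>R \<nu>) < \<delta>" using u by (simp add: v_def)
    qed
    \<comment> \<open>A long geodesic may return close to itself on the torus; the short piece of
      length \<open>l\<close> does not. Two different translates of \<open>y\<close> near it would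
      give a nonzero lattice vector of length at most \<open>3 / 4\<close>, which is why
      \<open>l\<close> and \<open>\<delta>\<close> are at most \<open>1 / 4\<close>.\<close>
    have only: "k' = k" if k': "W (y + lattice_point k') \<noteq> 0" for k'
    proof (rule ccontr)
      assume ne: "k' \<noteq> k"
      obtain u' where u': "u' \<in> {0..1}" "norm (y + lattice_point k' - x - u' *\<^sub>R v) < \<delta>" using W_nz[OF k'] by blast
      have "lattice_point (k' - k) = (y + lattice_point k' - x - u' *\<^sub>R v) - (y + lattice_point k - x - u *\<^sub>R v) + (u' - u) *\<^sub>R v"
        by (simp add: lattice_point_diff algebra_simps)
      also have "norm \<dots> \<le> \<delta> + \<delta> + \<bar>u' - u\<bar> * l"
        using u u' nu L norm_triangle_ineq4[of "y + lattice_point k' - x - u' *\<^sub>R v" "y + lattice_point k - x - u *\<^sub>R v"]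
        by (intro order_trans[OF norm_triangle_ineq] add_mono) (auto simp: v_def abs_mult)
      also have "\<dots> \<le> 1 / 4 + 1 / 4 + 1 * (1 / 4)"
        using d L u(1) u'(1) by (intro add_mono mult_mono) auto
      finally have "norm (lattice_point (k' - k)) < 1" by simp
      moreover have "1 \<le> norm (lattice_point (k' - k))"
        using ne by (intro norm_lattice_point_ge_1) simp
      ultimately show False by simp
    qed
    have "(\<integral>\<^sup>+ k'. W (y + lattice_point k') \<partial>count_space UNIV) = (\<integral>\<^sup>+ k'. W (y + lattice_point k) * indicator {k} k' \<partial>count_space UNIV)"
      by (intro nn_integral_cong) (use only in \<open>auto simp: indicator_def\<close>)
    also have "\<dots> = W (y + lattice_point k)"
      by (subst nn_integral_cmult_indicator) auto
    also have "\<dots> \<le> ennreal (4 * \<delta> / l)" by (rule W_le)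
    finally show ?thesis using \<open>y \<in> tube x \<nu> L \<delta>\<close> by simp
  next
    case False
    then have "(\<integral>\<^sup>+ k. W (y + lattice_point k) \<partial>count_space UNIV) = nn_integral (count_space UNIV) (\<lambda>k :: int \<times> int. 0)"
      by (intro nn_integral_cong) blast
    then show ?thesis by simp
  qed
  have "(\<integral>\<^sup>+ y. W y \<partial>lborel) = (\<integral>\<^sup>+ u. (\<integral>\<^sup>+ y. indicator B (y - x - u *\<^sub>R v) \<partial>lborel) \<partial>unit_seg)"
    unfolding W_def by (rule tonelli_plane_seg(2)) (rule mB)
  also have "\<dots> = (\<integral>\<^sup>+ u. emeasure lborel B \<partial>unit_seg)"
  proof (rule nn_integral_cong)
    fix u
    have "(\<integral>\<^sup>+ y. indicator B (y - x - u *\<^sub>R v) \<partial>lborel) = (\<integral>\<^sup>+ y. indicator B (x + u *\<^sub>R v + y - x - u *\<^sub>R v) \<partial>lborel)"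
      by (rule nn_integral_lborel_translate[symmetric]) measurable
    then show "(\<integral>\<^sup>+ y. indicator B (y - x - u *\<^sub>R v) \<partial>lborel) = emeasure lborel B" by simp
  qed
  also have "\<dots> = emeasure lborel B"
    using emeasure_unit_seg_space by simp
  finally have "emeasure lborel B = (\<integral>\<^sup>+ y. (\<integral>\<^sup>+ k. W (y + lattice_point k) \<partial>count_space UNIV) \<partial>torus)"
    by (simp add: nn_integral_periodize)
  also have "\<dots> \<le> (\<integral>\<^sup>+ y. ennreal (4 * \<delta> / l) * indicator (tube x \<nu> L \<delta>) y \<partial>torus)"
    by (intro nn_integral_mono pw) (simp add: space_torus)
  also have "\<dots> = ennreal (4 * \<delta> / l) * emeasure torus (tube x \<nu> L \<delta>)"
    by (intro nn_integral_cmult_indicator sets_torus_borel tube_borel L0) (auto simp: tube_def space_torus)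
  finally have "ennreal (l / (4 * \<delta>)) * emeasure lborel B \<le> ennreal (l / (4 * \<delta>)) * (ennreal (4 * \<delta> / l) * emeasure torus (tube x \<nu> L \<delta>))"
    by (rule mult_left_mono) simp
  also have "\<dots> = emeasure torus (tube x \<nu> L \<delta>)"
  proof -
    have "ennreal (l / (4 * \<delta>)) * ennreal (4 * \<delta> / l) = 1"
      using L d by (simp add: ennreal_mult[symmetric])
    then show ?thesis by (simp flip: mult.assoc)
  qed
  finally show ?thesis by (simp add: B_def)
qed

lemma ae_torus_from_lborel:
  assumes "AE x in lborel. x \<in> square \<longrightarrow> P x"
  shows "AE x in torus. P x"
  unfolding torus_def using square_lebesgue AE_completion[OF assms]
  by (subst AE_restrict_space_iff) auto

text \<open>A substitute for Lebesgue differentiation: integrate the hypothesis over a compact subset \<open>K\<close> of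
  \<open>{A < c / 2}\<close>, move the translation from \<open>A\<close> to \<open>K\<close>, and shrink the resulting neighbourhoods to \<open>K\<close>.\<close>

lemma ball_averages_imp_AE:
  fixes A :: "real \<times> real \<Rightarrow> ennreal"
  assumes [measurable]: "A \<in> borel_measurable borel" and AM: "\<And>x. A x \<le> ennreal M"
    and c: "0 < c" and d0: "0 < \<delta>\<^sub>0"
    and avg: "\<And>x \<delta>. 0 < \<delta> \<Longrightarrow> \<delta> < \<delta>\<^sub>0 \<Longrightarrow>
      ennreal c * emeasure lborel (ball (0 :: real \<times> real) \<delta>) \<le> (\<integral>\<^sup>+ z. indicator (ball 0 \<delta>) z * A (x + z) \<partial>lborel)"
  shows "AE x in torus. ennreal (c / 2) \<le> A x"
proof (rule ae_torus_from_lborel, rule ccontr)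
  define E where "E = {x \<in> square. A x < ennreal (c / 2)}"
  have E[measurable]: "E \<in> sets borel"
  proof -
    have "E = square \<inter> {x \<in> space borel. A x < ennreal (c / 2)}" by (auto simp: E_def)
    then show ?thesis by (simp only:) (intro sets.Int square_borel, measurable)
  qed
  have Esq: "E \<subseteq> cbox (0, 0) (1, 1)" by (auto simp: E_def cbox_Pair_eq)
  have bE: "bounded E" using bounded_subset[OF bounded_cbox Esq] .
  have finE: "emeasure lborel E < \<infinity>" using emeasure_bounded_finite[OF bE] .
  assume nAE: "\<not> (AE x in lborel. x \<in> square \<longrightarrow> ennreal (c / 2) \<le> A x)"
  have Eeq: "{x \<in> space lborel. \<not> (x \<in> square \<longrightarrow> ennreal (c / 2) \<le> A x)} = E"
    by (auto simp: E_def not_le)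
  have E0: "emeasure lborel E \<noteq> 0"
  proof
    assume "emeasure lborel E = 0"
    then have "E \<in> null_sets lborel" by (simp add: null_sets_def)
    then show False using nAE AE_I'[of E lborel, OF _ eq_refl[OF Eeq]] by blast
  qed
  define e where "e = measure lborel E"
  have e1: "emeasure lborel E = ennreal e"
    unfolding e_def by (rule emeasure_eq_ennreal_measure) (use finE in simp)
  have e2: "0 < e"
  proof (rule ccontr)
    assume "\<not> 0 < e"
    then show False using E0 e1 by (simp add: ennreal_eq_0_iff)
  qed
  note e = e1 e2
  \<comment> \<open>Inner regularity with an error below the whole measure of \<open>E\<close>
    leaves a set \<open>K\<close> of positive measure.\<close>
  obtain K where K: "closed K" "K \<subseteq> E" "emeasure lebesgue (E - K) < ennreal e"
  proof -
    have "E \<in> sets lebesgue" using E by (simp add: sets_completionI_sets)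
    then show ?thesis using sets_lebesgue_inner_closed[OF _ e2] that by metis
  qed
  have [measurable]: "K \<in> sets borel" using K(1) by auto
  have cK: "compact K" using K bE bounded_subset compact_eq_bounded_closed by blast
  have K0: "emeasure lborel K \<noteq> 0"
  proof
    assume "emeasure lborel K = 0"
    moreover have "emeasure lborel E = emeasure lborel K + emeasure lborel (E - K)"
      using K(2) by (subst plus_emeasure) (auto intro!: arg_cong2[where f=emeasure])
    ultimately show False using K(3) e(1) by simp
  qed
  then have Kne: "K \<noteq> {}" by auto
  have finK: "emeasure lborel K < \<infinity>" using emeasure_bounded_finite[OF bounded_subset[OF bE K(2)]] .
  define Kn where "Kn n = {x. infdist x K \<le> 1 / real (Suc n)}" for n
  have Kn_closed: "closed (Kn n)" for n
    unfolding Kn_def by (intro closed_Collect_le continuous_intros)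
  have [measurable]: "Kn n \<in> sets borel" for n
    using Kn_closed[of n] by auto
  have Kn_dec: "decseq Kn"
  proof (rule decseq_SucI)
    fix n
    have "1 / real (Suc (Suc n)) \<le> 1 / real (Suc n)" by (intro divide_left_mono) auto
    then show "Kn (Suc n) \<subseteq> Kn n" unfolding Kn_def by auto
  qed
  have Kn_Int: "(\<Inter>n. Kn n) = K"
  proof
    show "(\<Inter>n. Kn n) \<subseteq> K"
    proof
      fix x assume x: "x \<in> (\<Inter>n. Kn n)"
      have "infdist x K \<le> 0"
      proof (rule field_le_epsilon)
        fix r :: real assume "0 < r"
        then obtain n where "inverse (real (Suc n)) < r" using reals_Archimedean by blast
        then have "1 / real (Suc n) < r" by (simp only: inverse_eq_divide)
        moreover have "infdist x K \<le> 1 / real (Suc n)" using x unfolding Kn_def by blast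
        ultimately show "infdist x K \<le> 0 + r" by linarith
      qed
      then have "infdist x K = 0" using infdist_nonneg[of x K] by linarith
      then show "x \<in> K" using in_closed_iff_infdist_zero[OF K(1) Kne] by simp
    qed
    show "K \<subseteq> (\<Inter>n. Kn n)" by (auto simp: Kn_def)
  qed
  have Kn_bdd: "bounded (Kn n)" for n
  proof -
    obtain r where r: "\<And>x. x \<in> K \<Longrightarrow> norm x \<le> r" using compact_imp_bounded[OF cK] by (auto simp: bounded_iff)
    have "norm x \<le> r + 1" if "x \<in> Kn n" for x
    proof -
      obtain y where y: "y \<in> K" "infdist x K = dist x y" using infdist_attains_inf[OF K(1) Kne] by blast
      have "1 / real (Suc n) \<le> 1" by simp
      moreover have "infdist x K \<le> 1 / real (Suc n)" using that unfolding Kn_def by blast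
      ultimately have "dist x y \<le> 1" using y(2) by linarith
      then show ?thesis using r[OF y(1)] norm_triangle_ineq2[of x y] by (simp add: dist_norm)
    qed
    then show ?thesis unfolding bounded_iff by blast
  qed
  \<comment> \<open>With \<open>A\<close> as a density, shrinking the neighbourhoods becomes
    continuity from above; it applies because \<open>A\<close> and the sets \<open>Kn n\<close> are
    bounded.\<close>
  define N where "N = density lborel A"
  have N_em: "emeasure N S = (\<integral>\<^sup>+ x. A x * indicator S x \<partial>lborel)" if "S \<in> sets borel" for S
    unfolding N_def using that by (subst emeasure_density) auto
  have N_le: "emeasure N S \<le> m * emeasure lborel S" if "S \<in> sets borel" "\<And>x. x \<in> S \<Longrightarrow> A x \<le> m" for S m
  proof -
    have "emeasure N S \<le> (\<integral>\<^sup>+ x. m * indicator S x \<partial>lborel)"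
      unfolding N_em[OF that(1)] by (intro nn_integral_mono) (use that(2) in \<open>auto simp: indicator_def\<close>)
    also have "\<dots> = m * emeasure lborel S" using that(1) by (intro nn_integral_cmult_indicator) simp
    finally show ?thesis .
  qed
  have lim: "(\<lambda>n. emeasure N (Kn n)) \<longlonglongrightarrow> emeasure N K"
    unfolding Kn_Int[symmetric]
  proof (rule Lim_emeasure_decseq[OF _ Kn_dec])
    show "range Kn \<subseteq> sets N" by (auto simp: N_def)
    fix n
    have "emeasure N (Kn n) \<le> ennreal M * emeasure lborel (Kn n)" using AM by (intro N_le) auto
    also have "\<dots> < \<infinity>" using emeasure_bounded_finite[OF Kn_bdd[of n]] by (simp add: ennreal_mult_less_top)
    finally show "emeasure N (Kn n) \<noteq> \<infinity>" by simp
  qed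
  have step: "ennreal c * emeasure lborel K \<le> emeasure N (Kn n)" if n: "1 / real (Suc n) < \<delta>\<^sub>0" for n
  proof -
    define d where "d = 1 / real (Suc n)"
    define B where "B = ball (0 :: real \<times> real) d"
    have [measurable]: "B \<in> sets borel" by (simp add: B_def)
    have d: "0 < d" "d < \<delta>\<^sub>0" using n by (auto simp: d_def)
    have B_em: "emeasure lborel B \<noteq> 0" "emeasure lborel B < \<infinity>"
    proof -
      have "0 < unit_ball_vol 2" by (rule unit_ball_vol_pos) simp
      then have "0 < unit_ball_vol 2 * d\<^sup>2" using d(1) by simp
      moreover have "emeasure lborel B = ennreal (unit_ball_vol 2 * d\<^sup>2)"
        using d(1) by (simp add: B_def emeasure_ball power2_eq_square)
      ultimately show "emeasure lborel B \<noteq> 0" "emeasure lborel B < \<infinity>"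
        by (simp_all only: ennreal_eq_0_iff not_le ennreal_less_top infinity_ennreal_def)
    qed
    have "emeasure lborel B * (ennreal c * emeasure lborel K) = (\<integral>\<^sup>+ x. ennreal c * emeasure lborel B * indicator K x \<partial>lborel)"
      by (subst nn_integral_cmult_indicator) (auto simp: mult_ac)
    also have "\<dots> \<le> (\<integral>\<^sup>+ x. (\<integral>\<^sup>+ z. indicator B z * A (x + z) \<partial>lborel) * indicator K x \<partial>lborel)"
      unfolding B_def by (intro nn_integral_mono mult_right_mono avg d) auto
    also have "\<dots> = (\<integral>\<^sup>+ x. (\<integral>\<^sup>+ z. indicator B z * A (x + z) * indicator K x \<partial>lborel) \<partial>lborel)"
      by (intro nn_integral_cong nn_integral_multc[symmetric]) measurable
    \<comment> \<open>For fixed \<open>z\<close> in the ball, the translate \<open>z + K\<close>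
      stays inside \<open>Kn n\<close>, so the inner integral is bounded independently of
      \<open>z\<close>.\<close>
    also have "\<dots> = (\<integral>\<^sup>+ z. (\<integral>\<^sup>+ x. indicator B z * A (x + z) * indicator K x \<partial>lborel) \<partial>lborel)"
      by (rule lborel_pair.Fubini') measurable
    also have "\<dots> \<le> (\<integral>\<^sup>+ z. emeasure N (Kn n) * indicator B z \<partial>lborel)"
    proof (rule nn_integral_mono)
      fix z
      have "(\<integral>\<^sup>+ x. indicator B z * A (x + z) * indicator K x \<partial>lborel) \<le> (\<integral>\<^sup>+ x. indicator B z * (A (z + x) * indicator (Kn n) (z + x)) \<partial>lborel)"
      proof (rule nn_integral_mono)
        fix x
        have "z + x \<in> Kn n" if "z \<in> B" "x \<in> K"
        proof -
          have "infdist (z + x) K \<le> dist (z + x) x" by (rule infdist_le[OF that(2)])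
          also have "\<dots> \<le> 1 / real (Suc n)" using that(1) by (simp add: B_def d_def dist_norm)
          finally show ?thesis by (simp add: Kn_def)
        qed
        then show "indicator B z * A (x + z) * indicator K x \<le> indicator B z * (A (z + x) * indicator (Kn n) (z + x))"
          by (auto simp: indicator_def add.commute)
      qed
      also have "\<dots> = indicator B z * (\<integral>\<^sup>+ x. A (z + x) * indicator (Kn n) (z + x) \<partial>lborel)"
        by (rule nn_integral_cmult) measurable
      also have "(\<integral>\<^sup>+ x. A (z + x) * indicator (Kn n) (z + x) \<partial>lborel) = emeasure N (Kn n)"
        unfolding N_em[OF \<open>Kn n \<in> sets borel\<close>] by (rule nn_integral_lborel_translate[where F="\<lambda>x. A x * indicator (Kn n) x"]) measurable
      finally show "(\<integral>\<^sup>+ x. indicator B z * A (x + z) * indicator K x \<partial>lborel) \<le> emeasure N (Kn n) * indicator B z"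
        by (simp add: mult.commute)
    qed
    also have "\<dots> = emeasure lborel B * emeasure N (Kn n)"
      by (subst nn_integral_cmult_indicator) (auto simp: mult.commute)
    finally show ?thesis
      using B_em by (simp add: ennreal_mult_le_mult_iff)
  qed
  have "ennreal c * emeasure lborel K \<le> emeasure N K"
  proof (rule LIMSEQ_le_const[OF lim])
    obtain n0 where "inverse (real (Suc n0)) < \<delta>\<^sub>0" using reals_Archimedean[OF d0] by blast
    then have n0: "1 / real (Suc n0) < \<delta>\<^sub>0" by (simp add: inverse_eq_divide)
    show "\<exists>n0. \<forall>n\<ge>n0. ennreal c * emeasure lborel K \<le> emeasure N (Kn n)"
    proof (intro exI[of _ n0] allI impI step)
      fix n assume "n0 \<le> n"
      then have "1 / real (Suc n) \<le> 1 / real (Suc n0)" by (intro divide_left_mono) auto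
      then show "1 / real (Suc n) < \<delta>\<^sub>0" using n0 by linarith
    qed
  qed
  also have "emeasure N K \<le> ennreal (c / 2) * emeasure lborel K"
    using K(2) by (intro N_le) (auto simp: E_def intro: less_imp_le)
  finally have "ennreal c \<le> ennreal (c / 2)"
    using K0 finK by (simp add: mult.commute[of _ "emeasure lborel K"] ennreal_mult_le_mult_iff)
  then show False using c by (simp add: ennreal_le_iff)
qed

text \<open>The tube averages bound tube integrals below by the area of the tube, which is at least
  of order \<delta>, and passing to balls loses a factor of order \<open>1 / \<delta>\<close>. The
  two cancel and leave lower bounds for the ball averages of the segment integral, uniformly as the
  balls shrink.\<close>

lemma generalized_GCC_line_bound:
  assumes gcc: "generalized_GCC \<gamma>" and g: "weight M g" and \<gamma>[measurable]: "\<gamma> \<in> borel_measurable torus"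
    and ae: "AE x in torus. \<gamma> x = g x"
  shows "\<exists>c>0. \<exists>len>0. \<forall>\<nu>. norm \<nu> = 1 \<longrightarrow> line_bound c (len *\<^sub>R \<nu>) g"
proof -
  have [measurable]: "g \<in> borel_measurable borel" and g0: "\<And>x. 0 \<le> g x" and gM: "\<And>x. g x \<le> M"
    using g by (auto simp: weight_def)
  obtain L c0 where L: "0 < L" and c0: "0 < c0" and
    lim: "ereal c0 \<le> Liminf (at_right 0) (\<lambda>\<delta>. INF x. INF \<nu>\<in>sphere 0 1.
       ereal (1 / measure torus (tube x \<nu> L \<delta>) * (LINT y:tube x \<nu> L \<delta>|torus. \<gamma> y)))"
    using gcc unfolding generalized_GCC_def by blast
  have "ereal (c0 / 2) < ereal c0" using c0 by simp
  also note lim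
  finally have "\<forall>\<^sub>F \<delta> in at_right 0. ereal (c0 / 2) < (INF x. INF \<nu>\<in>sphere 0 1.
       ereal (1 / measure torus (tube x \<nu> L \<delta>) * (LINT y:tube x \<nu> L \<delta>|torus. \<gamma> y)))"
    by (rule less_LiminfD)
  then obtain b where b: "0 < b" and bb: "\<And>\<delta>. 0 < \<delta> \<Longrightarrow> \<delta> < b \<Longrightarrow> ereal (c0 / 2) < (INF x. INF \<nu>\<in>sphere 0 1.
       ereal (1 / measure torus (tube x \<nu> L \<delta>) * (LINT y:tube x \<nu> L \<delta>|torus. \<gamma> y)))"
    by (auto simp: eventually_at_right_field)
  define l where "l = min L (1 / 4)"
  have l: "0 < l" "l \<le> 1 / 4" "l \<le> L" using L by (auto simp: l_def)
  \<comment> \<open>The two tube comparisons and the level \<open>c0 / 2\<close> multiply to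
    \<open>c0 * l / (4 * (L + 2))\<close>; the further 4 is the ratio of the areas of the balls of
    radii \<open>2 * \<delta>\<close> and \<open>\<delta>\<close>.\<close>
  define c where "c = c0 * l / (16 * (L + 2))"
  have c: "0 < c" using c0 l L by (simp add: c_def)
  \<comment> \<open>The balls have twice the radius of the tube, and the latter has to stay below
    \<open>b\<close> and \<open>1 / 4\<close>.\<close>
  define \<delta>1 where "\<delta>1 = 2 * min b (1 / 4)"
  have d1: "0 < \<delta>1" using b by (simp add: \<delta>1_def)
  have "line_bound (c / 2) ((L + 2) *\<^sub>R \<nu>) g" if nu: "norm \<nu> = 1" for \<nu>
  proof -
    define v where "v = (L + 2) *\<^sub>R \<nu>"
    define A where "A x = (\<integral>\<^sup>+ u. ennreal (g (x + u *\<^sub>R v)) \<partial>unit_seg)" for x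
    have Am: "A \<in> borel_measurable borel"
      unfolding A_def[abs_def] by (rule tonelli_plane_seg(1)) measurable
    have A_real: "A x = ennreal (LINT u|unit_seg. g (x + u *\<^sub>R v))" for x
      unfolding A_def
    proof (rule nn_integral_eq_integral)
      show "integrable unit_seg (\<lambda>u. g (x + u *\<^sub>R v))"
        by (rule integrable_unit_seg_bounded[where B=M]) (use g0 gM in \<open>auto intro!: borel_measurable_unit_seg\<close>)
    qed (simp add: g0)
    have A_le: "A x \<le> ennreal M" for x
    proof -
      have "A x \<le> (\<integral>\<^sup>+ u. ennreal M \<partial>unit_seg)"
        unfolding A_def by (intro nn_integral_mono ennreal_leI gM)
      then show ?thesis using emeasure_unit_seg_space by simp
    qed
    have "AE x in torus. ennreal (c / 2) \<le> A x"
    proof (rule ball_averages_imp_AE[OF Am A_le c d1])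
      fix x \<delta>' assume d': "0 < \<delta>'" "\<delta>' < \<delta>1"
      define \<delta> where "\<delta> = \<delta>' / 2"
      have d: "0 < \<delta>" "\<delta> < b" "\<delta> \<le> 1 / 4" using d' by (auto simp: \<delta>_def \<delta>1_def)
      \<comment> \<open>A tube started at \<open>x + \<nu>\<close> has its extended axis starting at
        \<open>x\<close>.\<close>
      define T where "T = tube (x + \<nu>) \<nu> L \<delta>"
      have Tb[measurable]: "T \<in> sets borel" unfolding T_def using L by (intro tube_borel) simp
      have Tt[measurable]: "T \<in> sets torus"
        using Tb by (rule sets_torus_borel) (auto simp: T_def tube_def space_torus)
      have finT: "emeasure torus T \<noteq> \<infinity>"
        using finite_measure.emeasure_finite[OF finite_measure_torus] by simp
      define I where "I = (\<integral>\<^sup>+ z. indicator (ball 0 \<delta>') z * A (x + z) \<partial>lborel)"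
      define \<beta> where "\<beta> = emeasure lborel (ball (0 :: real \<times> real) \<delta>)"
      have beta: "emeasure lborel (ball (0 :: real \<times> real) \<delta>') = ennreal 4 * \<beta>"
        using d' by (simp add: \<beta>_def emeasure_ball \<delta>_def ennreal_mult[symmetric] power_divide del: ennreal_numeral)
      have "ereal (c0 / 2) < ereal (1 / measure torus T * (LINT y:T|torus. \<gamma> y))"
        using less_INF_D[OF less_INF_D[OF bb[OF d(1,2)], of "x + \<nu>"], of \<nu>] nu by (simp add: T_def)
      then have lt: "c0 / 2 < 1 / measure torus T * (LINT y:T|torus. \<gamma> y)" by simp
      \<comment> \<open>For a null tube the quotient \<open>1 / 0\<close> is 0 by convention, and
        \<open>lt\<close> would fail.\<close>
      have "measure torus T \<noteq> 0" using lt c0 by (cases "measure torus T = 0") auto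
      then have mT: "0 < measure torus T" using measure_nonneg[of torus T] by linarith
      have eqg: "(LINT y:T|torus. \<gamma> y) = (LINT y|torus. g y * indicator T y)"
        unfolding set_lebesgue_integral_def
      proof (rule integral_cong_AE)
        show "AE y in torus. indicat_real T y *\<^sub>R \<gamma> y = g y * indicator T y"
          using ae by eventually_elim simp
        show "(\<lambda>y. g y * indicator T y) \<in> borel_measurable torus"
          by (rule borel_measurable_torus) measurable
      qed measurable
      have "c0 / 2 * measure torus T \<le> (LINT y|torus. g y * indicator T y)"
        using lt mT by (simp add: eqg field_simps)
      then have "ennreal (c0 / 2) * emeasure torus T \<le> ennreal (LINT y|torus. g y * indicator T y)"
        using c0 finT by (simp add: emeasure_eq_ennreal_measure ennreal_mult[symmetric] ennreal_leI)
      also have "\<dots> = (\<integral>\<^sup>+ y. ennreal (g y * indicator T y) \<partial>torus)"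
      proof (rule nn_integral_eq_integral[symmetric])
        show "integrable torus (\<lambda>y. g y * indicator T y)"
        proof (rule integrable_torus_bounded[where B=M])
          show "(\<lambda>y. g y * indicator T y) \<in> borel_measurable torus"
            by (rule borel_measurable_torus) measurable
          show "norm (g y * indicator T y) \<le> M" for y
            using g0[of y] gM[of y] by (auto simp: indicator_def)
        qed
      qed (simp add: g0)
      also have "\<dots> = (\<integral>\<^sup>+ y. ennreal (g y) * indicator T y \<partial>torus)"
        by (intro nn_integral_cong) (auto simp: indicator_def)
      also have "\<dots> \<le> ennreal ((L + 2) / (2 * \<delta>)) * I"
        using tube_integral_le[OF g nu L d(1), of "x + \<nu>"] d(3)
        unfolding T_def I_def A_def v_def by (simp add: \<delta>_def)
      finally have up: "ennreal (c0 / 2) * emeasure torus T \<le> ennreal ((L + 2) / (2 * \<delta>)) * I" .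
      have lo: "ennreal (l / (4 * \<delta>)) * \<beta> \<le> emeasure torus T"
        unfolding T_def \<beta>_def by (rule tube_measure_ge[OF nu l d(1,3)])
      have "ennreal c * (ennreal 4 * \<beta>) = ennreal (2 * \<delta> / (L + 2)) * (ennreal (c0 / 2) * (ennreal (l / (4 * \<delta>)) * \<beta>))"
      proof -
        have "c * 4 = 2 * \<delta> / (L + 2) * (c0 / 2 * (l / (4 * \<delta>)))"
          using d(1) L by (simp add: c_def field_simps)
        then show ?thesis
          using c d(1) L l c0 by (simp add: ennreal_mult[symmetric] mult.assoc[symmetric] del: ennreal_numeral)
      qed
      also have "\<dots> \<le> ennreal (2 * \<delta> / (L + 2)) * (ennreal (c0 / 2) * emeasure torus T)"
        by (intro mult_left_mono lo) auto
      also have "\<dots> \<le> ennreal (2 * \<delta> / (L + 2)) * (ennreal ((L + 2) / (2 * \<delta>)) * I)"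
        by (intro mult_left_mono up) auto
      also have "\<dots> = I"
        using d(1) L by (simp add: ennreal_mult[symmetric] mult.assoc[symmetric])
      finally show "ennreal c * emeasure lborel (ball (0 :: real \<times> real) \<delta>') \<le> (\<integral>\<^sup>+ z. indicator (ball 0 \<delta>') z * A (x + z) \<partial>lborel)"
        by (simp only: beta I_def)
    qed
    then show ?thesis
      unfolding line_bound_def v_def[symmetric]
    proof eventually_elim
      fix x assume "ennreal (c / 2) \<le> A x"
      then show "c / 2 \<le> (LINT u|unit_seg. g (x + u *\<^sub>R v))"
        unfolding A_real using g0 by (subst (asm) ennreal_le_iff) (auto intro!: integral_nonneg_AE)
    qed
  qed
  then show ?thesis
    using c L by (intro exI[of _ "c / 2"] conjI exI[of _ "L + 2"]) auto
qed

section \<open>Sectors of the annulus\<close>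

text \<open>Allowing a sign confines the angle to a half circle, so that antipodal points can be
  given the same angle.\<close>

lemma polar_mod_pi:
  fixes x :: "real \<times> real"
  shows "\<exists>\<psi> \<sigma>. 0 \<le> \<psi> \<and> \<psi> < pi \<and> \<bar>\<sigma>\<bar> = 1 \<and> x = (\<sigma> * norm x * cos \<psi>, \<sigma> * norm x * sin \<psi>)"
proof -
  obtain a b where x: "x = (a, b)" by (cases x)
  define z where "z = Complex a b"
  define r where "r = cmod z"
  have n: "norm x = r" by (simp add: r_def z_def x cmod_def norm_Pair)
  have "Re (rcis (cmod z) (Arg z)) = a" "Im (rcis (cmod z) (Arg z)) = b"
    by (simp_all only: rcis_cmod_Arg) (simp_all add: z_def)
  then have ab: "r * cos (Arg z) = a" "r * sin (Arg z) = b"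
    unfolding r_def by (simp_all only: Re_rcis Im_rcis)
  have A: "- pi < Arg z" "Arg z \<le> pi" using Arg_bounded[of z] by auto
  consider "0 \<le> Arg z" "Arg z < pi" | "Arg z = pi" | "Arg z < 0" using A by linarith
  then have "\<exists>\<psi> \<sigma>. 0 \<le> \<psi> \<and> \<psi> < pi \<and> \<bar>\<sigma>\<bar> = 1 \<and> r * cos (Arg z) = \<sigma> * r * cos \<psi> \<and> r * sin (Arg z) = \<sigma> * r * sin \<psi>"
  proof cases
    case 1
    then show ?thesis by (intro exI[of _ "Arg z"] exI[of _ 1]) simp
  next
    case 2
    then show ?thesis by (intro exI[of _ 0] exI[of _ "-1"]) simp
  next
    case 3
    then show ?thesis using A by (intro exI[of _ "Arg z + pi"] exI[of _ "-1"]) simp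
  qed
  then show ?thesis unfolding n unfolding x prod.inject ab .
qed

lemma inner_polar:
  fixes x y :: "real \<times> real"
  assumes "x = (\<sigma> * r * cos \<psi>, \<sigma> * r * sin \<psi>)" "y = (\<sigma>' * r' * cos \<psi>', \<sigma>' * r' * sin \<psi>')"
  shows "x \<bullet> y = \<sigma> * \<sigma>' * r * r' * cos (\<psi> - \<psi>')"
  by (simp add: assms cos_diff algebra_simps)

lemma norm_diff_sign_sq:
  fixes x y :: "'a::real_inner"
  assumes "\<tau>\<^sup>2 = 1"
  shows "(norm (x - \<tau> *\<^sub>R y))\<^sup>2 = (norm x)\<^sup>2 + (norm y)\<^sup>2 - 2 * \<tau> * (x \<bullet> y)"
proof -
  have "(norm (x - \<tau> *\<^sub>R y))\<^sup>2 = x \<bullet> x + \<tau>\<^sup>2 * (y \<bullet> y) - 2 * \<tau> * (x \<bullet> y)"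
    unfolding power2_norm_eq_inner
    by (simp add: inner_diff_left inner_diff_right inner_commute[of y x] power2_eq_square algebra_simps)
  then show ?thesis by (simp add: assms power2_norm_eq_inner)
qed

text \<open>The left side is the distance from \<open>x\<close> to the line through the origin at
  angle \<open>\<psi>'\<close>, which contains both \<open>y\<close> and \<open>- y\<close>. The
  proof completes the square in \<open>norm y\<close>.\<close>

lemma polar_separated:
  fixes x y :: "real \<times> real"
  assumes x: "x = (\<sigma> * norm x * cos \<psi>, \<sigma> * norm x * sin \<psi>)" "\<bar>\<sigma>\<bar> = 1"
    and y: "y = (\<sigma>' * norm y * cos \<psi>', \<sigma>' * norm y * sin \<psi>')" "\<bar>\<sigma>'\<bar> = 1" and \<tau>: "\<bar>\<tau>\<bar> = 1"
  shows "norm x * \<bar>sin (\<psi> - \<psi>')\<bar> \<le> norm (x - \<tau> *\<^sub>R y)"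
proof -
  define e where "e = \<tau> * \<sigma> * \<sigma>'"
  have "\<bar>e\<bar> = 1" using x(2) y(2) \<tau> by (simp add: e_def abs_mult)
  then have "e\<^sup>2 = 1" by (metis one_power2 power2_abs)
  have t2: "\<tau>\<^sup>2 = 1" using \<tau> by (metis one_power2 power2_abs)
  have "(norm (x - \<tau> *\<^sub>R y))\<^sup>2 = (norm x)\<^sup>2 + (norm y)\<^sup>2 - 2 * \<tau> * (x \<bullet> y)"
    using t2 by (rule norm_diff_sign_sq)
  also have "\<dots> = (norm x)\<^sup>2 + (norm y)\<^sup>2 - 2 * norm y * (e * norm x * cos (\<psi> - \<psi>'))"
    by (subst inner_polar[OF x(1) y(1)]) (simp add: e_def)
  also have "\<dots> = (norm y - e * norm x * cos (\<psi> - \<psi>'))\<^sup>2 + (norm x)\<^sup>2 * (1 - (cos (\<psi> - \<psi>'))\<^sup>2)"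
    using \<open>e\<^sup>2 = 1\<close> by (simp add: power2_diff power_mult_distrib algebra_simps)
  also have "\<dots> \<ge> (norm x)\<^sup>2 * (1 - (cos (\<psi> - \<psi>'))\<^sup>2)" by simp
  also have "1 - (cos (\<psi> - \<psi>'))\<^sup>2 = (sin (\<psi> - \<psi>'))\<^sup>2" by (simp add: sin_squared_eq)
  finally have "(norm x * \<bar>sin (\<psi> - \<psi>')\<bar>)\<^sup>2 \<le> (norm (x - \<tau> *\<^sub>R y))\<^sup>2" by (simp add: power_mult_distrib)
  then show ?thesis by (rule power2_le_imp_le) simp
qed

text \<open>Law of cosines with the sign that makes the inner product nonnegative; then
  \<open>1 - |cos|\<close> remains, which is at most the squared sine.\<close>

lemma polar_close:
  fixes x y :: "real \<times> real"
  assumes x: "x = (\<sigma> * norm x * cos \<psi>, \<sigma> * norm x * sin \<psi>)" "\<bar>\<sigma>\<bar> = 1"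
    and y: "y = (\<sigma>' * norm y * cos \<psi>', \<sigma>' * norm y * sin \<psi>')" "\<bar>\<sigma>'\<bar> = 1"
  shows "\<exists>\<tau>\<in>{1, -1}. (norm (x - \<tau> *\<^sub>R y))\<^sup>2 \<le> (norm x - norm y)\<^sup>2 + 2 * norm x * norm y * (sin (\<psi> - \<psi>'))\<^sup>2"
proof -
  define C where "C = \<sigma> * \<sigma>' * cos (\<psi> - \<psi>')"
  define \<tau> :: real where "\<tau> = (if 0 \<le> C then 1 else -1)"
  have t: "\<tau> * C = \<bar>C\<bar>" "\<tau>\<^sup>2 = 1" by (auto simp: \<tau>_def)
  have C: "\<bar>C\<bar> = \<bar>cos (\<psi> - \<psi>')\<bar>" using x(2) y(2) by (simp add: C_def abs_mult)
  have "(norm (x - \<tau> *\<^sub>R y))\<^sup>2 = (norm x)\<^sup>2 + (norm y)\<^sup>2 - 2 * \<tau> * (x \<bullet> y)"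
    using t(2) by (rule norm_diff_sign_sq)
  also have "\<dots> = (norm x)\<^sup>2 + (norm y)\<^sup>2 - 2 * norm x * norm y * (\<tau> * C)"
    by (subst inner_polar[OF x(1) y(1)]) (simp add: C_def)
  also have "\<dots> = (norm x - norm y)\<^sup>2 + 2 * norm x * norm y * (1 - \<bar>cos (\<psi> - \<psi>')\<bar>)"
    unfolding t C by (simp add: power2_diff algebra_simps)
  also have "\<dots> \<le> (norm x - norm y)\<^sup>2 + 2 * norm x * norm y * (sin (\<psi> - \<psi>'))\<^sup>2"
  proof -
    have "\<bar>cos (\<psi> - \<psi>')\<bar> * \<bar>cos (\<psi> - \<psi>')\<bar> \<le> 1 * \<bar>cos (\<psi> - \<psi>')\<bar>"
      by (intro mult_right_mono) auto
    then have "1 - \<bar>cos (\<psi> - \<psi>')\<bar> \<le> (sin (\<psi> - \<psi>'))\<^sup>2"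
      using sin_squared_eq[of "\<psi> - \<psi>'"] power2_eq_square[of "\<bar>cos (\<psi> - \<psi>')\<bar>"] by simp
    then show ?thesis by (intro add_left_mono mult_left_mono) auto
  qed
  finally show ?thesis by (intro bexI[of _ \<tau>]) (auto simp: \<tau>_def)
qed

section \<open>Bounds for the sine near multiples of \<pi> and away from them\<close>

lemma sin_ge_half:
  fixes x :: real
  assumes "0 \<le> x" "x \<le> 1"
  shows "x / 2 \<le> sin x"
proof -
  have "\<bar>sin x - (\<Sum>m<Suc (Suc (Suc 0)). sin_coeff m * x ^ m)\<bar> \<le> inverse (fact (Suc (Suc (Suc 0)))) * \<bar>x\<bar> ^ Suc (Suc (Suc 0))"
    by (rule Maclaurin_sin_bound)
  moreover have "(\<Sum>m<Suc (Suc (Suc 0)). sin_coeff m * x ^ m) = x"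
    by (simp add: sin_coeff_def)
  moreover have "Suc (Suc (Suc 0)) = 3" "(fact 3 :: real) = 6"
    by (simp_all add: fact_numeral)
  ultimately have "\<bar>sin x - x\<bar> \<le> x ^ 3 / 6"
    using assms(1) by (simp only: abs_of_nonneg inverse_eq_divide)
  moreover have "x ^ 3 \<le> x" using assms power_decreasing[of 1 3 x] by simp
  ultimately show ?thesis using assms by linarith
qed

lemma sin_ge_between:
  assumes "0 \<le> \<eta>" "\<eta> \<le> 1" "\<eta> \<le> \<bar>t\<bar>" "\<bar>t\<bar> \<le> pi - \<eta>"
  shows "\<eta> / 2 \<le> \<bar>sin t\<bar>"
proof -
  have s: "\<bar>sin t\<bar> = sin \<bar>t\<bar>"
    using assms sin_ge_zero[of "\<bar>t\<bar>"] by (cases "0 \<le> t") auto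
  have "sin \<eta> \<le> sin \<bar>t\<bar>"
  proof (cases "\<bar>t\<bar> \<le> pi / 2")
    case True
    then show ?thesis using assms by (intro sin_monotone_2pi_le) auto
  next
    case False
    then have "sin \<eta> \<le> sin (pi - \<bar>t\<bar>)" using assms by (intro sin_monotone_2pi_le) auto
    then show ?thesis by simp
  qed
  then show ?thesis using sin_ge_half[OF assms(1,2)] s by linarith
qed

lemma sin_le_near_multiple:
  assumes "\<bar>t\<bar> \<le> \<eta> \<or> pi - \<eta> \<le> \<bar>t\<bar>" "\<bar>t\<bar> \<le> pi"
  shows "\<bar>sin t\<bar> \<le> \<eta>"
  using assms(1)
proof
  assume "\<bar>t\<bar> \<le> \<eta>"
  then show ?thesis using abs_sin_x_le_abs_x[of t] by linarith
next
  assume *: "pi - \<eta> \<le> \<bar>t\<bar>"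
  have "\<bar>sin t\<bar> = \<bar>sin (pi - \<bar>t\<bar>)\<bar>" by (cases "0 \<le> t") auto
  also have "\<dots> \<le> \<bar>pi - \<bar>t\<bar>\<bar>" by (rule abs_sin_x_le_abs_x)
  finally show ?thesis using * assms(2) by linarith
qed

section \<open>Choice of the removed sectors and grouping of the remaining ones\<close>

lemma pigeonhole_residue:
  fixes q :: "'a \<Rightarrow> int" and m :: "'a \<Rightarrow> real"
  assumes "finite S" "0 < N"
  shows "\<exists>r\<in>{0..<int N}. real N * (\<Sum>k\<in>{k\<in>S. q k mod int N = r}. m k) \<le> (\<Sum>k\<in>S. m k)"
proof (rule ccontr)
  assume "\<not> ?thesis"
  then have "(\<Sum>k\<in>S. m k) < real N * (\<Sum>k\<in>{k\<in>S. q k mod int N = r}. m k)" if "r \<in> {0..<int N}" for r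
    using that by force
  then have "(\<Sum>r\<in>{0..<int N}. \<Sum>k\<in>S. m k) < (\<Sum>r\<in>{0..<int N}. real N * (\<Sum>k\<in>{k\<in>S. q k mod int N = r}. m k))"
    using assms by (intro sum_strict_mono) auto
  also have "\<dots> = real N * (\<Sum>r\<in>{0..<int N}. \<Sum>k\<in>{k\<in>S. q k mod int N = r}. m k)"
    by (simp add: sum_distrib_left)
  also have "(\<Sum>r\<in>{0..<int N}. \<Sum>k\<in>{k\<in>S. q k mod int N = r}. m k) = (\<Sum>k\<in>S. m k)"
    using assms by (intro sum.group) auto
  finally show False by simp
qed

text \<open>\<open>u q\<close> is the position of \<open>q\<close> in the cyclic order starting at \<open>r\<close>; the positions divisible by \<open>N\<close> are
  the ones that are cut out.\<close>

lemma cyclic_cells: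
  fixes q q' r P N :: int and u :: "int \<Rightarrow> int"
  assumes N: "0 < N" "N dvd P" "N \<le> P" and r: "0 \<le> r" "r < N" and q: "0 \<le> q" "q < P" and q': "0 \<le> q'" "q' < P"
    and nz: "q mod N \<noteq> r" "q' mod N \<noteq> r"
  defines "u \<equiv> \<lambda>q. if r \<le> q then q - r else q - r + P"
  shows "u q div N \<noteq> u q' div N \<Longrightarrow> 2 \<le> \<bar>q - q'\<bar> \<and> \<bar>q - q'\<bar> \<le> P - 2"
    and "u q div N = u q' div N \<Longrightarrow> \<bar>q - q'\<bar> \<le> N - 1 \<or> P - N + 1 \<le> \<bar>q - q'\<bar>"
proof -
  \<comment> \<open>Since \<open>N\<close> divides \<open>P\<close>, going around the circle does
    not change residues; the positions divisible by \<open>N\<close> are exactly those with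
    \<open>q mod N = r\<close>.\<close>
  have um: "0 < u q mod N \<and> u q mod N < N" if "q mod N \<noteq> r" for q
  proof -
    obtain c where c: "P = N * c" using N(2) by (auto simp: dvd_def)
    have "u q mod N = (q - r) mod N" by (simp add: u_def c)
    moreover have "(q - r) mod N \<noteq> 0"
    proof
      assume "(q - r) mod N = 0"
      then have "q mod N = r mod N" by (metis mod_eq_dvd_iff mod_0_imp_dvd)
      then show False using that r by simp
    qed
    ultimately show ?thesis using N(1) by (metis pos_mod_bound pos_mod_sign order_le_less)
  qed
  have ub: "0 \<le> u q \<and> u q < P" if "0 \<le> q" "q < P" for q
    using that r N by (auto simp: u_def)
  have e1: "u q = N * (u q div N) + u q mod N" and e2: "u q' = N * (u q' div N) + u q' mod N" by simp_all
  have m1: "0 < u q mod N" "u q mod N < N" and m2: "0 < u q' mod N" "u q' mod N < N"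
    using um nz by auto
  have cases: "u q - u q' = q - q' \<or> u q - u q' = q - q' + P \<or> u q - u q' = q - q' - P"
    by (auto simp: u_def)
  \<comment> \<open>Position 0 is itself cut out, so there is also a gap where the cyclic order
    closes up; this yields the bound \<open>P - 2\<close>.\<close>
  have u1: "1 \<le> u q" using ub[OF q] m1 by (cases "u q = 0") auto
  have u2: "1 \<le> u q'" using ub[OF q'] m2 by (cases "u q' = 0") auto
  \<comment> \<open>Between two different blocks at least one position is missing, hence a
    difference of at least 2.\<close>
  have sep: "a < b \<Longrightarrow> N * a + i + 2 \<le> N * b + j" if "i < N" "0 < j" for a b i j :: int
  proof -
    assume "a < b"
    then have "N * (a + 1) \<le> N * b" using N by (intro mult_left_mono) auto
    then show ?thesis using that by (simp add: algebra_simps)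
  qed
  show "2 \<le> \<bar>q - q'\<bar> \<and> \<bar>q - q'\<bar> \<le> P - 2" if ne: "u q div N \<noteq> u q' div N"
  proof -
    have "2 \<le> \<bar>u q - u q'\<bar>"
    proof (cases "u q div N < u q' div N")
      case True
      then have "u q + 2 \<le> u q'" using sep[OF m1(2) m2(1) True] e1 e2 by linarith
      then show ?thesis by linarith
    next
      case False
      then have "u q' div N < u q div N" using ne by linarith
      then have "u q' + 2 \<le> u q" using sep[OF m2(2) m1(1)] e1 e2 by fastforce
      then show ?thesis by linarith
    qed
    then show ?thesis using cases u1 u2 ub[OF q] ub[OF q'] q q' by linarith
  qed
  show "\<bar>q - q'\<bar> \<le> N - 1 \<or> P - N + 1 \<le> \<bar>q - q'\<bar>" if eq: "u q div N = u q' div N"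
  proof -
    have "\<bar>u q - u q'\<bar> \<le> N - 1" using e1 e2 m1 m2 unfolding eq by linarith
    then show ?thesis using cases N q q' by linarith
  qed
qed

text \<open>Angles are taken modulo \<open>\<pi>\<close>, so that antipodal caps belong to the same group. The removed set \<open>E\<close> is
  every \<open>N\<close>-th of about \<open>N * sqrt R\<close> small sectors, with the residue chosen to lose little mass.\<close>

lemma sector_grouping:
  fixes S :: "(int \<times> int) set" and m :: "int \<times> int \<Rightarrow> real"
  assumes S: "finite S" and N: "4 \<le> N" and R: "1 \<le> R"
    and ann: "\<And>k. k \<in> S \<Longrightarrow> R \<le> norm (lattice_point k) \<and> norm (lattice_point k) \<le> R + 1"
  shows "\<exists>E grp. E \<subseteq> S \<and> real N * (\<Sum>k\<in>E. m k) \<le> (\<Sum>k\<in>S. m k) \<and>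
    (\<forall>k\<in>S - E. \<forall>l\<in>S - E. (grp k :: int) \<noteq> grp l \<longrightarrow>
       sqrt R / (2 * real N) \<le> norm (lattice_point k - lattice_point l) \<and>
       sqrt R / (2 * real N) \<le> norm (lattice_point k + lattice_point l)) \<and>
    (\<forall>k\<in>S - E. \<forall>l\<in>S - E. grp k = grp l \<longrightarrow>
       norm (lattice_point k - lattice_point l) \<le> 12 * sqrt R \<or>
       norm (lattice_point k + lattice_point l) \<le> 12 * sqrt R)"
proof -
  have "\<forall>k. \<exists>\<psi> \<sigma>. 0 \<le> \<psi> \<and> \<psi> < pi \<and> \<bar>\<sigma>\<bar> = 1 \<and>
      lattice_point k = (\<sigma> * norm (lattice_point k) * cos \<psi>, \<sigma> * norm (lattice_point k) * sin \<psi>)"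
    using polar_mod_pi by blast
  then obtain \<psi> \<sigma> where psi: "\<And>k. 0 \<le> \<psi> k" "\<And>k. \<psi> k < pi" and sig: "\<And>k. \<bar>\<sigma> k\<bar> = 1"
    and pol: "\<And>k. lattice_point k = (\<sigma> k * norm (lattice_point k) * cos (\<psi> k), \<sigma> k * norm (lattice_point k) * sin (\<psi> k))"
    by metis
  \<comment> \<open>There will be \<open>J\<close> blocks of \<open>N\<close> small sectors each. A
    block has the angle \<open>pi / J\<close>, of order \<open>1 / sqrt R\<close> whatever
    \<open>N\<close> is, so the diameter of a group does not depend on \<open>N\<close>; only the
    width of the gaps does.\<close>
  define J where "J = nat \<lceil>sqrt R\<rceil>"
  have sR: "1 \<le> sqrt R" using R by simp
  have J: "sqrt R \<le> real J" "real J \<le> 2 * sqrt R" "1 \<le> J"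
  proof -
    have "real J = real_of_int \<lceil>sqrt R\<rceil>" using sR by (simp add: J_def)
    then show "sqrt R \<le> real J" "real J \<le> 2 * sqrt R" "1 \<le> J"
      using ceiling_correct[of "sqrt R"] sR by linarith+
  qed
  define P where "P = int J * int N"
  define \<eta> where "\<eta> = pi / real_of_int P"
  have P4: "4 \<le> P" using J N mult_mono[of 1 "int J" 4 "int N"] by (simp add: P_def)
  have P: "0 < P" "int N dvd P" "int N \<le> P"
    using P4 J N by (auto simp: P_def)
  have eta: "0 < \<eta>" "\<eta> \<le> 1" "real_of_int P * \<eta> = pi"
    using P4 pi_less_4 by (auto simp: \<eta>_def)
  define q where "q k = \<lfloor>\<psi> k / \<eta>\<rfloor>" for k
  have q: "real_of_int (q k) * \<eta> \<le> \<psi> k" "\<psi> k < (real_of_int (q k) + 1) * \<eta>" for k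
    using eta(1) by (auto simp: q_def floor_divide_lower floor_divide_upper)
  have q0: "0 \<le> q k" for k using psi eta by (simp add: q_def)
  have qP: "q k < P" for k
  proof -
    have "real_of_int (q k) * \<eta> < real_of_int P * \<eta>" using q(1)[of k] psi(2)[of k] eta(3) by linarith
    then show ?thesis using eta(1) by simp
  qed
  have "0 < N" using N by simp
  from pigeonhole_residue[OF S this, where q=q and m=m]
  obtain r where r: "r \<in> {0..<int N}" "real N * (\<Sum>k\<in>{k\<in>S. q k mod int N = r}. m k) \<le> (\<Sum>k\<in>S. m k)" by blast
  define E where "E = {k\<in>S. q k mod int N = r}"
  define grp where "grp k = (if r \<le> q k then q k - r else q k - r + P) div int N" for k
  have N0: "0 < int N" using N by simp
  \<comment> \<open>Rounding angles to sector indices costs at most one \<open>\<eta>\<close>, so an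
    index difference of 2 still separates the angles by \<open>\<eta>\<close>.\<close>
  have diff: "\<bar>(\<psi> k - \<psi> l) - real_of_int (q k - q l) * \<eta>\<bar> \<le> \<eta>" for k l
    using q[of k] q[of l] by (simp add: algebra_simps abs_le_iff)
  have absd: "\<bar>real_of_int n * \<eta>\<bar> = \<bar>real_of_int n\<bar> * \<eta>" for n
    using eta(1) by (simp only: abs_mult abs_of_pos)
  have Neta: "\<eta> * real N = pi / real J" using N by (simp add: \<eta>_def P_def)
  show ?thesis
  proof (intro exI[of _ E] exI[of _ grp] conjI ballI impI)
    show "E \<subseteq> S" by (auto simp: E_def)
    show "real N * (\<Sum>k\<in>E. m k) \<le> (\<Sum>k\<in>S. m k)" using r(2) by (simp add: E_def)
  next
    fix k l assume k: "k \<in> S - E" and l: "l \<in> S - E" and ne: "grp k \<noteq> grp l"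
    have "2 \<le> \<bar>q k - q l\<bar> \<and> \<bar>q k - q l\<bar> \<le> P - 2"
      by (rule cyclic_cells(1)[OF N0 P(2,3), of r]) (use r(1) q0 qP k l ne in \<open>auto simp: E_def grp_def\<close>)
    then have "2 \<le> \<bar>real_of_int (q k - q l)\<bar>" "\<bar>real_of_int (q k - q l)\<bar> \<le> real_of_int P - 2" by linarith+
    then have "2 * \<eta> \<le> \<bar>real_of_int (q k - q l)\<bar> * \<eta>" "\<bar>real_of_int (q k - q l)\<bar> * \<eta> \<le> (real_of_int P - 2) * \<eta>"
      using eta(1) by (auto intro!: mult_right_mono simp del: of_int_diff)
    then have "2 * \<eta> \<le> \<bar>real_of_int (q k - q l) * \<eta>\<bar>" "\<bar>real_of_int (q k - q l) * \<eta>\<bar> \<le> pi - 2 * \<eta>"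
      unfolding absd using eta(3) by (simp_all only: left_diff_distrib)
    then have "\<eta> \<le> \<bar>\<psi> k - \<psi> l\<bar>" "\<bar>\<psi> k - \<psi> l\<bar> \<le> pi - \<eta>" using diff[of k l] by linarith+
    then have s: "\<eta> / 2 \<le> \<bar>sin (\<psi> k - \<psi> l)\<bar>" using eta by (intro sin_ge_between) auto
    have "sqrt R / (2 * real N) \<le> R * (\<eta> / 2)"
    proof -
      have "sqrt R * real J \<le> sqrt R * (2 * sqrt R)" using J R by (intro mult_left_mono) auto
      also have "\<dots> = R * 2" using R by simp
      also have "\<dots> \<le> R * pi" using R pi_ge_two by (intro mult_left_mono) auto
      finally have "sqrt R * real J / (2 * real N * real J) \<le> R * pi / (2 * real N * real J)"
        by (intro divide_right_mono) auto
      then show ?thesis using J(3) N by (simp add: \<eta>_def P_def mult.commute)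
    qed
    also have "\<dots> \<le> norm (lattice_point k) * \<bar>sin (\<psi> k - \<psi> l)\<bar>"
      using ann[of k] k s R eta by (intro mult_mono) auto
    finally have base: "sqrt R / (2 * real N) \<le> norm (lattice_point k) * \<bar>sin (\<psi> k - \<psi> l)\<bar>" .
    show "sqrt R / (2 * real N) \<le> norm (lattice_point k - lattice_point l)"
      using base polar_separated[OF pol[of k] sig pol[of l] sig, of 1] by simp
    show "sqrt R / (2 * real N) \<le> norm (lattice_point k + lattice_point l)"
      using base polar_separated[OF pol[of k] sig pol[of l] sig, of "-1"] by simp
  next
    fix k l assume k: "k \<in> S - E" and l: "l \<in> S - E" and eq: "grp k = grp l"
    have "\<bar>q k - q l\<bar> \<le> int N - 1 \<or> P - int N + 1 \<le> \<bar>q k - q l\<bar>"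
      by (rule cyclic_cells(2)[OF N0 P(2,3), of r]) (use r(1) q0 qP k l eq in \<open>auto simp: E_def grp_def\<close>)
    then have "\<bar>\<psi> k - \<psi> l\<bar> \<le> \<eta> * real N \<or> pi - \<eta> * real N \<le> \<bar>\<psi> k - \<psi> l\<bar>"
    proof
      assume "\<bar>q k - q l\<bar> \<le> int N - 1"
      then have "\<bar>real_of_int (q k - q l)\<bar> \<le> real N - 1" by linarith
      then have "\<bar>real_of_int (q k - q l)\<bar> * \<eta> \<le> (real N - 1) * \<eta>" using eta by (intro mult_right_mono) auto
      then have "\<bar>real_of_int (q k - q l) * \<eta>\<bar> \<le> \<eta> * real N - \<eta>" unfolding absd using eta(3) by (simp only: left_diff_distrib distrib_right mult_1 mult.commute[of \<eta>])
      then show ?thesis using diff[of k l] by linarith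
    next
      assume "P - int N + 1 \<le> \<bar>q k - q l\<bar>"
      then have "real_of_int P - real N + 1 \<le> \<bar>real_of_int (q k - q l)\<bar>" by linarith
      then have "(real_of_int P - real N + 1) * \<eta> \<le> \<bar>real_of_int (q k - q l)\<bar> * \<eta>" using eta by (intro mult_right_mono) auto
      then have "pi - \<eta> * real N + \<eta> \<le> \<bar>real_of_int (q k - q l) * \<eta>\<bar>" unfolding absd using eta(3) by (simp only: left_diff_distrib distrib_right mult_1 mult.commute[of \<eta>])
      then show ?thesis using diff[of k l] by linarith
    qed
    moreover have "\<bar>\<psi> k - \<psi> l\<bar> \<le> pi" using psi[of k] psi[of l] by linarith
    ultimately have "\<bar>sin (\<psi> k - \<psi> l)\<bar> \<le> \<eta> * real N" by (rule sin_le_near_multiple)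
    also have "\<dots> \<le> 4 / sqrt R"
      unfolding Neta using J sR pi_less_4 by (intro frac_le) auto
    finally have "(sin (\<psi> k - \<psi> l))\<^sup>2 \<le> (4 / sqrt R)\<^sup>2"
      by (metis abs_ge_zero power2_abs power_mono)
    then have s2: "(sin (\<psi> k - \<psi> l))\<^sup>2 \<le> 16 / R" using R by (simp add: power_divide)
    obtain \<tau> where \<tau>: "\<tau> \<in> {1, -1}" "(norm (lattice_point k - \<tau> *\<^sub>R lattice_point l))\<^sup>2 \<le>
        (norm (lattice_point k) - norm (lattice_point l))\<^sup>2 + 2 * norm (lattice_point k) * norm (lattice_point l) * (sin (\<psi> k - \<psi> l))\<^sup>2"
      using polar_close[OF pol[of k] sig pol[of l] sig] by blast
    have nk: "R \<le> norm (lattice_point k)" "norm (lattice_point k) \<le> R + 1" "R \<le> norm (lattice_point l)" "norm (lattice_point l) \<le> R + 1"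
      using ann k l by auto
    have "(norm (lattice_point k) - norm (lattice_point l))\<^sup>2 \<le> 1\<^sup>2"
      using nk by (intro power2_le_iff_abs_le[THEN iffD2]) auto
    moreover have "2 * norm (lattice_point k) * norm (lattice_point l) * (sin (\<psi> k - \<psi> l))\<^sup>2 \<le> 2 * (2 * R) * (2 * R) * (16 / R)"
      using nk R s2 by (intro mult_mono) auto
    moreover have "2 * (2 * R) * (2 * R) * (16 / R) = 128 * R" using R by simp
    \<comment> \<open>The sum is at most \<open>1 + 128 * R\<close>; rounding up to
      \<open>144 * R\<close> gives a perfect square, the origin of the constant 12.\<close>
    ultimately have "(norm (lattice_point k - \<tau> *\<^sub>R lattice_point l))\<^sup>2 \<le> 144 * R" using \<tau>(2) R by simp
    also have "\<dots> = (12 * sqrt R)\<^sup>2" using R by (simp add: power_mult_distrib)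
    finally have "norm (lattice_point k - \<tau> *\<^sub>R lattice_point l) \<le> 12 * sqrt R"
      by (rule power2_le_imp_le) (use R in simp)
    then show "norm (lattice_point k - lattice_point l) \<le> 12 * sqrt R \<or> norm (lattice_point k + lattice_point l) \<le> 12 * sqrt R"
      using \<tau>(1) by auto
  qed
qed

section \<open>Differences of lattice points in the annulus\<close>

definition perp :: "real \<times> real \<Rightarrow> real \<times> real" where
  "perp n = (- snd n, fst n)"

lemma norm_sq_perp_decomp:
  assumes "norm n = 1"
  shows "(norm x)\<^sup>2 = (x \<bullet> n)\<^sup>2 + (x \<bullet> perp n)\<^sup>2"
proof -
  obtain a b where n: "n = (a, b)" by (cases n)
  obtain c d where x: "x = (c, d)" by (cases x)
  have "a\<^sup>2 + b\<^sup>2 = (norm n)\<^sup>2" by (simp add: n norm_Pair)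
  then have ab: "a\<^sup>2 + b\<^sup>2 = 1" using assms by simp
  have "(x \<bullet> n)\<^sup>2 + (x \<bullet> perp n)\<^sup>2 = (c\<^sup>2 + d\<^sup>2) * (a\<^sup>2 + b\<^sup>2)"
    by (simp add: n x perp_def power2_eq_square algebra_simps)
  then show ?thesis by (simp add: ab x norm_Pair)
qed

text \<open>The rectangle is cut into cells of side \<open>1 / 2\<close> in the rotated coordinates.
  The diagonal of a cell is shorter than 1, so no cell holds two lattice points, and counting cells
  suffices.\<close>

lemma card_lattice_in_rectangle:
  fixes K :: "(int \<times> int) set"
  assumes n: "norm n = 1" and ab: "0 \<le> a" "0 \<le> b"
    and A: "\<And>k l. k \<in> K \<Longrightarrow> l \<in> K \<Longrightarrow> \<bar>(lattice_point k - lattice_point l) \<bullet> n\<bar> \<le> a"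
    and B: "\<And>k l. k \<in> K \<Longrightarrow> l \<in> K \<Longrightarrow> \<bar>(lattice_point k - lattice_point l) \<bullet> perp n\<bar> \<le> b"
  shows "finite K \<and> real (card K) \<le> (4 * a + 2) * (4 * b + 2)"
proof (cases "K = {}")
  case True
  then show ?thesis using ab by simp
next
  case False
  then obtain l where l: "l \<in> K" by blast
  define f where "f k = (\<lfloor>2 * ((lattice_point k - lattice_point l) \<bullet> n)\<rfloor>, \<lfloor>2 * ((lattice_point k - lattice_point l) \<bullet> perp n)\<rfloor>)" for k
  define I where "I a = {\<lfloor>- (2 * a)\<rfloor>..\<lfloor>2 * a\<rfloor>}" for a :: real
  have finI: "finite (I a \<times> I b)" by (simp add: I_def)
  have sub: "f ` K \<subseteq> I a \<times> I b"
  proof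
    fix z assume "z \<in> f ` K"
    then obtain k where k: "k \<in> K" "z = f k" by blast
    have "\<lfloor>2 * t\<rfloor> \<in> I c" if "\<bar>t\<bar> \<le> c" for t c :: real
      using that unfolding I_def by (auto intro!: floor_mono)
    then show "z \<in> I a \<times> I b" using A[OF k(1) l] B[OF k(1) l] by (simp add: k f_def)
  qed
  have inj: "inj_on f K"
  proof (rule inj_onI, rule ccontr)
    fix k k' assume kk: "k \<in> K" "k' \<in> K" "f k = f k'" "k \<noteq> k'"
    have fl: "\<bar>s - t\<bar> < 1 / 2" if "\<lfloor>2 * s\<rfloor> = \<lfloor>2 * t\<rfloor>" for s t :: real
      using that by linarith
    have sm: "\<bar>(lattice_point k - lattice_point k') \<bullet> v\<bar> < 1 / 2"
      if "\<lfloor>2 * ((lattice_point k - lattice_point l) \<bullet> v)\<rfloor> = \<lfloor>2 * ((lattice_point k' - lattice_point l) \<bullet> v)\<rfloor>" for v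
    proof -
      have "(lattice_point k - lattice_point k') \<bullet> v = (lattice_point k - lattice_point l) \<bullet> v - (lattice_point k' - lattice_point l) \<bullet> v"
        by (simp add: inner_diff_left)
      then show ?thesis using fl[OF that] by simp
    qed
    have sq: "t\<^sup>2 \<le> (1 / 2)\<^sup>2" if "\<bar>t\<bar> < 1 / 2" for t :: real
      using that by (intro power2_le_iff_abs_le[THEN iffD2]) auto
    have "(norm (lattice_point (k - k')))\<^sup>2 \<le> (1 / 2)\<^sup>2 + (1 / 2)\<^sup>2"
      unfolding lattice_point_diff norm_sq_perp_decomp[OF n]
      using kk(3) by (intro add_mono sq sm) (auto simp: f_def)
    moreover have "1\<^sup>2 \<le> (norm (lattice_point (k - k')))\<^sup>2"
      using kk(4) by (intro power_mono norm_lattice_point_ge_1) auto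
    ultimately show False by (simp add: power2_eq_square)
  qed
  have cI: "real (card (I c)) \<le> 4 * c + 2" if "0 \<le> c" for c
  proof -
    have "\<lfloor>- (2 * c)\<rfloor> \<le> \<lfloor>2 * c\<rfloor>" using that by (intro floor_mono) auto
    then have "real (card (I c)) = real_of_int (\<lfloor>2 * c\<rfloor> - \<lfloor>- (2 * c)\<rfloor> + 1)"
      by (simp add: I_def)
    then show ?thesis by linarith
  qed
  have "card K \<le> card (I a \<times> I b)"
    using card_mono[OF finI sub] card_image[OF inj] by simp
  then have "real (card K) \<le> real (card (I a)) * real (card (I b))"
    by (metis card_cartesian_product of_nat_le_iff of_nat_mult)
  also have "\<dots> \<le> (4 * a + 2) * (4 * b + 2)"
    using ab by (intro mult_mono cI) auto
  finally show ?thesis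
    using finite_imageD[OF finite_subset[OF sub finI] inj] by simp
qed

text \<open>Squared radii in the annulus vary by at most \<open>3 * R * w\<close>. The inner product
  is a difference of two of them, and the parallelogram law expresses the other quantity through
  their sum.\<close>

lemma annulus_difference_bounds:
  fixes R w :: real and x y :: "real \<times> real"
  assumes R: "1 \<le> R" and w: "0 \<le> w" "w \<le> 1" and x: "R \<le> norm x" "norm x \<le> R + w" and y: "R \<le> norm y" "norm y \<le> R + w"
  shows "\<bar>(x + y) \<bullet> (x - y)\<bar> \<le> 3 * R * w"
    and "4 * R\<^sup>2 \<le> (norm (x + y))\<^sup>2 + (norm (x - y))\<^sup>2"
    and "(norm (x + y))\<^sup>2 + (norm (x - y))\<^sup>2 \<le> 4 * R\<^sup>2 + 12 * R * w"
proof -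
  have sq: "R\<^sup>2 \<le> (norm z)\<^sup>2 \<and> (norm z)\<^sup>2 \<le> R\<^sup>2 + 3 * R * w" if "R \<le> norm z" "norm z \<le> R + w" for z :: "real \<times> real"
  proof
    show "R\<^sup>2 \<le> (norm z)\<^sup>2" using that R by (intro power_mono) auto
    have "(norm z)\<^sup>2 \<le> (R + w)\<^sup>2" using that by (intro power_mono) auto
    also have "\<dots> = R\<^sup>2 + 2 * R * w + w * w" by (simp add: power2_eq_square algebra_simps)
    also have "w * w \<le> R * w" using w R by (intro mult_right_mono) auto
    finally show "(norm z)\<^sup>2 \<le> R\<^sup>2 + 3 * R * w" by simp
  qed
  have "(x + y) \<bullet> (x - y) = (norm x)\<^sup>2 - (norm y)\<^sup>2"
    by (simp add: power2_norm_eq_inner inner_diff_right inner_add_left inner_commute[of y x])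
  then show "\<bar>(x + y) \<bullet> (x - y)\<bar> \<le> 3 * R * w"
    using sq[OF x] sq[OF y] by (simp add: abs_le_iff)
  have "(norm (x + y))\<^sup>2 + (norm (x - y))\<^sup>2 = 2 * (norm x)\<^sup>2 + 2 * (norm y)\<^sup>2"
    by (simp add: power2_norm_eq_inner inner_diff_right inner_diff_left inner_add_left inner_add_right inner_commute[of y x])
  then show "4 * R\<^sup>2 \<le> (norm (x + y))\<^sup>2 + (norm (x - y))\<^sup>2"
    and "(norm (x + y))\<^sup>2 + (norm (x - y))\<^sup>2 \<le> 4 * R\<^sup>2 + 12 * R * w"
    using sq[OF x] sq[OF y] by simp_all
qed

text \<open>With \<open>p = 2 k - m\<close>, the number \<open>p \<bullet> m\<close> is a difference of two squared radii, which confines \<open>p\<close> to a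
  strip of width of order \<open>R w / |m|\<close>; and \<open>|p|\<^sup>2 + |m|\<^sup>2\<close> is nearly constant, which confines \<open>p\<close> to two
  pieces of length of order \<open>R w / |p|\<close> of this strip.\<close>

lemma annulus_pair_count:
  assumes \<kappa>: "0 < \<kappa>" "\<kappa> \<le> 1" and \<alpha>: "0 \<le> \<alpha>" "\<alpha> \<le> 1 / 2"
  shows "\<exists>C>0. \<exists>R\<^sub>0\<ge>1. \<forall>R\<ge>R\<^sub>0. \<forall>m. 
    finite {k. lattice_point k \<in> annulus R \<alpha> \<and> lattice_point (k - m) \<in> annulus R \<alpha> \<and>
      \<kappa> * sqrt R \<le> norm (lattice_point m) \<and> \<kappa> * sqrt R \<le> norm (lattice_point k + lattice_point (k - m))} \<and>
    real (card {k. lattice_point k \<in> annulus R \<alpha> \<and> lattice_point (k - m) \<in> annulus R \<alpha> \<and>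
      \<kappa> * sqrt R \<le> norm (lattice_point m) \<and> \<kappa> * sqrt R \<le> norm (lattice_point k + lattice_point (k - m))})
    \<le> C * norm (lattice_point m) powr (1 - 2 * \<alpha>)"
proof -
  define CA where "CA = (12 / \<kappa>\<^sup>2 + 2) * (44 / \<kappa>\<^sup>2 + 2)"
  define CB where "CB = 14 * (84 / \<kappa> ^ 3 + 2)"
  have CA: "0 < CA" and CB: "0 < CB" using \<kappa> by (auto simp: CA_def CB_def intro!: mult_pos_pos add_nonneg_pos)
  \<comment> \<open>From \<open>R0\<close> on, \<open>\<kappa>\<^sup>2 * R \<ge> 12\<close>. For
    short \<open>m\<close> this gives \<open>9 * R / \<kappa>\<^sup>2 \<le> R\<^sup>2\<close>; for
    long \<open>m\<close> it is what
    \<open>\<kappa>\<^sup>2 * R - 9 \<ge> \<kappa>\<^sup>2 * R / 4\<close> requires.\<close>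
  define R0 where "R0 = 12 / \<kappa>\<^sup>2"
  have k2: "0 < \<kappa>\<^sup>2" "\<kappa>\<^sup>2 \<le> 1" using \<kappa> by (auto simp: power_le_one)
  have R0: "12 \<le> R0" using k2 by (simp add: R0_def le_divide_eq)
  show ?thesis
  proof (rule exI[of _ "2 * (CA + CB)"], rule conjI[rotated], rule exI[of _ R0], intro conjI allI impI)
    show "0 < 2 * (CA + CB)" using CA CB by simp
    show "1 \<le> R0" using R0 by simp
    fix R m
    assume RR: "R0 \<le> R"
    define M where "M = norm (lattice_point m)"
    define K where "K = {k. lattice_point k \<in> annulus R \<alpha> \<and> lattice_point (k - m) \<in> annulus R \<alpha> \<and>
      \<kappa> * sqrt R \<le> norm (lattice_point m) \<and> \<kappa> * sqrt R \<le> norm (lattice_point k + lattice_point (k - m))}"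
    have R: "1 \<le> R" "12 \<le> \<kappa>\<^sup>2 * R"
      using RR R0 k2(1) by (linarith, simp add: R0_def pos_divide_le_eq mult.commute)
    define w where "w = R powr (- \<alpha>)"
    have "w \<le> R powr 0" unfolding w_def using R \<alpha> by (intro powr_mono) auto
    then have w: "0 < w" "w \<le> 1" using R by (auto simp: w_def)
    have "finite K \<and> real (card K) \<le> 2 * (CA + CB) * M powr (1 - 2 * \<alpha>)"
    proof (cases "\<kappa> * sqrt R \<le> M")
      case False
      then have "K = {}" by (auto simp: K_def M_def)
      then show ?thesis using CA CB by simp
    next
      case M: True
      have "0 < \<kappa> * sqrt R" using \<kappa> R by simp
      then have "m \<noteq> 0" using M by (auto simp: M_def)
      then have M1: "1 \<le> M" unfolding M_def by (rule norm_lattice_point_ge_1)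
      have M2: "\<kappa>\<^sup>2 * R \<le> M\<^sup>2"
      proof -
        have "(\<kappa> * sqrt R)\<^sup>2 \<le> M\<^sup>2" using M \<kappa> R by (intro power_mono) auto
        then show ?thesis using R by (simp add: power_mult_distrib)
      qed
      define n where "n = (1 / M) *\<^sub>R lattice_point m"
      have n: "norm n = 1" using M1 by (auto simp: n_def M_def)
      define p where "p k = lattice_point k + lattice_point (k - m)" for k
      \<comment> \<open>The position along the strip, which is perpendicular to \<open>m\<close>;
        the sign of \<open>u\<close> tells the two pieces apart.\<close>
      define u where "u k = p k \<bullet> perp n" for k
      have p2: "p k = 2 *\<^sub>R lattice_point k - lattice_point m" for k
        by (simp add: p_def lattice_point_diff scaleR_2)
      have pu: "(norm (p k))\<^sup>2 = (p k \<bullet> n)\<^sup>2 + (u k)\<^sup>2" for k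
        unfolding u_def by (rule norm_sq_perp_decomp[OF n])
      have xn: "R \<le> norm (lattice_point k)" "norm (lattice_point k) \<le> R + w"
        "R \<le> norm (lattice_point (k - m))" "norm (lattice_point (k - m)) \<le> R + w"
        "\<kappa> * sqrt R \<le> norm (p k)" if "k \<in> K" for k
        using that by (auto simp: K_def annulus_def w_def p_def)
      have kkm: "lattice_point k - lattice_point (k - m) = lattice_point m" for k
        by (simp add: lattice_point_diff)
      have pn: "\<bar>p k \<bullet> n\<bar> \<le> 3 * R * w / M"
        and n1: "4 * R\<^sup>2 \<le> (norm (p k))\<^sup>2 + M\<^sup>2" and n2: "(norm (p k))\<^sup>2 + M\<^sup>2 \<le> 4 * R\<^sup>2 + 12 * R * w" if k: "k \<in> K" for k
      proof -
        note b = annulus_difference_bounds[OF R(1) less_imp_le[OF w(1)] w(2) xn(1,2)[OF k] xn(3,4)[OF k]]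
        have "\<bar>p k \<bullet> n\<bar> = \<bar>p k \<bullet> lattice_point m\<bar> / M" using M1 by (simp add: n_def abs_mult)
        also have "\<dots> \<le> 3 * R * w / M"
          using b(1) M1 unfolding kkm p_def by (intro divide_right_mono) auto
        finally show "\<bar>p k \<bullet> n\<bar> \<le> 3 * R * w / M" .
        show "4 * R\<^sup>2 \<le> (norm (p k))\<^sup>2 + M\<^sup>2" "(norm (p k))\<^sup>2 + M\<^sup>2 \<le> 4 * R\<^sup>2 + 12 * R * w"
          using b(2,3) unfolding kkm p_def M_def .
      qed
      have pn2: "(p k \<bullet> n)\<^sup>2 \<le> 9 * R\<^sup>2 * w\<^sup>2 / M\<^sup>2" if "k \<in> K" for k
      proof -
        have "(p k \<bullet> n)\<^sup>2 \<le> (3 * R * w / M)\<^sup>2"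
          using pn[OF that] R(1) w M1 by (intro power2_le_iff_abs_le[THEN iffD2]) auto
        then show ?thesis by (simp add: power_divide power_mult_distrib)
      qed
      have RM: "R / M\<^sup>2 \<le> 1 / \<kappa>\<^sup>2" using M2 M1 k2 by (simp add: field_simps)
      have ww: "w\<^sup>2 \<le> w" using w power_decreasing[of 1 2 w] by simp
      have pn2': "9 * R\<^sup>2 * w\<^sup>2 / M\<^sup>2 \<le> 9 * R * w / \<kappa>\<^sup>2"
      proof -
        have "9 * R\<^sup>2 * w\<^sup>2 / M\<^sup>2 = 9 * R * w\<^sup>2 * (R / M\<^sup>2)" by (simp add: power2_eq_square)
        also have "\<dots> \<le> 9 * R * w * (1 / \<kappa>\<^sup>2)" using RM ww R(1) w by (intro mult_mono) auto
        finally show ?thesis by simp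
      qed
      have udiff: "\<bar>(u k)\<^sup>2 - (u l)\<^sup>2\<bar> \<le> 21 * R * w / \<kappa>\<^sup>2" if k: "k \<in> K" and l: "l \<in> K" for k l
      proof -
        have "12 * R * w \<le> 12 * R * w / \<kappa>\<^sup>2" using k2 R(1) w by (simp add: le_divide_eq mult_left_le)
        moreover have "\<bar>(u k)\<^sup>2 - (u l)\<^sup>2\<bar> \<le> 12 * R * w + 9 * R * w / \<kappa>\<^sup>2"
          using pu[of k] pu[of l] n1[OF k] n1[OF l] n2[OF k] n2[OF l] pn2[OF k] pn2[OF l] pn2'
            zero_le_power2[of "p k \<bullet> n"] zero_le_power2[of "p l \<bullet> n"] by (simp only: abs_le_iff) linarith
        ultimately show ?thesis by (simp add: add_divide_distrib[symmetric])
      qed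
      \<comment> \<open>Within one sign of \<open>u\<close> the sum of two values has modulus at
        least \<open>2 * U\<close>, so dividing the difference of their squares by it confines
        \<open>u\<close> to an interval.\<close>
      have rect: "finite K' \<and> real (card K') \<le> (12 * (R * w / M) + 2) * (4 * b + 2)"
        if K': "K' \<subseteq> K" "(\<forall>k\<in>K'. 0 < u k) \<or> (\<forall>k\<in>K'. u k < 0)" and U: "0 < U" "\<And>k. k \<in> K \<Longrightarrow> U \<le> \<bar>u k\<bar>"
          and b: "21 * R * w / \<kappa>\<^sup>2 \<le> 2 * U * b" "0 \<le> b" for K' U b
      proof -
        have "finite K' \<and> real (card K') \<le> (4 * (3 * (R * w / M)) + 2) * (4 * b + 2)"
        proof (rule card_lattice_in_rectangle[OF n])
          show "0 \<le> 3 * (R * w / M)" using R(1) w M1 by simp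
          show "0 \<le> b" by (rule b)
          fix k l assume kl: "k \<in> K'" "l \<in> K'"
          then have k: "k \<in> K" and l: "l \<in> K" using K' by auto
          have eq: "lattice_point k - lattice_point l = (1 / 2) *\<^sub>R (p k - p l)"
            by (simp add: p2 scaleR_right_diff_distrib)
          have "\<bar>(p k - p l) \<bullet> n\<bar> \<le> 2 * (3 * R * w / M)"
            using pn[OF k] pn[OF l] by (simp add: inner_diff_left abs_le_iff)
          then show "\<bar>(lattice_point k - lattice_point l) \<bullet> n\<bar> \<le> 3 * (R * w / M)"
            unfolding eq by (simp add: abs_mult)
          have "0 < u k \<and> 0 < u l \<or> u k < 0 \<and> u l < 0" using K'(2) kl by blast
          then have "2 * U \<le> \<bar>u k + u l\<bar>" using U(2)[OF k] U(2)[OF l] by linarith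
          then have "(2 * U) * \<bar>u k - u l\<bar> \<le> \<bar>u k + u l\<bar> * \<bar>u k - u l\<bar>"
            by (rule mult_right_mono) simp
          also have "\<dots> = \<bar>(u k)\<^sup>2 - (u l)\<^sup>2\<bar>"
            by (simp add: power2_eq_square algebra_simps flip: abs_mult)
          also have "\<dots> \<le> (2 * U) * b" using udiff[OF k l] b by linarith
          finally have "\<bar>u k - u l\<bar> \<le> b" using U(1) by simp
          then show "\<bar>(lattice_point k - lattice_point l) \<bullet> perp n\<bar> \<le> b"
            unfolding eq using b(2) by (simp add: u_def inner_diff_left abs_mult)
        qed
        then show ?thesis by simp
      qed
      have both: "finite K \<and> real (card K) \<le> 2 * ((12 * (R * w / M) + 2) * (4 * b + 2))"
        if U: "0 < U" "\<And>k. k \<in> K \<Longrightarrow> U \<le> \<bar>u k\<bar>" and b: "21 * R * w / \<kappa>\<^sup>2 \<le> 2 * U * b" "0 \<le> b" for U b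
      proof -
        define P where "P = {k \<in> K. 0 < u k}"
        define Q where "Q = {k \<in> K. u k < 0}"
        have P: "finite P \<and> real (card P) \<le> (12 * (R * w / M) + 2) * (4 * b + 2)"
          by (rule rect[OF _ _ U b]) (auto simp: P_def)
        have Q: "finite Q \<and> real (card Q) \<le> (12 * (R * w / M) + 2) * (4 * b + 2)"
          by (rule rect[OF _ _ U b]) (auto simp: Q_def)
        have "u k \<noteq> 0" if "k \<in> K" for k using U(1) U(2)[OF that] by auto
        then have e: "K = P \<union> Q" by (auto simp: neq_iff P_def Q_def)
        have "finite (P \<union> Q)" "card (P \<union> Q) \<le> card P + card Q"
          using P Q card_Un_le[of P Q] by auto
        then show ?thesis unfolding e using P Q by linarith
      qed
      have dist: "2 * (CA + CB) * X = 2 * (CA * X) + 2 * (CB * X)" for X :: real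
        by (simp add: algebra_simps)
      have Mp: "1 \<le> M powr (1 - 2 * \<alpha>)" using M1 \<alpha> by (intro ge_one_powr_ge_zero) auto
      show ?thesis
      proof (cases "M \<le> R")
        case True
        \<comment> \<open>For \<open>M \<le> R\<close> the vector \<open>p\<close> is long and
          nearly perpendicular to \<open>m\<close>: \<open>4 * R\<^sup>2\<close> minus two squares
          of size at most \<open>R\<^sup>2\<close> remains for \<open>(u k)\<^sup>2\<close>. The
          pieces then have bounded length, and only the width of the strip matters.\<close>
        have "R \<le> \<bar>u k\<bar>" if k: "k \<in> K" for k
        proof -
          have "9 * R * w / \<kappa>\<^sup>2 \<le> 9 * R / \<kappa>\<^sup>2" using R(1) w k2 by (intro divide_right_mono) auto
          also have "\<dots> \<le> R\<^sup>2"
          proof -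
            have "9 * R \<le> (\<kappa>\<^sup>2 * R) * R" using R by (intro mult_right_mono) auto
            then show ?thesis using k2 by (simp add: pos_divide_le_eq power2_eq_square mult_ac)
          qed
          finally have "(p k \<bullet> n)\<^sup>2 \<le> R\<^sup>2" using pn2[OF k] pn2' by linarith
          moreover have "M\<^sup>2 \<le> R\<^sup>2" using True M1 by (intro power_mono) auto
          ultimately have "R\<^sup>2 \<le> (u k)\<^sup>2" using pu[of k] n1[OF k] zero_le_power2[of R] by linarith
          then show ?thesis using R(1) by (simp add: abs_le_square_iff[symmetric])
        qed
        moreover have "21 * R * w / \<kappa>\<^sup>2 \<le> 2 * R * (11 / \<kappa>\<^sup>2)"
        proof -
          have "21 * R * w \<le> 22 * R" using R(1) w mult_left_mono[of w 1 "21 * R"] by linarith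
          then have "21 * R * w / \<kappa>\<^sup>2 \<le> 22 * R / \<kappa>\<^sup>2" using k2 by (intro divide_right_mono) auto
          then show ?thesis by simp
        qed
        ultimately have "finite K \<and> real (card K) \<le> 2 * ((12 * (R * w / M) + 2) * (4 * (11 / \<kappa>\<^sup>2) + 2))"
          using R(1) k2 by (intro both) auto
        moreover have "(12 * (R * w / M) + 2) * (4 * (11 / \<kappa>\<^sup>2) + 2) \<le> CA * M powr (1 - 2 * \<alpha>)"
        proof -
          \<comment> \<open>Here the exponent arises: \<open>R * w = R powr (1 - \<alpha>)\<close>,
            and \<open>R\<close> is at most \<open>M\<^sup>2 / \<kappa>\<^sup>2\<close>.\<close>
          have "R * w / M \<le> 1 / \<kappa>\<^sup>2 * M powr (1 - 2 * \<alpha>)"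
          proof -
            have "R * w = R powr (1 - \<alpha>)" using R(1) by (simp add: w_def powr_diff powr_minus divide_inverse)
            also have "\<dots> \<le> (M\<^sup>2 / \<kappa>\<^sup>2) powr (1 - \<alpha>)"
              using M2 R(1) k2 \<alpha> by (intro powr_mono2) (auto simp: pos_le_divide_eq mult.commute)
            also have "\<dots> = (M\<^sup>2) powr (1 - \<alpha>) * (1 / \<kappa>\<^sup>2) powr (1 - \<alpha>)"
              by (subst powr_mult[symmetric]) auto
            also have "(1 / \<kappa>\<^sup>2) powr (1 - \<alpha>) \<le> (1 / \<kappa>\<^sup>2) powr 1"
              using k2 \<alpha> by (intro powr_mono) auto
            also have "(1 / \<kappa>\<^sup>2) powr 1 = 1 / \<kappa>\<^sup>2" using k2 by simp
            also have "(M\<^sup>2) powr (1 - \<alpha>) = M * M powr (1 - 2 * \<alpha>)"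
            proof -
              have "(M\<^sup>2) powr (1 - \<alpha>) = M powr (2 * (1 - \<alpha>))" using M1 by (simp add: powr_powr flip: powr_numeral)
              also have "\<dots> = M powr (1 + (1 - 2 * \<alpha>))" by (simp add: algebra_simps)
              also have "\<dots> = M * M powr (1 - 2 * \<alpha>)" using M1 by (subst powr_add) simp
              finally show ?thesis .
            qed
            finally have "R * w \<le> M * M powr (1 - 2 * \<alpha>) * (1 / \<kappa>\<^sup>2)" by (simp add: mult_left_mono)
            then show ?thesis using M1 by (simp add: pos_divide_le_eq mult_ac)
          qed
          then have "12 * (R * w / M) + 2 \<le> (12 / \<kappa>\<^sup>2 + 2) * M powr (1 - 2 * \<alpha>)"
            using Mp by (simp add: distrib_right)
          then have "(12 * (R * w / M) + 2) * (4 * (11 / \<kappa>\<^sup>2) + 2) \<le> ((12 / \<kappa>\<^sup>2 + 2) * M powr (1 - 2 * \<alpha>)) * (4 * (11 / \<kappa>\<^sup>2) + 2)"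
            using k2 by (intro mult_right_mono) auto
          then show ?thesis by (simp add: CA_def mult_ac)
        qed
        moreover have "0 \<le> CB * M powr (1 - 2 * \<alpha>)" using CB by simp
        ultimately show ?thesis unfolding dist by linarith
      next
        case False
        \<comment> \<open>For \<open>M > R\<close> the strip has bounded width, but \<open>p\<close>
          may be short; the separation of \<open>k\<close> from \<open>- (k - m)\<close> now
          supplies the lower bound for \<open>u\<close>. The pieces have length of order
          \<open>sqrt R * w = R powr (1 / 2 - \<alpha>)\<close>.\<close>
        have f1: "\<kappa> * sqrt R / 2 \<le> \<bar>u k\<bar>" if k: "k \<in> K" for k
        proof -
          have "9 * R\<^sup>2 * w\<^sup>2 / M\<^sup>2 \<le> 9"
          proof -
            have "R\<^sup>2 * w\<^sup>2 \<le> M\<^sup>2 * 1" using False R(1) w by (intro mult_mono power_mono power_le_one) auto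
            then show ?thesis using M1 by (simp add: pos_divide_le_eq)
          qed
          then have "(p k \<bullet> n)\<^sup>2 \<le> 9" using pn2[OF k] by linarith
          moreover have "\<kappa>\<^sup>2 * R \<le> (norm (p k))\<^sup>2"
          proof -
            have "(\<kappa> * sqrt R)\<^sup>2 \<le> (norm (p k))\<^sup>2" using xn(5)[OF k] \<kappa> R by (intro power_mono) auto
            then show ?thesis using R by (simp add: power_mult_distrib)
          qed
          ultimately have "\<kappa>\<^sup>2 * R / 4 \<le> (u k)\<^sup>2" using pu[of k] R(2) by linarith
          then have "(\<kappa> * sqrt R / 2)\<^sup>2 \<le> (u k)\<^sup>2" using R(1) by (simp add: power_mult_distrib power_divide)
          then have "\<bar>\<kappa> * sqrt R / 2\<bar> \<le> \<bar>u k\<bar>" by (simp only: abs_le_square_iff)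
          then show ?thesis by linarith
        qed
        have f2: "21 * R * w / \<kappa>\<^sup>2 \<le> 2 * (\<kappa> * sqrt R / 2) * (21 * sqrt R * w / \<kappa> ^ 3)"
        proof -
          have "2 * (\<kappa> * sqrt R / 2) * (21 * sqrt R * w / \<kappa> ^ 3) = 21 * (sqrt R * sqrt R) * w / \<kappa>\<^sup>2"
            using \<kappa> by (simp add: power2_eq_square power3_eq_cube)
          also have "sqrt R * sqrt R = R" using R(1) by simp
          finally show ?thesis by simp
        qed
        have "finite K \<and> real (card K) \<le> 2 * ((12 * (R * w / M) + 2) * (4 * (21 * sqrt R * w / \<kappa> ^ 3) + 2))"
          by (rule both[OF _ f1 f2]) (use R(1) \<kappa> w in auto)
        moreover have "(12 * (R * w / M) + 2) * (4 * (21 * sqrt R * w / \<kappa> ^ 3) + 2) \<le> CB * M powr (1 - 2 * \<alpha>)"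
        proof -
          have "R * w \<le> M * 1" using False R(1) w by (intro mult_mono) auto
          then have "R * w / M \<le> 1" using M1 by (simp add: pos_divide_le_eq)
          then have A: "12 * (R * w / M) + 2 \<le> 14" by linarith
          have "sqrt R * w = R powr (1 / 2 - \<alpha>)" 
            using R(1) powr_add[of R "1 / 2" "- \<alpha>"] powr_half_sqrt[of R] unfolding w_def by simp
          also have "\<dots> \<le> M powr (1 / 2 - \<alpha>)" using False R(1) \<alpha> by (intro powr_mono2) auto
          also have "\<dots> \<le> M powr (1 - 2 * \<alpha>)" using M1 \<alpha> by (intro powr_mono) auto
          finally have "84 / \<kappa> ^ 3 * (sqrt R * w) \<le> 84 / \<kappa> ^ 3 * M powr (1 - 2 * \<alpha>)"
            using \<kappa> by (intro mult_left_mono) auto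
          then have B: "4 * (21 * sqrt R * w / \<kappa> ^ 3) + 2 \<le> (84 / \<kappa> ^ 3 + 2) * M powr (1 - 2 * \<alpha>)"
            using Mp by (simp add: distrib_right)
          have "(12 * (R * w / M) + 2) * (4 * (21 * sqrt R * w / \<kappa> ^ 3) + 2) \<le> 14 * ((84 / \<kappa> ^ 3 + 2) * M powr (1 - 2 * \<alpha>))"
            using R(1) \<kappa> w by (intro mult_mono A B) auto
          then show ?thesis unfolding CB_def mult.assoc .
        qed
        moreover have "0 \<le> CA * M powr (1 - 2 * \<alpha>)" using CA by simp
        ultimately show ?thesis unfolding dist by linarith
      qed
    qed
    then show "finite {k. lattice_point k \<in> annulus R \<alpha> \<and> lattice_point (k - m) \<in> annulus R \<alpha> \<and>
      \<kappa> * sqrt R \<le> norm (lattice_point m) \<and> \<kappa> * sqrt R \<le> norm (lattice_point k + lattice_point (k - m))}"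
      "real (card {k. lattice_point k \<in> annulus R \<alpha> \<and> lattice_point (k - m) \<in> annulus R \<alpha> \<and>
      \<kappa> * sqrt R \<le> norm (lattice_point m) \<and> \<kappa> * sqrt R \<le> norm (lattice_point k + lattice_point (k - m))})
      \<le> 2 * (CA + CB) * norm (lattice_point m) powr (1 - 2 * \<alpha>)"
      unfolding K_def M_def by auto
  qed
qed

section \<open>Uniqueness of Fourier coefficients\<close>

text \<open>On product spaces only Borel functions can be composed with translations, so that Lebesgue
  measurable functions are first replaced by Borel versions.\<close>

lemma borel_version_real:
  fixes f :: "real \<times> real \<Rightarrow> real"
  assumes "f \<in> borel_measurable torus"
  shows "\<exists>g. g \<in> borel_measurable borel \<and> (AE x in torus. f x = g x)"
proof -
  have "(\<lambda>x. indicator square x *\<^sub>R f x) \<in> borel_measurable lebesgue"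
    using assms square_lebesgue unfolding torus_def by (subst (asm) borel_measurable_restrict_space_iff) auto
  then obtain g where g: "g \<in> borel_measurable lborel" "AE x in lborel. indicator square x *\<^sub>R f x = g x"
    using completion_ex_borel_measurable_real by blast
  have "AE x in torus. f x = g x"
    by (rule ae_torus_from_lborel) (use g(2) in eventually_elim, auto simp: indicator_def)
  then show ?thesis using g(1) by auto
qed

lemma borel_version_complex:
  fixes f :: "real \<times> real \<Rightarrow> complex"
  assumes [measurable]: "f \<in> borel_measurable torus"
  shows "\<exists>g. g \<in> borel_measurable borel \<and> (AE x in torus. f x = g x)"
proof -
  have "(\<lambda>x. Re (f x)) \<in> borel_measurable torus" "(\<lambda>x. Im (f x)) \<in> borel_measurable torus"
    by measurable
  then obtain u v where [measurable]: "u \<in> borel_measurable borel" "v \<in> borel_measurable borel"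
    and ae: "AE x in torus. Re (f x) = u x" "AE x in torus. Im (f x) = v x"
    using borel_version_real by meson
  from ae have "AE x in torus. f x = of_real (u x) + \<i> * of_real (v x)"
    by eventually_elim (simp add: complex_eq_iff)
  moreover have "(\<lambda>x. of_real (u x) + \<i> * of_real (v x)) \<in> borel_measurable borel"
    by measurable
  ultimately show ?thesis by blast
qed

text \<open>The algebra of trigonometric polynomials without explicit spectra, so that closure under
  products and orthogonality follow by induction.\<close>

inductive trig_function :: "(real \<times> real \<Rightarrow> complex) \<Rightarrow> bool" where
  chr: "trig_function (chr k)"
| scale: "trig_function f \<Longrightarrow> trig_function (\<lambda>x. c * f x)"
| add: "trig_function f \<Longrightarrow> trig_function g \<Longrightarrow> trig_function (\<lambda>x. f x + g x)"

lemma trig_function_mult: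
  assumes "trig_function f" "trig_function g"
  shows "trig_function (\<lambda>x. f x * g x)"
  using assms
proof (induction f)
  case (chr k)
  then show ?case
  proof (induction g)
    case (chr l)
    show ?case using trig_function.chr[of "k + l"] by (simp add: chr_add_left[abs_def])
  next
    case (scale g c)
    then show ?case using trig_function.scale[of "\<lambda>x. chr k x * g x" c] by (simp add: mult.left_commute)
  next
    case (add f g)
    then show ?case using trig_function.add[of "\<lambda>x. chr k x * f x" "\<lambda>x. chr k x * g x"] by (simp add: distrib_left)
  qed
next
  case (scale f c)
  then show ?case using trig_function.scale[of "\<lambda>x. f x * g x" c] by (simp add: mult.assoc)
next
  case (add f1 f2)
  then show ?case using trig_function.add[of "\<lambda>x. f1 x * g x" "\<lambda>x. f2 x * g x"] by (simp add: distrib_right)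
qed

section \<open>From orthogonality to characters to vanishing almost everywhere\<close>

lemma integrable_mult_bounded:
  fixes h :: "real \<times> real \<Rightarrow> complex"
  assumes h: "integrable torus h" and f: "f \<in> borel_measurable torus" "\<And>x. norm (f x) \<le> B"
  shows "integrable torus (\<lambda>x. h x * f x)"
proof (rule Bochner_Integration.integrable_bound)
  show "integrable torus (\<lambda>x. of_real B * h x)" using h by simp
  show "(\<lambda>x. h x * f x) \<in> borel_measurable torus" using h f(1) by measurable
  show "AE x in torus. norm (h x * f x) \<le> norm (of_real B * h x)"
  proof (rule AE_I2)
    fix x
    have "norm (h x) * norm (f x) \<le> norm (h x) * \<bar>B\<bar>"
      using f(2)[of x] by (intro mult_left_mono) auto
    then show "norm (h x * f x) \<le> norm (of_real B * h x)" by (simp add: norm_mult mult.commute)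
  qed
qed

lemma trig_function_orthogonal:
  fixes h :: "real \<times> real \<Rightarrow> complex"
  assumes h: "integrable torus h" and z: "\<And>k. (LINT x|torus. h x * chr k x) = 0" and f: "trig_function f"
  shows "integrable torus (\<lambda>x. h x * f x) \<and> (LINT x|torus. h x * f x) = 0"
  using f
proof induction
  case (chr k)
  have "integrable torus (\<lambda>x. h x * chr k x)"
    by (rule integrable_mult_bounded[OF h, where B=1]) (auto intro: borel_measurable_torus)
  then show ?case using z by simp
next
  case (scale f c)
  then have "(\<lambda>x. h x * (c * f x)) = (\<lambda>x. c * (h x * f x))" by (simp add: fun_eq_iff mult_ac)
  then show ?case using scale by simp
next
  case (add f g)
  then show ?case by (simp add: distrib_left)
qed

text \<open>The torus as a product of two circles: a compact set, as Stone-Weierstrass demands, in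
  contrast to the half-open square.\<close>

definition torus_embed :: "real \<times> real \<Rightarrow> complex \<times> complex" where
  "torus_embed x = (cis (2 * pi * fst x), cis (2 * pi * snd x))"

lemma continuous_torus_embed: "continuous_on A torus_embed"
  unfolding torus_embed_def by (intro continuous_intros)

lemma inj_on_torus_embed: "inj_on torus_embed square"
proof (rule inj_onI)
  fix x y assume xy: "x \<in> square" "y \<in> square" "torus_embed x = torus_embed y"
  have one: "s = t" if "s \<in> {0..<1}" "t \<in> {0..<1}" "cis (2 * pi * s) = cis (2 * pi * t)" for s t :: real
  proof -
    have "\<bar>s - t\<bar> < 1" using that by auto
    then have "2 * pi * \<bar>s - t\<bar> < 2 * pi * 1" by (intro mult_strict_left_mono) auto
    moreover have "2 * pi * s - 2 * pi * t = 2 * pi * (s - t)" by (simp add: algebra_simps)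
    ultimately have "\<bar>2 * pi * s - 2 * pi * t\<bar> < 2 * pi" by (simp add: abs_mult)
    then have "2 * pi * s = 2 * pi * t" by (rule cis_inj_of_close) (rule that(3))
    then show ?thesis by simp
  qed
  show "x = y"
    using xy one[of "fst x" "fst y"] one[of "snd x" "snd y"]
    by (auto simp: torus_embed_def prod_eq_iff)
qed

lemma trig_function_coordinates:
  "trig_function (\<lambda>x. complex_of_real (Re (fst (torus_embed x))))"
  "trig_function (\<lambda>x. complex_of_real (Im (fst (torus_embed x))))"
  "trig_function (\<lambda>x. complex_of_real (Re (snd (torus_embed x))))"
  "trig_function (\<lambda>x. complex_of_real (Im (snd (torus_embed x))))"
proof -
  have re: "trig_function (\<lambda>x. complex_of_real (Re (chr k x)))" for k
  proof -
    have "trig_function (\<lambda>x. 1 / 2 * chr k x + 1 / 2 * chr (- k) x)"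
      by (intro trig_function.intros)
    also have "(\<lambda>x. 1 / 2 * chr k x + 1 / 2 * chr (- k) x) = (\<lambda>x. complex_of_real (Re (chr k x)))"
      by (auto simp: fun_eq_iff complex_eq_iff cnj_chr[symmetric])
    finally show ?thesis .
  qed
  have im: "trig_function (\<lambda>x. complex_of_real (Im (chr k x)))" for k
  proof -
    have "trig_function (\<lambda>x. - \<i> / 2 * chr k x + \<i> / 2 * chr (- k) x)"
      by (intro trig_function.intros)
    also have "(\<lambda>x. - \<i> / 2 * chr k x + \<i> / 2 * chr (- k) x) = (\<lambda>x. complex_of_real (Im (chr k x)))"
      by (auto simp: fun_eq_iff complex_eq_iff cnj_chr[symmetric])
    finally show ?thesis .
  qed
  have "fst (torus_embed x) = chr (1, 0) x" "snd (torus_embed x) = chr (0, 1) x" for x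
    by (cases x; simp add: torus_embed_def chr_def lattice_point_def)+
  then show "trig_function (\<lambda>x. complex_of_real (Re (fst (torus_embed x))))"
    "trig_function (\<lambda>x. complex_of_real (Im (fst (torus_embed x))))"
    "trig_function (\<lambda>x. complex_of_real (Re (snd (torus_embed x))))"
    "trig_function (\<lambda>x. complex_of_real (Im (snd (torus_embed x))))"
    using re im by simp_all
qed

text \<open>On the product of two circles the real and imaginary parts of the coordinates separate
  points and pull back to trigonometric polynomials. By Stone-Weierstrass \<open>\<phi>\<close> is a
  uniform limit of functions with pullbacks orthogonal to \<open>h\<close>.\<close>

lemma continuous_orthogonal:
  fixes h :: "real \<times> real \<Rightarrow> complex" and \<phi> :: "complex \<times> complex \<Rightarrow> real"
  assumes h: "integrable torus h" and z: "\<And>k. (LINT x|torus. h x * chr k x) = 0"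
    and \<phi>: "continuous_on UNIV \<phi>" and bd: "\<And>z. \<bar>\<phi> z\<bar> \<le> B"
  shows "(LINT x|torus. h x * of_real (\<phi> (torus_embed x))) = 0"
proof -
  define S where "S = sphere (0::complex) 1 \<times> sphere (0::complex) 1"
  define P where "P g \<longleftrightarrow> continuous_on S g \<and> trig_function (\<lambda>x. complex_of_real (g (torus_embed x)))" for g
  have one: "trig_function (\<lambda>x. c)" for c
    using trig_function.scale[OF trig_function.chr[of 0], of c] by simp
  have S: "torus_embed x \<in> S" for x by (simp add: S_def torus_embed_def)
  have phim[measurable]: "(\<lambda>x. complex_of_real (\<phi> (torus_embed x))) \<in> borel_measurable torus"
    by (intro borel_measurable_torus borel_measurable_continuous_onI continuous_intros
        continuous_on_compose2[OF \<phi>] continuous_torus_embed) auto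
  have int: "integrable torus (\<lambda>x. h x * of_real (\<phi> (torus_embed x)))"
    by (rule integrable_mult_bounded[OF h, where B=B]) (use bd in auto)
  have approx: "norm (LINT x|torus. h x * of_real (\<phi> (torus_embed x))) \<le> e * (LINT x|torus. norm (h x))" if e: "0 < e" for e
  proof -
    have "\<exists>g. P g \<and> (\<forall>x\<in>S. \<bar>\<phi> x - g x\<bar> < e)"
    proof (rule Stone_Weierstrass_HOL[where S=S])
      show "compact S" by (simp add: S_def compact_Times)
      show "P (\<lambda>x. c)" for c by (simp add: P_def one)
      show "continuous_on S f" if "P f" for f using that by (simp add: P_def)
      show "P (\<lambda>x. f x + g x)" if "P f \<and> P g" for f g
        using that by (auto simp: P_def intro!: continuous_intros trig_function.add)
      show "P (\<lambda>x. f x * g x)" if "P f \<and> P g" for f g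
        using that by (auto simp: P_def intro!: continuous_intros trig_function_mult)
      show "\<exists>f. P f \<and> f x \<noteq> f y" if "x \<in> S \<and> y \<in> S \<and> x \<noteq> y" for x y
      proof -
        have "P (\<lambda>z. Re (fst z))" "P (\<lambda>z. Im (fst z))" "P (\<lambda>z. Re (snd z))" "P (\<lambda>z. Im (snd z))"
          unfolding P_def by (auto intro!: continuous_intros trig_function_coordinates)
        moreover have "Re (fst x) \<noteq> Re (fst y) \<or> Im (fst x) \<noteq> Im (fst y) \<or> Re (snd x) \<noteq> Re (snd y) \<or> Im (snd x) \<noteq> Im (snd y)"
          using that by (auto simp: prod_eq_iff complex_eq_iff)
        ultimately show ?thesis by blast
      qed
      show "continuous_on S \<phi>" using \<phi> continuous_on_subset by blast
    qed (rule e)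
    then obtain g where g: "P g" "\<And>x. x \<in> S \<Longrightarrow> \<bar>\<phi> x - g x\<bar> < e" by blast
    have og: "integrable torus (\<lambda>x. h x * of_real (g (torus_embed x)))" "(LINT x|torus. h x * of_real (g (torus_embed x))) = 0"
      using trig_function_orthogonal[OF h z, of "\<lambda>x. complex_of_real (g (torus_embed x))"] g(1) by (auto simp: P_def)
    have "(LINT x|torus. h x * of_real (\<phi> (torus_embed x))) = (LINT x|torus. h x * of_real (\<phi> (torus_embed x)) - h x * of_real (g (torus_embed x)))"
      using int og by simp
    also have "norm \<dots> \<le> (LINT x|torus. norm (h x * of_real (\<phi> (torus_embed x)) - h x * of_real (g (torus_embed x))))"
      by (rule integral_norm_bound)
    also have "\<dots> \<le> (LINT x|torus. e * norm (h x))"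
    proof (rule integral_mono)
      show "integrable torus (\<lambda>x. norm (h x * of_real (\<phi> (torus_embed x)) - h x * of_real (g (torus_embed x))))"
        using int og by simp
      show "integrable torus (\<lambda>x. e * norm (h x))" using h by simp
      fix x
      have "norm (h x * of_real (\<phi> (torus_embed x)) - h x * of_real (g (torus_embed x))) = norm (h x) * \<bar>\<phi> (torus_embed x) - g (torus_embed x)\<bar>"
        by (simp only: right_diff_distrib[symmetric] norm_mult of_real_diff[symmetric] norm_of_real real_norm_def)
      also have "\<dots> \<le> norm (h x) * e" by (rule mult_left_mono[OF less_imp_le[OF g(2)[OF S]]]) simp
      finally show "norm (h x * of_real (\<phi> (torus_embed x)) - h x * of_real (g (torus_embed x))) \<le> e * norm (h x)" by (simp add: mult.commute)
    qed
    finally show ?thesis by simp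
  qed
  define H where "H = (LINT x|torus. norm (h x))"
  have H: "0 \<le> H" by (simp add: H_def)
  have "norm (LINT x|torus. h x * of_real (\<phi> (torus_embed x))) \<le> 0"
  proof (rule field_le_epsilon)
    fix e :: real assume e: "0 < e"
    have "0 < e / (H + 1)" using e H by simp
    then have "norm (LINT x|torus. h x * of_real (\<phi> (torus_embed x))) \<le> e / (H + 1) * H"
      by (rule approx[folded H_def])
    also have "\<dots> \<le> e" using e H by (simp add: field_simps)
    finally show "norm (LINT x|torus. h x * of_real (\<phi> (torus_embed x))) \<le> 0 + e" by simp
  qed
  then show ?thesis by simp
qed

text \<open>Dominated convergence with majorant \<open>|h|\<close>. It carries orthogonality from
  continuous functions to compact sets, from these to closed sets, and through disjoint
  unions.\<close>

lemma integral_torus_indicator_limit: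
  fixes h :: "real \<times> real \<Rightarrow> complex" and s :: "nat \<Rightarrow> real \<times> real \<Rightarrow> real"
  assumes h: "integrable torus h" and s: "\<And>n. s n \<in> borel_measurable torus" "\<And>n x. \<bar>s n x\<bar> \<le> 1"
    and z: "\<And>n. (LINT x|torus. h x * of_real (s n x)) = 0"
    and lim: "\<And>x. x \<in> square \<Longrightarrow> (\<lambda>n. s n x) \<longlonglongrightarrow> t x" and t: "t \<in> borel_measurable torus"
  shows "(LINT x|torus. h x * of_real (t x)) = 0"
proof -
  have [measurable]: "h \<in> borel_measurable torus" using h by simp
  note s(1)[measurable] t[measurable]
  have "(\<lambda>n. LINT x|torus. h x * of_real (s n x)) \<longlonglongrightarrow> (LINT x|torus. h x * of_real (t x))"
  proof (rule integral_dominated_convergence[where w="\<lambda>x. norm (h x)"])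
    show "integrable torus (\<lambda>x. norm (h x))" using h by simp
    show "AE x in torus. (\<lambda>n. h x * of_real (s n x)) \<longlonglongrightarrow> h x * of_real (t x)"
      by (intro AE_I2 tendsto_intros lim) (simp add: space_torus)
    show "AE x in torus. norm (h x * of_real (s n x)) \<le> norm (h x)" for n
      using s(2)[of n] by (intro AE_I2) (simp add: norm_mult mult_left_le)
  qed measurable
  then have "(\<lambda>n. 0) \<longlonglongrightarrow> (LINT x|torus. h x * of_real (t x))" unfolding z .
  then show ?thesis using LIMSEQ_unique tendsto_const by blast
qed

text \<open>A function orthogonal to all characters integrates to zero over every Borel set, by
  approximation and the Dynkin argument. Testing with the sets where its real or imaginary part has
  a fixed sign forces it to vanish.\<close>

lemma fourier_unique:
  fixes h :: "real \<times> real \<Rightarrow> complex"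
  assumes h: "integrable torus h" and z: "\<And>k. fourier_coeff h k = 0"
  shows "AE x in torus. h x = 0"
proof -
  have zc: "(LINT x|torus. h x * chr k x) = 0" for k
    using z[of "- k"] by (simp add: fourier_coeff_chr)
  have bt: "A \<in> sets borel \<Longrightarrow> (\<lambda>x. indicat_real A x) \<in> borel_measurable torus" for A
    by (rule borel_measurable_torus) simp
  have compact0: "(LINT x|torus. h x * of_real (indicator C x)) = 0" if C: "compact C" "C \<subseteq> square" for C
  proof (cases "C = {}")
    case False
    define K where "K = torus_embed ` C"
    have K: "closed K" "K \<noteq> {}"
      using C False by (auto simp: K_def intro!: compact_imp_closed compact_continuous_image continuous_torus_embed)
    \<comment> \<open>Tents around the image of \<open>C\<close>. They converge to the indicator of
      \<open>C\<close> on the square because the embedding is injective there, so points off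
      \<open>C\<close> have positive distance from \<open>K\<close>.\<close>
    define \<phi> where "\<phi> n y = max 0 (1 - real n * infdist y K)" for n :: nat and y
    have phi_cont: "continuous_on UNIV (\<phi> n)" for n
      unfolding \<phi>_def by (intro continuous_intros)
    have phi_bd: "\<bar>\<phi> n y\<bar> \<le> 1" for n y
      using infdist_nonneg[of y K] by (simp add: \<phi>_def)
    show ?thesis
    proof (rule integral_torus_indicator_limit[OF h, where s="\<lambda>n x. \<phi> n (torus_embed x)"])
      show "(\<lambda>x. \<phi> n (torus_embed x)) \<in> borel_measurable torus" for n
        by (intro borel_measurable_torus borel_measurable_continuous_onI
            continuous_on_compose2[OF phi_cont] continuous_torus_embed) auto
      show "(LINT x|torus. h x * of_real (\<phi> n (torus_embed x))) = 0" for n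
        by (rule continuous_orthogonal[OF h zc phi_cont phi_bd])
      show "\<bar>\<phi> n (torus_embed x)\<bar> \<le> 1" for n x by (rule phi_bd)
      show "(\<lambda>n. \<phi> n (torus_embed x)) \<longlonglongrightarrow> indicat_real C x" if x: "x \<in> square" for x
      proof (cases "x \<in> C")
        case True
        then have "infdist (torus_embed x) K = 0" using K by (auto simp: K_def)
        then show ?thesis using True by (simp add: \<phi>_def)
      next
        case False
        then have "torus_embed x \<notin> K"
          using inj_on_torus_embed x C(2) unfolding K_def by (auto dest: inj_onD)
        then have d: "0 < infdist (torus_embed x) K"
          using in_closed_iff_infdist_zero[OF K, of "torus_embed x"] infdist_nonneg[of "torus_embed x" K] by linarith
        obtain n0 :: nat where "1 / infdist (torus_embed x) K < real n0" using reals_Archimedean2 by blast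
        then have n0: "1 < real n0 * infdist (torus_embed x) K" using d by (simp add: pos_divide_less_eq)
        have "\<phi> n (torus_embed x) = 0" if "n0 \<le> n" for n
        proof -
          have "real n0 * infdist (torus_embed x) K \<le> real n * infdist (torus_embed x) K"
            using that d by (intro mult_right_mono) auto
          then show ?thesis using n0 by (simp add: \<phi>_def)
        qed
        then have "\<forall>\<^sub>F n in sequentially. \<phi> n (torus_embed x) = 0" by (auto simp: eventually_sequentially)
        then show ?thesis using False by (simp add: tendsto_eventually)
      qed
      show "indicat_real C \<in> borel_measurable torus" using bt[of C] compact_imp_closed[OF C(1)] by auto
    qed
  qed simp
  \<comment> \<open>The boxes with upper corner \<open>1 - 1 / (n + 1)\<close> exhaust the half-open
    square from inside and make the intersection with \<open>C\<close> compact.\<close>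
  have closed0: "(LINT x|torus. h x * of_real (indicator C x)) = 0" if C: "closed C" for C
  proof (rule integral_torus_indicator_limit[OF h, where s="\<lambda>n. indicator (C \<inter> cbox (0, 0) (1 - 1 / real (Suc n), 1 - 1 / real (Suc n)))"])
    fix n
    let ?D = "C \<inter> cbox (0, 0) (1 - 1 / real (Suc n), 1 - 1 / real (Suc n))"
    have D: "compact ?D" using C by (intro closed_Int_compact) auto
    show "indicat_real ?D \<in> borel_measurable torus" using bt[of ?D] compact_imp_closed[OF D] by auto
    have lt: "1 - 1 / real (Suc n) < 1" by simp
    have "?D \<subseteq> square" by (auto simp: cbox_Pair_eq simp del: of_nat_Suc intro: le_less_trans[OF _ lt])
    then show "(LINT x|torus. h x * of_real (indicator ?D x)) = 0" by (rule compact0[OF D])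
    show "\<bar>indicat_real ?D x\<bar> \<le> 1" for x by (simp add: indicator_def)
  next
    show "indicat_real C \<in> borel_measurable torus" using bt[of C] C by auto
    fix x :: "real \<times> real" assume x: "x \<in> square"
    define e where "e = min (1 - fst x) (1 - snd x)"
    have "0 < e" using x by (auto simp: e_def)
    then obtain n0 where "inverse (real (Suc n0)) < e" using reals_Archimedean by blast
    then have n0: "1 / real (Suc n0) < e" by (simp only: inverse_eq_divide)
    have "x \<in> cbox (0, 0) (1 - 1 / real (Suc n), 1 - 1 / real (Suc n))" if "n0 \<le> n" for n
    proof -
      have "1 / real (Suc n) \<le> 1 / real (Suc n0)" using that by (intro divide_left_mono) auto
      then have "1 / real (Suc n) < e" using n0 by linarith
      then show ?thesis using x by (cases x) (auto simp: e_def cbox_Pair_eq simp del: of_nat_Suc)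
    qed
    then have "\<forall>\<^sub>F n in sequentially. indicator (C \<inter> cbox (0, 0) (1 - 1 / real (Suc n), 1 - 1 / real (Suc n))) x = indicat_real C x"
      by (auto simp: eventually_sequentially indicator_def simp del: of_nat_Suc)
    then show "(\<lambda>n. indicator (C \<inter> cbox (0, 0) (1 - 1 / real (Suc n), 1 - 1 / real (Suc n))) x) \<longlonglongrightarrow> indicat_real C x"
      by (rule tendsto_eventually)
  qed
  have int_ind: "integrable torus (\<lambda>x. h x * of_real (indicator A x))" if "A \<in> sets borel" for A
    by (rule integrable_mult_bounded[OF h, where B=1])
      (use bt[OF that] in \<open>auto simp: indicator_def\<close>)
  have borel0: "(LINT x|torus. h x * of_real (indicator A x)) = 0" if "A \<in> sets borel" for A
  proof -
    have "Int_stable (Collect (closed :: (real \<times> real) set \<Rightarrow> bool))"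
      by (auto simp: Int_stable_def)
    moreover have "Collect closed \<subseteq> Pow (UNIV :: (real \<times> real) set)" by auto
    moreover have "A \<in> sigma_sets UNIV (Collect closed)"
      using that by (simp add: borel_eq_closed)
    ultimately show ?thesis
    proof (induction rule: sigma_sets_induct_disjoint)
      case (basic A)
      then show ?case using closed0 by simp
    next
      case empty
      then show ?case by simp
    next
      case (compl A)
      have A: "A \<in> sets borel" using compl by (simp add: borel_eq_closed)
      have "(\<lambda>x. h x * of_real (indicator (UNIV - A) x)) = (\<lambda>x. h x * of_real (indicator UNIV x) - h x * of_real (indicator A x))"
        by (auto simp: indicator_def fun_eq_iff)
      then show ?case
        using compl int_ind[OF A] int_ind[of UNIV] closed0[of UNIV] by simp
    next
      case (union A)
      have A: "A n \<in> sets borel" for n using union by (auto simp: borel_eq_closed)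
      then have UA: "(\<Union>n. A n) \<in> sets borel" by auto
      have sum_ind: "(\<Sum>i<n. indicat_real (A i) x) = indicator (\<Union>i<n. A i) x" for n x
        using union(1) by (subst indicator_UN_disjoint) (auto simp: disjoint_family_on_def)
      show ?case
      proof (rule integral_torus_indicator_limit[OF h, where s="\<lambda>n x. \<Sum>i<n. indicator (A i) x"])
        fix n
        show "(\<lambda>x. \<Sum>i<n. indicat_real (A i) x) \<in> borel_measurable torus"
          using bt[OF A] by simp
        show "(LINT x|torus. h x * of_real (\<Sum>i<n. indicator (A i) x)) = 0"
          using union(3) int_ind[OF A] by (simp add: sum_distrib_left)
        show "\<bar>\<Sum>i<n. indicat_real (A i) x\<bar> \<le> 1" for x
          unfolding sum_ind by (simp add: indicator_def)
      next
        show "indicat_real (\<Union>n. A n) \<in> borel_measurable torus" using bt[OF UA] by simp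
        fix x :: "real \<times> real"
        show "(\<lambda>n. \<Sum>i<n. indicat_real (A i) x) \<longlonglongrightarrow> indicat_real (\<Union>n. A n) x"
          unfolding sum_ind by (rule LIMSEQ_indicator_UN)
      qed
    qed
  qed
  \<comment> \<open>The sets of fixed sign must be Borel to be covered by \<open>borel0\<close>,
    hence the passage to a Borel version.\<close>
  obtain g where [measurable]: "g \<in> borel_measurable borel" and hg: "AE x in torus. h x = g x"
    using borel_version_complex[OF borel_measurable_integrable[OF h]] by blast
  note bmt = borel_measurable_torus[OF \<open>g \<in> borel_measurable borel\<close>]
  have intg: "integrable torus g"
    using h hg bmt integrable_cong_AE[of h torus g] by auto
  have g0: "(LINT x|torus. g x * of_real (indicator A x)) = 0" if A: "A \<in> sets borel" for A
  proof -
    have [measurable]: "(\<lambda>x. indicat_real A x) \<in> borel_measurable torus" "h \<in> borel_measurable torus" "g \<in> borel_measurable torus"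
      using bt[OF A] h bmt by auto
    have "(LINT x|torus. g x * of_real (indicator A x)) = (LINT x|torus. h x * of_real (indicator A x))"
    proof (rule integral_cong_AE)
      show "AE x in torus. g x * of_real (indicator A x) = h x * of_real (indicator A x)"
        using hg by eventually_elim simp
    qed measurable
    then show ?thesis using borel0[OF A] by simp
  qed
  have ig: "integrable torus (\<lambda>x. g x * of_real (indicator A x))" if "A \<in> sets borel" for A
    by (rule integrable_mult_bounded[OF intg, where B=1])
      (use bt[OF that] in \<open>auto simp: indicator_def\<close>)
  have real0: "AE x in torus. L (g x) = 0" if L: "bounded_linear L" for L :: "complex \<Rightarrow> real"
  proof -
    have [measurable]: "L \<in> borel_measurable borel"
      by (intro borel_measurable_continuous_onI linear_continuous_on L)
    \<comment> \<open>On the set where it is positive, \<open>\<sigma> * L (g x)\<close> has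
      integral zero and therefore vanishes almost everywhere; both signs of \<open>\<sigma>\<close>
      together give \<open>L (g x) = 0\<close>.\<close>
    have half: "AE x in torus. \<not> 0 < \<sigma> * L (g x)" for \<sigma> :: real
    proof -
      define A where "A = {x. 0 < \<sigma> * L (g x)}"
      have A: "A \<in> sets borel" unfolding A_def by measurable
      have e: "\<sigma> * L (g x * of_real (indicator A x)) = \<sigma> * L (g x) * indicator A x" for x
        by (cases "x \<in> A") (simp_all add: linear_simps[OF L])
      have i: "integrable torus (\<lambda>x. \<sigma> * L (g x) * indicator A x)"
        using integrable_mult_right[OF integrable_bounded_linear[OF L ig[OF A]], of \<sigma>] unfolding e .
      have "(LINT x|torus. \<sigma> * L (g x) * indicator A x) = \<sigma> * L (LINT x|torus. g x * of_real (indicator A x))"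
        unfolding e[symmetric] integral_mult_right_zero integral_bounded_linear[OF L ig[OF A]] ..
      also have "\<dots> = 0" by (simp add: g0[OF A] linear_simps[OF L])
      finally have "AE x in torus. \<sigma> * L (g x) * indicator A x = 0"
        using integral_nonneg_eq_0_iff_AE[OF i] by (auto simp: A_def indicator_def)
      then show ?thesis
        by eventually_elim (auto simp: A_def indicator_def split: if_splits)
    qed
    show ?thesis using half[of 1] half[of "-1"] by eventually_elim simp
  qed
  show ?thesis
    using real0[OF bounded_linear_Re] real0[OF bounded_linear_Im] hg
    by eventually_elim (simp add: complex_eq_iff)
qed

section \<open>Reduction to trigonometric polynomials\<close>

lemma L2_torus_integrable:
  assumes "f \<in> L2_torus"
  shows "integrable torus f"
proof (rule Bochner_Integration.integrable_bound)
  have "integrable torus (\<lambda>x. 1 :: real)"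
    by (rule integrable_torus_bounded[where B=1]) auto
  then show "integrable torus (\<lambda>x. 1 + (norm (f x))\<^sup>2)"
    using assms by (intro Bochner_Integration.integrable_add) (auto simp: L2_torus_def)
  show "f \<in> borel_measurable torus" using assms by (simp add: L2_torus_def)
  show "AE x in torus. norm (f x) \<le> norm (1 + (norm (f x))\<^sup>2)"
  proof (rule AE_I2)
    fix x
    have "0 \<le> (norm (f x) - 1)\<^sup>2" by simp
    then have "2 * norm (f x) \<le> 1 + (norm (f x))\<^sup>2" by (simp add: power2_diff)
    moreover have "0 \<le> norm (f x)" by simp
    ultimately have "norm (f x) \<le> 1 + (norm (f x))\<^sup>2" by linarith
    then show "norm (f x) \<le> norm (1 + (norm (f x))\<^sup>2)" by simp
  qed
qed

lemma L2_torus_finite_spectrum: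
  assumes f: "f \<in> L2_torus" and S: "finite S" "\<And>k. k \<notin> S \<Longrightarrow> fourier_coeff f k = 0"
  shows "AE x in torus. f x = trig_poly S (fourier_coeff f) x"
proof -
  have int: "integrable torus f" using L2_torus_integrable[OF f] .
  have tpi: "integrable torus (trig_poly S (fourier_coeff f))"
    by (rule integrable_torus_bounded[OF _ norm_trig_poly_le]) (rule borel_measurable_torus, measurable)
  have "AE x in torus. f x - trig_poly S (fourier_coeff f) x = 0"
  proof (rule fourier_unique)
    show "integrable torus (\<lambda>x. f x - trig_poly S (fourier_coeff f) x)" using int tpi by simp
    fix k
    have c: "chr m \<in> borel_measurable torus" for m by (rule borel_measurable_torus) measurable
    have i1: "integrable torus (\<lambda>x. f x * chr (- k) x)"
      by (rule integrable_mult_bounded[OF int, where B=1]) (auto intro: c)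
    have i2: "integrable torus (\<lambda>x. fourier_coeff f l * chr (l - k) x)" for l
      by (intro integrable_mult_right integrable_torus_bounded[where B=1]) (auto intro: c)
    have "(LINT x|torus. trig_poly S (fourier_coeff f) x * chr (- k) x) = (LINT x|torus. (\<Sum>l\<in>S. fourier_coeff f l * chr (l - k) x))"
      by (simp add: trig_poly_def sum_distrib_right mult.assoc flip: chr_add_left)
    also have "\<dots> = (\<Sum>l\<in>S. if l = k then fourier_coeff f l else 0)"
      by (subst Bochner_Integration.integral_sum) (auto intro!: sum.cong simp: i2 integral_chr)
    also have "\<dots> = fourier_coeff f k" using S by (simp add: sum.delta)
    finally have e: "(LINT x|torus. trig_poly S (fourier_coeff f) x * chr (- k) x) = fourier_coeff f k" .
    have i3: "integrable torus (\<lambda>x. trig_poly S (fourier_coeff f) x * chr (- k) x)"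
      by (rule integrable_mult_bounded[OF tpi, where B=1]) (auto intro: c)
    have "fourier_coeff (\<lambda>x. f x - trig_poly S (fourier_coeff f) x) k = (LINT x|torus. f x * chr (- k) x) - (LINT x|torus. trig_poly S (fourier_coeff f) x * chr (- k) x)"
      unfolding fourier_coeff_chr[of "\<lambda>x. f x - trig_poly S (fourier_coeff f) x"] left_diff_distrib by (rule Bochner_Integration.integral_diff[OF i1 i3])
    then show "fourier_coeff (\<lambda>x. f x - trig_poly S (fourier_coeff f) x) k = 0"
      by (simp add: e) (simp add: fourier_coeff_chr)
  qed
  then show ?thesis by eventually_elim simp
qed

section \<open>The observability estimate\<close>

lemma finite_lattice_ball: "finite {k. norm (lattice_point k) \<le> B}"
proof (rule finite_subset)
  show "{k. norm (lattice_point k) \<le> B} \<subseteq> {- \<lceil>B\<rceil>..\<lceil>B\<rceil>} \<times> {- \<lceil>B\<rceil>..\<lceil>B\<rceil>}"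
  proof
    fix k assume "k \<in> {k. norm (lattice_point k) \<le> B}"
    then have B: "norm (lattice_point k) \<le> B" by simp
    obtain i j where k: "k = (i, j)" by (cases k)
    have "\<bar>real_of_int i\<bar> \<le> B" "\<bar>real_of_int j\<bar> \<le> B"
      using B norm_fst_le[of "real_of_int i" "real_of_int j"] norm_snd_le[of "real_of_int j" "real_of_int i"]
      by (auto simp: k lattice_point_def)
    then have "\<bar>i\<bar> \<le> \<lceil>B\<rceil>" "\<bar>j\<bar> \<le> \<lceil>B\<rceil>" by linarith+
    then show "k \<in> {- \<lceil>B\<rceil>..\<lceil>B\<rceil>} \<times> {- \<lceil>B\<rceil>..\<lceil>B\<rceil>}" by (auto simp: k)
  qed
qed simp

lemma annulus_norm:
  assumes "1 \<le> R" "0 \<le> \<alpha>" "x \<in> annulus R \<alpha>"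
  shows "R \<le> norm x" "norm x \<le> R + 1"
proof -
  have "R powr (- \<alpha>) \<le> R powr 0" using assms by (intro powr_mono) auto
  then show "R \<le> norm x" "norm x \<le> R + 1" using assms by (auto simp: annulus_def)
qed

text \<open>The upper bound is Cauchy-Schwarz. For the lower one, \<open>2 * (x \<bullet> y)\<close>
  is at least \<open>2 * norm x * norm y - (norm (x - y))\<^sup>2\<close>, and half of
  \<open>144 * R\<close> divided by \<open>norm y\<close> is at most 72. This is the height of an
  arc with chord of order \<open>sqrt R\<close>.\<close>

lemma cap_frequency:
  fixes x y :: "real \<times> real"
  assumes R: "1 \<le> R" and x: "R \<le> norm x" "norm x \<le> R + 1" and y: "R \<le> norm y" and d: "norm (x - y) \<le> 12 * sqrt R"
  shows "\<bar>x \<bullet> ((1 / norm y) *\<^sub>R y) - R\<bar> \<le> 72"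
proof -
  have y0: "0 < norm y" using R y by linarith
  have "x \<bullet> y \<le> norm x * norm y" by (rule norm_cauchy_schwarz)
  then have up: "x \<bullet> ((1 / norm y) *\<^sub>R y) \<le> norm x" using y0 by (simp add: pos_divide_le_eq)
  have "(norm (x - y))\<^sup>2 \<le> (12 * sqrt R)\<^sup>2" using d by (intro power_mono) auto
  also have "\<dots> = 144 * R" using R by (simp add: power_mult_distrib)
  finally have "(norm x)\<^sup>2 + (norm y)\<^sup>2 - 2 * (x \<bullet> y) \<le> 144 * R"
    by (simp add: power2_norm_eq_inner inner_diff_left inner_diff_right inner_commute[of y x])
  moreover have "0 \<le> (norm x - norm y)\<^sup>2" by simp
  ultimately have "2 * (norm x * norm y) - 144 * R \<le> 2 * (x \<bullet> y)" by (simp add: power2_diff)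
  moreover have "144 * R \<le> 144 * norm y" using y by simp
  ultimately have "(norm x - 72) * norm y \<le> x \<bullet> y" by (simp add: left_diff_distrib)
  then have "norm x - 72 \<le> x \<bullet> ((1 / norm y) *\<^sub>R y)" using y0 by (simp add: pos_le_divide_eq)
  then show ?thesis using up x by (simp add: abs_le_iff)
qed

text \<open>Cauchy-Schwarz over pairs: the products \<open>|a k|\<^sup>2 * |a l|\<^sup>2\<close>
  summed over all of \<open>S \<times> S\<close> give the square of the mass, so only the
  coefficients of \<open>w\<close> see the restriction to \<open>P\<close>.\<close>

lemma off_diagonal_bound:
  fixes a w :: "'a::ab_group_add \<Rightarrow> complex"
  assumes S: "finite S" and P: "P \<subseteq> S \<times> S"
  shows "norm (\<Sum>p\<in>P. a (fst p) * cnj (a (snd p)) * w (snd p - fst p))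
    \<le> (\<Sum>k\<in>S. (norm (a k))\<^sup>2) * sqrt (\<Sum>p\<in>P. (norm (w (snd p - fst p)))\<^sup>2)"
proof -
  let ?x = "\<lambda>p. norm (a (fst p)) * norm (a (snd p))" and ?y = "\<lambda>p. norm (w (snd p - fst p))"
  let ?X = "\<Sum>k\<in>S. (norm (a k))\<^sup>2"
  have "norm (\<Sum>p\<in>P. a (fst p) * cnj (a (snd p)) * w (snd p - fst p)) \<le> (\<Sum>p\<in>P. ?x p * ?y p)"
    by (rule sum_norm_le) (simp add: norm_mult)
  also have "\<dots> \<le> sqrt ((\<Sum>p\<in>P. (?x p)\<^sup>2) * (\<Sum>p\<in>P. (?y p)\<^sup>2))"
    by (rule real_le_rsqrt) (rule Cauchy_Schwarz_ineq_sum)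
  also have "\<dots> \<le> sqrt (?X\<^sup>2 * (\<Sum>p\<in>P. (?y p)\<^sup>2))"
  proof (intro real_sqrt_le_mono mult_right_mono)
    have "(\<Sum>p\<in>P. (?x p)\<^sup>2) \<le> (\<Sum>p\<in>S \<times> S. (?x p)\<^sup>2)"
      using S P by (intro sum_mono2) auto
    also have "\<dots> = ?X\<^sup>2"
      by (simp add: power2_eq_square[of ?X] sum_product power_mult_distrib sum.cartesian_product split_def)
    finally show "(\<Sum>p\<in>P. (?x p)\<^sup>2) \<le> ?X\<^sup>2" .
  qed (simp add: sum_nonneg)
  also have "\<dots> = ?X * sqrt (\<Sum>p\<in>P. (?y p)\<^sup>2)"
    by (simp add: real_sqrt_mult sum_nonneg)
  finally show ?thesis .
qed

lemma summable_tail: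
  fixes f :: "'a \<Rightarrow> real"
  assumes "f summable_on UNIV" "\<And>x. 0 \<le> f x" "0 < e"
  shows "\<exists>F. finite F \<and> (\<forall>G. finite G \<and> G \<inter> F = {} \<longrightarrow> sum f G \<le> e)"
proof -
  have hs: "(f has_sum infsum f UNIV) UNIV" using assms(1) by (simp add: summable_iff_has_sum_infsum)
  then have "\<forall>\<^sub>F F in finite_subsets_at_top UNIV. dist (sum f F) (infsum f UNIV) < e"
    using assms(3) unfolding has_sum_def tendsto_iff by blast
  then obtain F where F: "finite F" "dist (sum f F) (infsum f UNIV) < e"
    unfolding eventually_finite_subsets_at_top by blast
  have "sum f G \<le> e" if G: "finite G" "G \<inter> F = {}" for G
  proof -
    have "sum f (F \<union> G) \<le> infsum f UNIV"
      using assms F G by (intro finite_sum_le_infsum) auto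
    moreover have "sum f (F \<union> G) = sum f F + sum f G"
      using F G by (intro sum.union_disjoint) auto
    ultimately show ?thesis using F(2) by (simp add: dist_real_def)
  qed
  then show ?thesis using F(1) by blast
qed

lemma weighted_norm_pairs:
  assumes "integrable torus w"
  shows "complex_of_real (LINT x|torus. w x * (norm (trig_poly F a x))\<^sup>2)
    = (\<Sum>p\<in>F \<times> F. a (fst p) * cnj (a (snd p)) * fourier_coeff (\<lambda>x. of_real (w x)) (snd p - fst p))"
  unfolding weighted_trig_poly_norm[OF assms] by (simp add: sum.cartesian_product split_def)

lemma large_radius_bound:
  assumes g: "weight M g" and M: "0 < M" and c: "0 < c" "0 < len"
    and lb: "\<forall>\<nu>. norm \<nu> = 1 \<longrightarrow> line_bound c (len *\<^sub>R \<nu>) g" and \<alpha>: "0 \<le> \<alpha>" "\<alpha> \<le> 1 / 2"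
    and sob: "(\<lambda>k. (1 + (norm (lattice_point k))\<^sup>2) powr (1 / 2 - \<alpha>) * (norm (fourier_coeff (\<lambda>x. of_real (g x)) k))\<^sup>2) summable_on UNIV"
  shows "\<exists>C>0. \<exists>R\<^sub>0\<ge>1. \<forall>R\<ge>R\<^sub>0. \<forall>S (a :: int \<times> int \<Rightarrow> complex). finite S \<and> (\<forall>k\<in>S. lattice_point k \<in> annulus R \<alpha>) \<longrightarrow>
    (\<Sum>k\<in>S. (norm (a k))\<^sup>2) \<le> C * (LINT x|torus. g x * (norm (trig_poly S a x))\<^sup>2)"
proof -
  have "\<exists>C>0. \<exists>R\<^sub>1>0. \<forall>g \<nu> R F G (a :: int \<times> int \<Rightarrow> complex).
    weight M g \<and> line_bound c (len *\<^sub>R \<nu>) g \<and> R\<^sub>1 \<le> R \<and> finite F \<and> finite G \<and> F \<inter> G = {} \<and>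
    (\<forall>k\<in>F. \<bar>lattice_point k \<bullet> \<nu> - R\<bar> \<le> 72) \<and> (\<forall>k\<in>G. \<bar>lattice_point k \<bullet> \<nu> + R\<bar> \<le> 72) \<longrightarrow>
    (\<Sum>k\<in>F \<union> G. (norm (a k))\<^sup>2) \<le> C * (LINT x|torus. g x * (norm (trig_poly (F \<union> G) a x))\<^sup>2)"
    by (rule logvinenko_sereda_antipodal[OF M c(1) _ c(2)]) simp
  then obtain C1 R1 where C1: "0 < C1" and R1: "0 < R1" and raw: "\<forall>g \<nu> R F G (a :: int \<times> int \<Rightarrow> complex).
    weight M g \<and> line_bound c (len *\<^sub>R \<nu>) g \<and> R1 \<le> R \<and> finite F \<and> finite G \<and> F \<inter> G = {} \<and>
    (\<forall>k\<in>F. \<bar>lattice_point k \<bullet> \<nu> - R\<bar> \<le> 72) \<and> (\<forall>k\<in>G. \<bar>lattice_point k \<bullet> \<nu> + R\<bar> \<le> 72) \<longrightarrow>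
    (\<Sum>k\<in>F \<union> G. (norm (a k))\<^sup>2) \<le> C1 * (LINT x|torus. g x * (norm (trig_poly (F \<union> G) a x))\<^sup>2)"
    by (elim exE conjE)
  have LS: "(\<Sum>k\<in>F \<union> G. (norm (a k))\<^sup>2) \<le> C1 * (LINT x|torus. g x * (norm (trig_poly (F \<union> G) a x))\<^sup>2)"
    if "norm \<nu> = 1" "R1 \<le> R" "finite F" "finite G" "F \<inter> G = {}"
      "\<forall>k\<in>F. \<bar>lattice_point k \<bullet> \<nu> - R\<bar> \<le> 72" "\<forall>k\<in>G. \<bar>lattice_point k \<bullet> \<nu> + R\<bar> \<le> 72"
    for \<nu> R F G and a :: "int \<times> int \<Rightarrow> complex"
    by (rule raw[THEN spec[of _ g], THEN spec[of _ \<nu>], THEN spec[of _ R], THEN spec[of _ F], THEN spec[of _ G], THEN spec[of _ a], THEN mp])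
      (intro conjI g lb[rule_format] that)
  \<comment> \<open>Removing \<open>E\<close> will cost \<open>(1 + 2 * M * C1) * X E\<close>, while
    \<open>X E \<le> X S / N\<close>; this choice keeps the cost at a quarter of
    \<open>X S\<close>.\<close>
  obtain N :: nat where N: "4 \<le> N" "4 * (1 + 2 * M * C1) \<le> real N"
  proof -
    obtain N :: nat where "4 * (1 + 2 * M * C1) < real N" using reals_Archimedean2 by blast
    then show ?thesis using that[of "max 4 N"] by auto
  qed
  define \<kappa> where "\<kappa> = 1 / (2 * real N)"
  have \<kappa>: "0 < \<kappa>" "\<kappa> \<le> 1" using N by (auto simp: \<kappa>_def)
  define Kset where "Kset R m = {k. lattice_point k \<in> annulus R \<alpha> \<and> lattice_point (k - m) \<in> annulus R \<alpha> \<and>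
      \<kappa> * sqrt R \<le> norm (lattice_point m) \<and> \<kappa> * sqrt R \<le> norm (lattice_point k + lattice_point (k - m))}" for R m
  obtain C2 R2 where C2: "0 < C2" and R2: "1 \<le> R2" and count: "\<And>R m. R2 \<le> R \<Longrightarrow> finite (Kset R m) \<and>
      real (card (Kset R m)) \<le> C2 * norm (lattice_point m) powr (1 - 2 * \<alpha>)"
    using annulus_pair_count[OF \<kappa> \<alpha>] unfolding Kset_def by blast
  define wh where "wh = fourier_coeff (\<lambda>x. complex_of_real (g x))"
  define sw where "sw k = (1 + (norm (lattice_point k))\<^sup>2) powr (1 / 2 - \<alpha>) * (norm (wh k))\<^sup>2" for k
  \<comment> \<open>The interaction of the caps contributes \<open>C1 * \<epsilon> * X S\<close>, a
    second quarter of \<open>X S\<close>; absorbing both quarters turns \<open>2 * C1\<close> into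
    the final constant \<open>4 * C1\<close>.\<close>
  define \<epsilon> where "\<epsilon> = 1 / (4 * C1)"
  have eps: "0 < \<epsilon>" using C1 by (simp add: \<epsilon>_def)
  have "\<exists>F. finite F \<and> (\<forall>G. finite G \<and> G \<inter> F = {} \<longrightarrow> sum sw G \<le> \<epsilon>\<^sup>2 / C2)"
  proof (rule summable_tail)
    show "sw summable_on UNIV" using sob unfolding sw_def[abs_def] wh_def .
    show "0 \<le> sw x" for x by (simp add: sw_def)
    show "0 < \<epsilon>\<^sup>2 / C2" using eps C2 by simp
  qed
  then obtain F0 where F0: "finite F0" "\<And>G. finite G \<Longrightarrow> G \<inter> F0 = {} \<Longrightarrow> sum sw G \<le> \<epsilon>\<^sup>2 / C2" by blast
  obtain B where B: "\<And>k. k \<in> F0 \<Longrightarrow> norm (lattice_point k) < B" "0 < B"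
  proof -
    have "finite ((\<lambda>k. norm (lattice_point k)) ` F0)" using F0(1) by simp
    then obtain b where "\<forall>y\<in>(\<lambda>k. norm (lattice_point k)) ` F0. y \<le> b" by (meson bdd_above_finite bdd_above_def)
    then show ?thesis using that[of "\<bar>b\<bar> + 1"] by (force intro: le_less_trans)
  qed
  \<comment> \<open>Differences between distinct groups have length at least
    \<open>\<kappa> * sqrt R\<close>, which is at least \<open>B\<close> from here on; so none of
    them lies in \<open>F0\<close>, and only the small tail is met.\<close>
  define R0 where "R0 = Max {R1, R2, (B / \<kappa>)\<^sup>2}"
  have R0: "R1 \<le> R0" "R2 \<le> R0" "(B / \<kappa>)\<^sup>2 \<le> R0" by (auto simp: R0_def)
  show ?thesis
  proof (rule exI[of _ "4 * C1"], rule conjI[rotated], rule exI[of _ R0], intro conjI allI impI)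
    show "0 < 4 * C1" using C1 by simp
    show "1 \<le> R0" using R2 R0 by linarith
    fix R S and a :: "int \<times> int \<Rightarrow> complex"
    assume RR: "R0 \<le> R" and "finite S \<and> (\<forall>k\<in>S. lattice_point k \<in> annulus R \<alpha>)"
    then have S: "finite S" and ann: "\<And>k. k \<in> S \<Longrightarrow> lattice_point k \<in> annulus R \<alpha>" by auto
    have R: "1 \<le> R" "R1 \<le> R" "R2 \<le> R" "(B / \<kappa>)\<^sup>2 \<le> R" using RR R0 R2 by auto
    have nrm: "R \<le> norm (lattice_point k) \<and> norm (lattice_point k) \<le> R + 1" if "k \<in> S" for k
      using annulus_norm[OF R(1) \<alpha>(1) ann[OF that]] by simp
    have BR: "B \<le> \<kappa> * sqrt R"
    proof -
      have "B / \<kappa> \<le> sqrt R" using R(4) by (rule real_le_rsqrt)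
      then show ?thesis using \<kappa> by (simp add: pos_divide_le_eq mult.commute)
    qed
    obtain E grp where E: "E \<subseteq> S" "real N * (\<Sum>k\<in>E. (norm (a k))\<^sup>2) \<le> (\<Sum>k\<in>S. (norm (a k))\<^sup>2)"
      and far: "\<And>k l. k \<in> S - E \<Longrightarrow> l \<in> S - E \<Longrightarrow> (grp k :: int) \<noteq> grp l \<Longrightarrow>
         sqrt R / (2 * real N) \<le> norm (lattice_point k - lattice_point l) \<and> sqrt R / (2 * real N) \<le> norm (lattice_point k + lattice_point l)"
      and near: "\<And>k l. k \<in> S - E \<Longrightarrow> l \<in> S - E \<Longrightarrow> grp k = grp l \<Longrightarrow>
         norm (lattice_point k - lattice_point l) \<le> 12 * sqrt R \<or> norm (lattice_point k + lattice_point l) \<le> 12 * sqrt R"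
      using sector_grouping[OF S N(1) R(1) nrm, of "\<lambda>k. (norm (a k))\<^sup>2"] by blast
    define T where "T = S - E"
    have T: "finite T" "T \<subseteq> S" using S by (auto simp: T_def)
    define X where "X F = (\<Sum>k\<in>F. (norm (a k))\<^sup>2)" for F
    define Y where "Y F = (LINT x|torus. g x * (norm (trig_poly F a x))\<^sup>2)" for F
    have X0: "0 \<le> X F" for F by (simp add: X_def sum_nonneg)
    have gi: "integrable torus (\<lambda>x. g x * (norm (trig_poly F a x))\<^sup>2)" for F
      using integrable_weight_trig_poly_sq[OF g, of 0] by simp
    have gint: "integrable torus g"
      by (rule integrable_torus_bounded[where B=M])
        (use g M in \<open>auto simp: weight_def intro!: borel_measurable_torus\<close>)
    have g0: "\<And>x. 0 \<le> g x" and gM: "\<And>x. g x \<le> M" using g unfolding weight_def by blast+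
    define Q where "Q P = (\<Sum>p\<in>P. a (fst p) * cnj (a (snd p)) * wh (snd p - fst p))" for P
    have YQ: "complex_of_real (Y F) = Q (F \<times> F)" for F
      unfolding Y_def Q_def wh_def by (rule weighted_norm_pairs[OF gint])
    define cap where "cap j = {k \<in> T. grp k = j}" for j
    have capf: "finite (cap j)" for j using T by (simp add: cap_def)
    have cap_bound: "X (cap j) \<le> C1 * Y (cap j)" if j: "j \<in> grp ` T" for j
    proof -
      obtain k0 where k0: "k0 \<in> T" "grp k0 = j" using j by blast
      define \<nu> where "\<nu> = (1 / norm (lattice_point k0)) *\<^sub>R lattice_point k0"
      have n0: "R \<le> norm (lattice_point k0)" using nrm k0 T by blast
      then have "lattice_point k0 \<noteq> 0" using R by auto
      then have nu: "norm \<nu> = 1" by (simp add: \<nu>_def)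
      \<comment> \<open>One frequency \<open>k0\<close> of the group fixes the direction; every
        other one is close to \<open>k0\<close> or to \<open>- k0\<close>, which gives the two
        antipodal pieces.\<close>
      define F where "F = {k \<in> cap j. norm (lattice_point k - lattice_point k0) \<le> 12 * sqrt R}"
      define G where "G = cap j - F"
      have FG: "cap j = F \<union> G" "F \<inter> G = {}" by (auto simp: F_def G_def)
      have "X (F \<union> G) \<le> C1 * Y (F \<union> G)"
        unfolding X_def Y_def
      proof (rule LS[OF nu R(2)])
        show "finite F" "finite G" using capf[of j] by (auto simp: F_def G_def)
        show "F \<inter> G = {}" by (rule FG)
        show "\<forall>k\<in>F. \<bar>lattice_point k \<bullet> \<nu> - R\<bar> \<le> 72"
        proof
          fix k assume k: "k \<in> F"
          then have "k \<in> S" using T by (auto simp: F_def cap_def)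
          then show "\<bar>lattice_point k \<bullet> \<nu> - R\<bar> \<le> 72"
            unfolding \<nu>_def using nrm[of k] n0 k by (intro cap_frequency R(1)) (auto simp: F_def)
        qed
        show "\<forall>k\<in>G. \<bar>lattice_point k \<bullet> \<nu> + R\<bar> \<le> 72"
        proof
          fix k assume k: "k \<in> G"
          then have kT: "k \<in> T" "grp k = grp k0" "\<not> norm (lattice_point k - lattice_point k0) \<le> 12 * sqrt R"
            using k0 by (auto simp: G_def F_def cap_def)
          then have kS: "k \<in> S" using T by auto
          have "norm (lattice_point k + lattice_point k0) \<le> 12 * sqrt R"
            using near[of k k0] kT k0 unfolding T_def by blast
          then have d: "norm (- lattice_point k - lattice_point k0) \<le> 12 * sqrt R"
            by (metis minus_add_distrib norm_minus_cancel uminus_add_conv_diff add.commute)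
          have "\<bar>(- lattice_point k) \<bullet> \<nu> - R\<bar> \<le> 72"
            unfolding \<nu>_def using nrm[OF kS] n0 d by (intro cap_frequency R(1)) auto
          then show "\<bar>lattice_point k \<bullet> \<nu> + R\<bar> \<le> 72" by (simp add: abs_le_iff)
        qed
      qed
      then show ?thesis by (simp only: FG)
    qed
    define P where "P = {p \<in> T \<times> T. grp (fst p) \<noteq> grp (snd p)}"
    have Pf: "finite P" using T by (simp add: P_def)
    have XT: "X T = (\<Sum>j\<in>grp ` T. X (cap j))"
      unfolding X_def cap_def using T by (intro sum.group[symmetric]) auto
    have QT: "Q (T \<times> T) = (\<Sum>j\<in>grp ` T. Q (cap j \<times> cap j)) + Q P"
    proof -
      define P' where "P' = {p \<in> T \<times> T. grp (fst p) = grp (snd p)}"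
      have P'f: "finite P'" using T by (simp add: P'_def)
      have "T \<times> T = P' \<union> P" "P' \<inter> P = {}" by (auto simp: P'_def P_def)
      then have "Q (T \<times> T) = Q P' + Q P"
        unfolding Q_def using P'f Pf by (simp add: sum.union_disjoint)
      also have "Q P' = (\<Sum>j\<in>grp ` T. Q {p \<in> P'. grp (fst p) = j})"
        unfolding Q_def using T P'f by (intro sum.group[symmetric]) (auto simp: P'_def)
      also have "\<dots> = (\<Sum>j\<in>grp ` T. Q (cap j \<times> cap j))"
      proof (rule sum.cong)
        fix j assume "j \<in> grp ` T"
        have "{p \<in> P'. grp (fst p) = j} = cap j \<times> cap j" by (auto simp: P'_def cap_def)
        then show "Q {p \<in> P'. grp (fst p) = j} = Q (cap j \<times> cap j)" by simp
      qed simp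
      finally show ?thesis .
    qed
    have off: "norm (Q P) \<le> \<epsilon> * X S"
    proof -
      define Ms where "Ms = (\<lambda>p. snd p - fst p) ` P"
      have Msf: "finite Ms" using Pf by (simp add: Ms_def)
      have sep: "\<kappa> * sqrt R \<le> norm (lattice_point (snd p - fst p)) \<and> snd p \<in> Kset R (snd p - fst p)" if p: "p \<in> P" for p
      proof -
        have in_T: "fst p \<in> S - E" "snd p \<in> S - E" "grp (snd p) \<noteq> grp (fst p)"
          using p by (auto simp: P_def T_def)
        have "\<kappa> * sqrt R \<le> norm (lattice_point (snd p) - lattice_point (fst p))" "\<kappa> * sqrt R \<le> norm (lattice_point (snd p) + lattice_point (fst p))"
          using far[OF in_T(2,1,3)] by (auto simp: \<kappa>_def)
        then show ?thesis using in_T ann by (auto simp: Kset_def lattice_point_diff)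
      qed
      \<comment> \<open>The coefficient depends only on the difference \<open>m\<close> of a pair,
        and for given \<open>m\<close> the second component determines the pair; so the multiplicity
        is bounded by the count of \<open>Kset R m\<close>.\<close>
      have "(\<Sum>p\<in>P. (norm (wh (snd p - fst p)))\<^sup>2) = (\<Sum>m\<in>Ms. \<Sum>p\<in>{p \<in> P. snd p - fst p = m}. (norm (wh (snd p - fst p)))\<^sup>2)"
        using Pf Msf by (intro sum.group[symmetric]) (auto simp: Ms_def)
      also have "\<dots> = (\<Sum>m\<in>Ms. real (card {p \<in> P. snd p - fst p = m}) * (norm (wh m))\<^sup>2)"
        by (intro sum.cong refl) simp
      also have "\<dots> \<le> (\<Sum>m\<in>Ms. C2 * sw m)"
      proof (rule sum_mono)
        fix m assume m: "m \<in> Ms"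
        have "card {p \<in> P. snd p - fst p = m} \<le> card (Kset R m)"
        proof (rule card_inj_on_le[where f=snd])
          show "inj_on snd {p \<in> P. snd p - fst p = m}"
          proof (rule inj_onI)
            fix p q assume "p \<in> {p \<in> P. snd p - fst p = m}" "q \<in> {p \<in> P. snd p - fst p = m}" "snd p = snd q"
            then have "snd p - fst p = snd p - fst q" "snd p = snd q" by auto
            then show "p = q" by (simp add: prod_eq_iff)
          qed
          show "snd ` {p \<in> P. snd p - fst p = m} \<subseteq> Kset R m" using sep by blast
          show "finite (Kset R m)" using count[OF R(3)] by blast
        qed
        then have "real (card {p \<in> P. snd p - fst p = m}) \<le> C2 * norm (lattice_point m) powr (1 - 2 * \<alpha>)"
          using count[OF R(3), of m] by linarith
        \<comment> \<open>The exponent of the count is \<open>2 * s\<close>, exactly what the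
          Sobolev weight can pay for.\<close>
        also have "\<dots> \<le> C2 * (1 + (norm (lattice_point m))\<^sup>2) powr (1 / 2 - \<alpha>)"
        proof (rule mult_left_mono)
          have "norm (lattice_point m) powr (1 - 2 * \<alpha>) = (norm (lattice_point m) powr 2) powr (1 / 2 - \<alpha>)"
            by (simp only: powr_powr) (simp add: algebra_simps)
          also have "\<dots> \<le> (1 + (norm (lattice_point m))\<^sup>2) powr (1 / 2 - \<alpha>)"
            using \<alpha> by (intro powr_mono2) (auto simp: powr_numeral)
          finally show "norm (lattice_point m) powr (1 - 2 * \<alpha>) \<le> (1 + (norm (lattice_point m))\<^sup>2) powr (1 / 2 - \<alpha>)" .
        qed (use C2 in simp)
        finally show "real (card {p \<in> P. snd p - fst p = m}) * (norm (wh m))\<^sup>2 \<le> C2 * sw m"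
          unfolding sw_def mult.assoc[symmetric] by (rule mult_right_mono) simp
      qed
      also have "\<dots> = C2 * sum sw Ms" by (simp add: sum_distrib_left)
      also have "\<dots> \<le> C2 * (\<epsilon>\<^sup>2 / C2)"
      proof (intro mult_left_mono F0(2) Msf)
        show "Ms \<inter> F0 = {}"
        proof (rule ccontr)
          assume "Ms \<inter> F0 \<noteq> {}"
          then obtain p where "p \<in> P" "snd p - fst p \<in> F0" by (auto simp: Ms_def)
          then show False using sep[of p] B(1)[of "snd p - fst p"] BR by linarith
        qed
      qed (use C2 in simp)
      also have "\<dots> = \<epsilon>\<^sup>2" using C2 by simp
      finally have "sqrt (\<Sum>p\<in>P. (norm (wh (snd p - fst p)))\<^sup>2) \<le> \<epsilon>"
        using eps by (intro real_le_lsqrt) (auto simp: sum_nonneg)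
      moreover have "P \<subseteq> S \<times> S" using T by (auto simp: P_def)
      ultimately show ?thesis
        using off_diagonal_bound[OF S \<open>P \<subseteq> S \<times> S\<close>, of a wh] mult_left_mono[of "sqrt (\<Sum>p\<in>P. (norm (wh (snd p - fst p)))\<^sup>2)" \<epsilon> "X S"] X0[of S]
        unfolding Q_def[symmetric] X_def[symmetric] by (simp add: mult.commute)
    qed
    have main: "X T \<le> C1 * (Y T + \<epsilon> * X S)"
    proof -
      have "complex_of_real (Y T) = complex_of_real (\<Sum>j\<in>grp ` T. Y (cap j)) + Q P"
        unfolding YQ QT of_real_sum ..
      then have "Y T = (\<Sum>j\<in>grp ` T. Y (cap j)) + Re (Q P)"
        by (metis Re_complex_of_real plus_complex.sel(1))
      moreover have "\<bar>Re (Q P)\<bar> \<le> norm (Q P)" by (rule abs_Re_le_cmod)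
      ultimately have "(\<Sum>j\<in>grp ` T. Y (cap j)) \<le> Y T + \<epsilon> * X S" using off by linarith
      then have "C1 * (\<Sum>j\<in>grp ` T. Y (cap j)) \<le> C1 * (Y T + \<epsilon> * X S)" using C1 by (intro mult_left_mono) auto
      moreover have "X T \<le> C1 * (\<Sum>j\<in>grp ` T. Y (cap j))"
        unfolding XT sum_distrib_left by (rule sum_mono) (rule cap_bound)
      ultimately show ?thesis by linarith
    qed
    have edge: "Y T \<le> 2 * Y S + 2 * M * X E"
    proof -
      have split: "trig_poly T a x = trig_poly S a x + (- trig_poly E a x)" for x
        unfolding T_def trig_poly_def using S E(1) by (simp add: sum_diff)
      have "Y T \<le> (LINT x|torus. 2 * (g x * (norm (trig_poly S a x))\<^sup>2) + 2 * M * (norm (trig_poly E a x))\<^sup>2)"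
        unfolding Y_def
      proof (intro integral_mono Bochner_Integration.integrable_add integrable_mult_right gi integrable_trig_poly_sq)
        fix x
        have "(norm (trig_poly T a x))\<^sup>2 \<le> 2 * (norm (trig_poly S a x))\<^sup>2 + 2 * (norm (trig_poly E a x))\<^sup>2"
          unfolding split using power2_norm_add_le[of "trig_poly S a x" "- trig_poly E a x"] by (simp only: norm_minus_cancel)
        then have "g x * (norm (trig_poly T a x))\<^sup>2 \<le> g x * (2 * (norm (trig_poly S a x))\<^sup>2 + 2 * (norm (trig_poly E a x))\<^sup>2)"
          using g0 by (rule mult_left_mono)
        also have "\<dots> \<le> 2 * (g x * (norm (trig_poly S a x))\<^sup>2) + 2 * M * (norm (trig_poly E a x))\<^sup>2"
          using mult_right_mono[OF gM[of x], of "2 * (norm (trig_poly E a x))\<^sup>2"] by (simp add: algebra_simps)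
        finally show "g x * (norm (trig_poly T a x))\<^sup>2 \<le> 2 * (g x * (norm (trig_poly S a x))\<^sup>2) + 2 * M * (norm (trig_poly E a x))\<^sup>2" .
      qed
      also have "\<dots> = 2 * Y S + 2 * M * X E"
        using finite_subset[OF E(1) S] by (simp add: gi integrable_trig_poly_sq parseval X_def Y_def)
      finally show ?thesis .
    qed
    have XS: "X S = X T + X E"
      unfolding T_def X_def using sum.subset_diff[OF E(1) S, of "\<lambda>k. (norm (a k))\<^sup>2"] by simp
    have E': "real N * X E \<le> X S" using E(2) by (simp add: X_def)
    have "4 * ((1 + 2 * M * C1) * X E) \<le> real N * X E"
      using N(2) X0[of E] by (simp only: mult.assoc[symmetric]) (rule mult_right_mono)
    then have e1: "(1 + 2 * M * C1) * X E \<le> X S / 4" using E' by linarith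
    have e2: "C1 * (\<epsilon> * X S) = X S / 4" using C1 by (simp add: \<epsilon>_def)
    have "X T \<le> C1 * (2 * Y S + 2 * M * X E + \<epsilon> * X S)"
      using main mult_left_mono[OF edge, of C1] C1 by (simp add: distrib_left)
    also have "\<dots> = 2 * C1 * Y S + 2 * M * C1 * X E + C1 * (\<epsilon> * X S)" by (simp add: algebra_simps)
    finally have "X S \<le> 2 * C1 * Y S + (1 + 2 * M * C1) * X E + X S / 4"
      unfolding e2 using XS by (simp add: distrib_right)
    then have "X S \<le> 4 * C1 * Y S" using e1 by linarith
    then show "(\<Sum>k\<in>S. (norm (a k))\<^sup>2) \<le> 4 * C1 * (LINT x|torus. g x * (norm (trig_poly S a x))\<^sup>2)"
      unfolding X_def Y_def .
  qed
qed

text \<open>A disc of frequencies projects onto an interval centred at 0 in every direction, so one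
  segment direction suffices; the constant may depend on the radius of the disc.\<close>

lemma bounded_radius_bound:
  assumes g: "weight M g" and M: "0 < M" and c: "0 < c" and lb: "line_bound c v g" and R: "0 \<le> R"
  shows "\<exists>C>0. \<forall>S (a :: int \<times> int \<Rightarrow> complex). finite S \<and> (\<forall>k\<in>S. norm (lattice_point k) \<le> R) \<longrightarrow>
    (\<Sum>k\<in>S. (norm (a k))\<^sup>2) \<le> C * (LINT x|torus. g x * (norm (trig_poly S a x))\<^sup>2)"
proof -
  have D: "0 \<le> R * norm v" using R by simp
  have freq: "\<bar>lattice_point k \<bullet> v - 0\<bar> \<le> R * norm v" if "norm (lattice_point k) \<le> R" for k
  proof -
    have "\<bar>lattice_point k \<bullet> v\<bar> \<le> norm (lattice_point k) * norm v" by (rule Cauchy_Schwarz_ineq2)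
    also have "\<dots> \<le> R * norm v" using that by (rule mult_right_mono) simp
    finally show ?thesis by simp
  qed
  from logvinenko_sereda[OF M c D]
  obtain C where C: "0 < C" and raw: "\<forall>g v' \<mu> F (a :: int \<times> int \<Rightarrow> complex).
    weight M g \<and> line_bound c v' g \<and> finite F \<and> (\<forall>k\<in>F. \<bar>lattice_point k \<bullet> v' - \<mu>\<bar> \<le> R * norm v) \<longrightarrow>
    (\<Sum>k\<in>F. (norm (a k))\<^sup>2) \<le> C * (LINT x|torus. g x * (norm (trig_poly F a x))\<^sup>2)"
    by (elim exE conjE)
  show ?thesis
  proof (rule exI[of _ C], intro conjI C allI impI)
    fix S and a :: "int \<times> int \<Rightarrow> complex"
    assume S: "finite S \<and> (\<forall>k\<in>S. norm (lattice_point k) \<le> R)"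
    show "(\<Sum>k\<in>S. (norm (a k))\<^sup>2) \<le> C * (LINT x|torus. g x * (norm (trig_poly S a x))\<^sup>2)"
      by (rule raw[THEN spec[of _ g], THEN spec[of _ v], THEN spec[of _ 0], THEN spec[of _ S], THEN spec[of _ a], THEN mp])
        (use g lb S freq in blast)
  qed
qed

theorem theorem1p2:
  fixes \<alpha> s :: real and \<gamma> :: "real \<times> real \<Rightarrow> real"
  assumes "0 \<le> \<alpha>" and "\<alpha> \<le> 1 / 2"
    and "s = 1 / 2 - \<alpha>"
    and "(\<lambda>x. complex_of_real (\<gamma> x)) \<in> sobolev_torus s \<inter> Linf_torus"
    and "AE x in torus. 0 \<le> \<gamma> x"
    and "generalized_GCC \<gamma>"
  shows "\<exists>C>0. \<forall>R\<ge>1. \<forall>f\<in>L2_torus.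
    lattice_point ` {k. fourier_coeff f k \<noteq> 0} \<subseteq> annulus R \<alpha> \<inter> range lattice_point \<longrightarrow>
    (L2_norm_torus f)\<^sup>2 \<le> C * (LINT x|torus. (norm (f x))\<^sup>2 * \<gamma> x)"
proof -
  have "(\<lambda>x. complex_of_real (\<gamma> x)) \<in> borel_measurable torus"
    using assms(4) by (simp add: Linf_torus_def)
  then have "(\<lambda>x. Re (complex_of_real (\<gamma> x))) \<in> borel_measurable torus"
    by measurable
  then have \<gamma>m: "\<gamma> \<in> borel_measurable torus" by simp
  obtain M0 where "AE x in torus. norm (complex_of_real (\<gamma> x)) \<le> M0"
    using assms(4) by (auto simp: Linf_torus_def)
  define M where "M = max 1 M0"
  have M: "0 < M" by (simp add: M_def)
  obtain g0 where g0[measurable]: "g0 \<in> borel_measurable borel" and \<gamma>g0: "AE x in torus. \<gamma> x = g0 x"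
    using borel_version_real[OF \<gamma>m] by blast
  \<comment> \<open>The Borel version made periodic by \<open>wrap\<close> and bounded everywhere by
    truncation; almost everywhere on the torus it still equals \<open>\<gamma>\<close>.\<close>
  define g where "g x = max 0 (min M (g0 (wrap x)))" for x
  have gm: "g \<in> borel_measurable borel" unfolding g_def by measurable
  have "periodic g"
    using periodic_compose_wrap[of "\<lambda>y. max 0 (min M (g0 y))"] unfolding g_def[abs_def] .
  moreover have "0 \<le> g x \<and> g x \<le> M" for x using M by (auto simp: g_def)
  ultimately have g: "weight M g" using gm unfolding weight_def by blast
  have "AE x in torus. x \<in> space torus" by simp
  then have \<gamma>g: "AE x in torus. \<gamma> x = g x"
    using \<gamma>g0 assms(5) \<open>AE x in torus. norm (complex_of_real (\<gamma> x)) \<le> M0\<close>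
  proof eventually_elim
    case (elim x)
    then have "wrap x = x" by (intro wrap_of_square) (simp add: space_torus)
    then show ?case using elim by (simp add: g_def M_def)
  qed
  have gmt: "g \<in> borel_measurable torus" by (rule borel_measurable_torus[OF gm])
  obtain c len where c: "0 < c" "0 < len" and lb: "\<forall>\<nu>. norm \<nu> = 1 \<longrightarrow> line_bound c (len *\<^sub>R \<nu>) g"
    using generalized_GCC_line_bound[OF assms(6) g \<gamma>m \<gamma>g] by blast
  have fc: "fourier_coeff (\<lambda>x. complex_of_real (\<gamma> x)) k = fourier_coeff (\<lambda>x. complex_of_real (g x)) k" for k
    unfolding fourier_coeff_chr
  proof (rule integral_cong_AE)
    have [measurable]: "chr (- k) \<in> borel_measurable torus" by (rule borel_measurable_torus) measurable
    note \<gamma>m[measurable] gmt[measurable]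
    show "(\<lambda>x. complex_of_real (\<gamma> x) * chr (- k) x) \<in> borel_measurable torus" by measurable
    show "(\<lambda>x. complex_of_real (g x) * chr (- k) x) \<in> borel_measurable torus" by measurable
    show "AE x in torus. complex_of_real (\<gamma> x) * chr (- k) x = complex_of_real (g x) * chr (- k) x"
      using \<gamma>g by eventually_elim simp
  qed
  have sob: "(\<lambda>k. (1 + (norm (lattice_point k))\<^sup>2) powr (1 / 2 - \<alpha>) * (norm (fourier_coeff (\<lambda>x. of_real (g x)) k))\<^sup>2) summable_on UNIV"
    using assms(3,4) by (simp add: sobolev_torus_def fc)
  from large_radius_bound[OF g M c lb assms(1,2) sob]
  obtain C1 R0 where C1: "0 < C1" and R0: "1 \<le> R0" and large: "\<forall>R\<ge>R0. \<forall>S (a :: int \<times> int \<Rightarrow> complex).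
      finite S \<and> (\<forall>k\<in>S. lattice_point k \<in> annulus R \<alpha>) \<longrightarrow>
      (\<Sum>k\<in>S. (norm (a k))\<^sup>2) \<le> C1 * (LINT x|torus. g x * (norm (trig_poly S a x))\<^sup>2)"
    by (elim exE conjE)
  have lb1: "line_bound c (len *\<^sub>R (1, 0)) g" by (rule lb[rule_format]) (simp add: norm_Pair)
  \<comment> \<open>Annuli of radius below \<open>R0\<close> lie in the disc of radius
    \<open>R0 + 1\<close>, since their width is at most 1.\<close>
  have "0 \<le> R0 + 1" using R0 by simp
  from bounded_radius_bound[OF g M c(1) lb1 this]
  obtain C2 where C2: "0 < C2" and small: "\<forall>S (a :: int \<times> int \<Rightarrow> complex).
      finite S \<and> (\<forall>k\<in>S. norm (lattice_point k) \<le> R0 + 1) \<longrightarrow>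
      (\<Sum>k\<in>S. (norm (a k))\<^sup>2) \<le> C2 * (LINT x|torus. g x * (norm (trig_poly S a x))\<^sup>2)"
    by (elim exE conjE)
  show ?thesis
  proof (rule exI[of _ "C1 + C2"], intro conjI allI impI ballI)
    show "0 < C1 + C2" using C1 C2 by simp
    fix R f assume R: "1 \<le> R" and f: "f \<in> L2_torus"
      and supp: "lattice_point ` {k. fourier_coeff f k \<noteq> 0} \<subseteq> annulus R \<alpha> \<inter> range lattice_point"
    define a where "a = fourier_coeff f"
    define S where "S = {k. a k \<noteq> 0}"
    have ann: "\<forall>k\<in>S. lattice_point k \<in> annulus R \<alpha>" using supp by (auto simp: S_def a_def)
    have nrm: "norm (lattice_point k) \<le> R + 1" if "k \<in> S" for k
      using annulus_norm(2)[OF R assms(1)] ann that by blast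
    have S: "finite S" by (rule finite_subset[OF _ finite_lattice_ball[of "R + 1"]]) (use nrm in auto)
    have ftp: "AE x in torus. f x = trig_poly S a x"
      unfolding a_def by (rule L2_torus_finite_spectrum[OF f S]) (auto simp: S_def a_def)
    have [measurable]: "f \<in> borel_measurable torus" using f by (simp add: L2_torus_def)
    have [measurable]: "trig_poly S a \<in> borel_measurable torus" by (rule borel_measurable_torus) measurable
    note \<gamma>m[measurable] gmt[measurable]
    have "(L2_norm_torus f)\<^sup>2 = (LINT x|torus. (norm (f x))\<^sup>2)"
      by (simp add: L2_norm_torus_def)
    also have "\<dots> = (LINT x|torus. (norm (trig_poly S a x))\<^sup>2)"
    proof (rule integral_cong_AE)
      show "AE x in torus. (norm (f x))\<^sup>2 = (norm (trig_poly S a x))\<^sup>2" using ftp by eventually_elim simp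
    qed measurable
    also have "\<dots> = (\<Sum>k\<in>S. (norm (a k))\<^sup>2)" by (rule parseval[OF S])
    finally have lhs: "(L2_norm_torus f)\<^sup>2 = (\<Sum>k\<in>S. (norm (a k))\<^sup>2)" .
    define Y where "Y = (LINT x|torus. g x * (norm (trig_poly S a x))\<^sup>2)"
    have rhs: "(LINT x|torus. (norm (f x))\<^sup>2 * \<gamma> x) = Y"
      unfolding Y_def
    proof (rule integral_cong_AE)
      show "AE x in torus. (norm (f x))\<^sup>2 * \<gamma> x = g x * (norm (trig_poly S a x))\<^sup>2"
        using ftp \<gamma>g by eventually_elim simp
    qed measurable
    have Y0: "0 \<le> Y" unfolding Y_def using g by (intro integral_nonneg_AE) (auto simp: weight_def)
    have "(\<Sum>k\<in>S. (norm (a k))\<^sup>2) \<le> (C1 + C2) * Y"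
    proof (cases "R0 \<le> R")
      case True
      have "(\<Sum>k\<in>S. (norm (a k))\<^sup>2) \<le> C1 * Y" unfolding Y_def
        by (rule large[THEN spec[of _ R], THEN mp, THEN spec[of _ S], THEN spec[of _ a], THEN mp]) (intro True conjI S ann)+
      then show ?thesis using C2 Y0 by (simp add: distrib_right add_increasing2)
    next
      case False
      have "(\<Sum>k\<in>S. (norm (a k))\<^sup>2) \<le> C2 * Y"
        unfolding Y_def
      proof (rule small[THEN spec[of _ S], THEN spec[of _ a], THEN mp], intro conjI S ballI)
        fix k assume "k \<in> S"
        then show "norm (lattice_point k) \<le> R0 + 1" using nrm[of k] False by linarith
      qed
      then show ?thesis using C1 Y0 by (simp add: distrib_right add_increasing)
    qed
    then show "(L2_norm_torus f)\<^sup>2 \<le> (C1 + C2) * (LINT x|torus. (norm (f x))\<^sup>2 * \<gamma> x)"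
      unfolding lhs rhs .
  qed
qed

end
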